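(* Let $Q$ be a finite connected acyclic quiver, $\Lambda$ its complete preprojective algebra, $w$ an element of the Coxeter group $W_Q$ and $\mathbf{w}=s_{u_1}s_{u_2}\cdots s_{u_l}$ a reduced expression of $w$, with layers $L^1_{\mathbf{w}},\ldots,L^l_{\mathbf{w}}$. Then: \begin{enumerate} \item If there exists a Coxeter element $c$ such that $w$ is $c$-sortable and $\mathbf{w}$ is the $c$-sortable expression of $w$, then $L^j_{\mathbf{w}}$ is in $\mathrm{mod}\,kQ$ for all $j=1,\ldots,l$, where $Q$ is taken with the orientation for which $c$ is admissible. \item If for all $j=1,\ldots,l$ the layer $L^j_{\mathbf{w}}$ is in $\mathrm{mod}\,kQ$ for a certain (acyclic) orientation of $Q$, then $w$ is $c$-sortable, where $c$ is the Coxeter element admissible with respect to this orientation of $Q$. \end{enumerate}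
   Context: $k$ is an algebraically closed field; modules are right modules. $Q$ has vertex set $Q_0=\{1,\ldots,n\}$, and $m_{ij}$ is the number of arrows between $i$ and $j$ (in either direction). Paths are multiplied so that an arrow $a:i\to j$ satisfies $a=e_jae_i$. The Coxeter group $W_Q$ has generators $s_1,\ldots,s_n$ and relations $s_i^2=1$, $s_is_j=s_js_i$ if $m_{ij}=0$, $s_is_js_i=s_js_is_j$ if $m_{ij}=1$. An expression of an element is reduced if its length is smallest possible. The preprojective algebra is $k\overline{Q}/\langle\sum_{a\in Q_1}(aa^*-a^*a)\rangle$, where $\overline{Q}$ is obtained from $Q$ by adding for each arrow $a:i\to j$ an arrow $a^*:j\to i$; $\Lambda$ is its completion. Let $I_i:=\Lambda(1-e_i)\Lambda$, and for a word $\mathbf{v}=s_{v_1}\cdots s_{v_r}$ put $I_{\mathbf{v}}:=I_{v_r}\cdots I_{v_1}$. The layer is $L^j_{\mathbf{w}}:=\dfrac{I_{u_{j-1}}\cdots I_{u_1}}{I_{u_j}\cdots I_{u_1}}$ (empty product equal to $\Lambda$). A Coxeter element $c=s_{v_1}\cdots s_{v_n}$ is a product of all the generators, each appearing exactly once; it is admissible with respect to an orientation if $i<j$ whenever there is an arrow $v_i\to v_j$. Both $W_Q$ and (up to an isomorphism changing signs of arrows) $\Lambda$ depend only on the underlying graph of $Q$. For an acyclic orientation, with admissible Coxeter element $c$, one has $\Lambda/I_c\simeq kQ$, and a $\Lambda$-module is said to be in $\mathrm{mod}\,kQ$ if it is (finite dimensional and) annihilated by $I_c$. Fix a reduced word for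 $c$. An element $w\in W_Q$ is $c$-sortable if it has a reduced expression of the form $c^{(0)}c^{(1)}\cdots c^{(m)}$ where all $c^{(t)}$ are subwords of $c$ with supports satisfying $\mathrm{supp}(c^{(m)})\subseteq\cdots\subseteq\mathrm{supp}(c^{(1)})\subseteq\mathrm{supp}(c^{(0)})\subseteq Q_0$. This expression is unique and is called the $c$-sortable expression of $w$; $c$-sortability does not depend on the reduced expression of $c$. *)

theory Defs
  imports
    "HOL-Computational_Algebra.Polynomial"
    Graph_Theory.Digraph_Component
    Graph_Theory.Arc_Walk
    "HOL-Algebra.Ideal_Product"
    "HOL-Algebra.QuotRing"
    "HOL-Algebra.Module"
    "HOL-Library.Sublist"
begin

section \<open>Quivers and path algebras\<close>

text \<open>
  A quiver is a (multi-)digraph with named arcs.  A path is a pair of its start vertex and the list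
  of its arcs in the order in which they are traversed; the trivial path at \<open>i\<close> is \<open>(i, [])\<close>.
\<close>

type_synonym ('v, 'a) path = "'v \<times> 'a list"

definition paths :: "('v, 'a) pre_digraph \<Rightarrow> ('v, 'a) path set" where
  "paths G = {(i, p). \<exists>j. pre_digraph.awalk G i p j}"

text \<open>
  Elements are finitely supported coefficient functions on paths.  In a product of paths the right
  factor is traversed first, so that an arrow \<open>a : i \<rightarrow> j\<close> satisfies \<open>a = e\<^sub>j a e\<^sub>i\<close>; hence the
  coefficient of \<open>f g\<close> at a path is a sum over its splittings into an initial part (seen by \<open>g\<close>)
  and a final part (seen by \<open>f\<close>).  The argument \<open>k\<close> only names the type of coefficients.
\<close>

definition path_algebra ::
    "'k::field itself \<Rightarrow> ('v, 'a) pre_digraph \<Rightarrow> (('v, 'a) path \<Rightarrow> 'k) ring" where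
  "path_algebra k G =
    \<lparr>carrier = {f. finite {x. f x \<noteq> 0} \<and> {x. f x \<noteq> 0} \<subseteq> paths G},
     mult = (\<lambda>f g. \<lambda>(i, p). \<Sum>n\<le>length p.
       f (pre_digraph.awlast G i (take n p), drop n p) * g (i, take n p)),
     one = (\<lambda>(i, p). if i \<in> verts G \<and> p = [] then 1 else 0),
     zero = (\<lambda>_. 0),
     add = (\<lambda>f g x. f x + g x)\<rparr>"

definition of_path :: "('v, 'a) path \<Rightarrow> ('v, 'a) path \<Rightarrow> 'k::field" where
  "of_path x = (\<lambda>y. if y = x then 1 else 0)"

definition of_arrow :: "('v, 'a) pre_digraph \<Rightarrow> 'a \<Rightarrow> ('v, 'a) path \<Rightarrow> 'k::field" where
  "of_arrow G a = of_path (tail G a, [a])"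

definition of_scalar :: "('v, 'a) pre_digraph \<Rightarrow> 'k::field \<Rightarrow> ('v, 'a) path \<Rightarrow> 'k" where
  "of_scalar G t = (\<lambda>(i, p). if i \<in> verts G \<and> p = [] then t else 0)"

section \<open>The complete preprojective algebra\<close>

text \<open>In the double quiver, \<open>Inl a\<close> is the arrow \<open>a\<close> of \<open>Q\<close> and \<open>Inr a\<close> is \<open>a\<^sup>*\<close>.\<close>

definition double_quiver :: "('v, 'a) pre_digraph \<Rightarrow> ('v, 'a + 'a) pre_digraph" where
  "double_quiver Q =
    \<lparr>verts = verts Q,
     arcs = arcs Q <+> arcs Q,
     tail = case_sum (tail Q) (head Q),
     head = case_sum (head Q) (tail Q)\<rparr>"

definition preprojective_relation ::
    "'k::field itself \<Rightarrow> ('v, 'a) pre_digraph \<Rightarrow> ('v, 'a + 'a) path \<Rightarrow> 'k" where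
  "preprojective_relation k Q =
    (let R = path_algebra k (double_quiver Q); x = of_arrow (double_quiver Q)
     in \<Oplus>\<^bsub>R\<^esub>a\<in>arcs Q. x (Inl a) \<otimes>\<^bsub>R\<^esub> x (Inr a) \<ominus>\<^bsub>R\<^esub> x (Inr a) \<otimes>\<^bsub>R\<^esub> x (Inl a))"

definition preprojective_ideal ::
    "'k::field itself \<Rightarrow> ('v, 'a) pre_digraph \<Rightarrow> (('v, 'a + 'a) path \<Rightarrow> 'k) set" where
  "preprojective_ideal k Q =
    Idl\<^bsub>path_algebra k (double_quiver Q)\<^esub> {preprojective_relation k Q}"

definition preprojective ::
    "'k::field itself \<Rightarrow> ('v, 'a) pre_digraph \<Rightarrow> (('v, 'a + 'a) path \<Rightarrow> 'k) set ring" where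
  "preprojective k Q = path_algebra k (double_quiver Q) Quot preprojective_ideal k Q"

definition to_preprojective ::
    "'k::field itself \<Rightarrow> ('v, 'a) pre_digraph \<Rightarrow>
     (('v, 'a + 'a) path \<Rightarrow> 'k) \<Rightarrow> (('v, 'a + 'a) path \<Rightarrow> 'k) set" where
  "to_preprojective k Q f =
    preprojective_ideal k Q +>\<^bsub>path_algebra k (double_quiver Q)\<^esub> f"

definition arrow_ideal ::
    "'k::field itself \<Rightarrow> ('v, 'a) pre_digraph \<Rightarrow> (('v, 'a + 'a) path \<Rightarrow> 'k) set set" where
  "arrow_ideal k Q =
    Idl\<^bsub>preprojective k Q\<^esub>
      ((\<lambda>b. to_preprojective k Q (of_arrow (double_quiver Q) b)) ` arcs (double_quiver Q))"

definition ideal_power :: "('r, 'm) ring_scheme \<Rightarrow> 'r set \<Rightarrow> nat \<Rightarrow> 'r set" where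
  "ideal_power R J m = ((\<lambda>I. J \<cdot>\<^bsub>R\<^esub> I) ^^ m) (carrier R)"

text \<open>
  The inverse limit of the rings \<open>R / J\<^sup>m\<close>.  Its elements are sequences of cosets; for cosets
  \<open>X\<close> of \<open>J\<^sup>m\<^sup>+\<^sup>1\<close> and \<open>Y\<close> of \<open>J\<^sup>m\<close>, inclusion \<open>X \<subseteq> Y\<close> says that \<open>X\<close> is mapped to \<open>Y\<close> by the
  canonical projection.
\<close>

definition adic_completion :: "('r, 'm) ring_scheme \<Rightarrow> 'r set \<Rightarrow> (nat \<Rightarrow> 'r set) ring" where
  "adic_completion R J =
    \<lparr>carrier = {x. (\<forall>m. x m \<in> carrier (R Quot ideal_power R J m)) \<and> (\<forall>m. x (Suc m) \<subseteq> x m)},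
     mult = (\<lambda>x y m. x m \<otimes>\<^bsub>R Quot ideal_power R J m\<^esub> y m),
     one = (\<lambda>m. \<one>\<^bsub>R Quot ideal_power R J m\<^esub>),
     zero = (\<lambda>m. \<zero>\<^bsub>R Quot ideal_power R J m\<^esub>),
     add = (\<lambda>x y m. x m \<oplus>\<^bsub>R Quot ideal_power R J m\<^esub> y m)\<rparr>"

type_synonym ('k, 'v, 'a) cpp = "nat \<Rightarrow> (('v, 'a + 'a) path \<Rightarrow> 'k) set set"

definition complete_preprojective ::
    "'k::field itself \<Rightarrow> ('v, 'a) pre_digraph \<Rightarrow> ('k, 'v, 'a) cpp ring" where
  "complete_preprojective k Q = adic_completion (preprojective k Q) (arrow_ideal k Q)"

definition to_complete_preprojective ::
    "'k::field itself \<Rightarrow> ('v, 'a) pre_digraph \<Rightarrow>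
     (('v, 'a + 'a) path \<Rightarrow> 'k) \<Rightarrow> ('k, 'v, 'a) cpp" where
  "to_complete_preprojective k Q f =
    (\<lambda>m. ideal_power (preprojective k Q) (arrow_ideal k Q) m
           +>\<^bsub>preprojective k Q\<^esub> to_preprojective k Q f)"

definition idempotent ::
    "'k::field itself \<Rightarrow> ('v, 'a) pre_digraph \<Rightarrow> 'v \<Rightarrow> ('k, 'v, 'a) cpp" where
  "idempotent k Q i = to_complete_preprojective k Q (of_path (i, []))"

definition scalar ::
    "'k::field itself \<Rightarrow> ('v, 'a) pre_digraph \<Rightarrow> 'k \<Rightarrow> ('k, 'v, 'a) cpp" where
  "scalar k Q t = to_complete_preprojective k Q (of_scalar (double_quiver Q) t)"

section \<open>Ideals attached to words, and layers\<close>

definition vertex_ideal ::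
    "'k::field itself \<Rightarrow> ('v, 'a) pre_digraph \<Rightarrow> 'v \<Rightarrow> ('k, 'v, 'a) cpp set" where
  "vertex_ideal k Q i =
    (let \<Lambda> = complete_preprojective k Q in Idl\<^bsub>\<Lambda>\<^esub> {\<one>\<^bsub>\<Lambda>\<^esub> \<ominus>\<^bsub>\<Lambda>\<^esub> idempotent k Q i})"

text \<open>The word \<open>s\<^sub>v\<^sub>1 \<dots> s\<^sub>v\<^sub>r\<close> is the list \<open>[v\<^sub>1, \<dots>, v\<^sub>r]\<close>; its ideal is \<open>I\<^sub>v\<^sub>r \<dots> I\<^sub>v\<^sub>1\<close>, in reverse order.\<close>

definition word_ideal ::
    "'k::field itself \<Rightarrow> ('v, 'a) pre_digraph \<Rightarrow> 'v list \<Rightarrow> ('k, 'v, 'a) cpp set" where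
  "word_ideal k Q v =
    (let \<Lambda> = complete_preprojective k Q
     in fold (\<lambda>i I. vertex_ideal k Q i \<cdot>\<^bsub>\<Lambda>\<^esub> I) v (carrier \<Lambda>))"

text \<open>
  Right modules are represented by the record \<open>module\<close>, where \<open>r \<odot> x\<close> stands for \<open>x\<close> acted
  upon by \<open>r\<close> from the right. The fields \<open>mult\<close> and \<open>one\<close> are irrelevant.  The locale \<open>module\<close>
  (over commutative rings) is not used.
\<close>

definition quotient_right_module ::
    "('r, 'm) ring_scheme \<Rightarrow> 'r set \<Rightarrow> 'r set \<Rightarrow> ('r, 'r set) module" where
  "quotient_right_module R I J =
    \<lparr>carrier = (\<lambda>x. J +>\<^bsub>R\<^esub> x) ` I,
     mult = undefined,
     one = undefined,
     zero = J,
     add = set_add R,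
     smult = (\<lambda>r X. \<Union>x\<in>X. J +>\<^bsub>R\<^esub> (x \<otimes>\<^bsub>R\<^esub> r))\<rparr>"

definition layer ::
    "'k::field itself \<Rightarrow> ('v, 'a) pre_digraph \<Rightarrow> 'v list \<Rightarrow> nat \<Rightarrow>
     (('k, 'v, 'a) cpp, ('k, 'v, 'a) cpp set) module" where
  "layer k Q u j =
    quotient_right_module (complete_preprojective k Q)
      (word_ideal k Q (take (j - 1) u)) (word_ideal k Q (take j u))"

definition finite_dimensional ::
    "'k::field itself \<Rightarrow> ('v, 'a) pre_digraph \<Rightarrow> (('k, 'v, 'a) cpp, 'm) module \<Rightarrow> bool" where
  "finite_dimensional k Q M \<longleftrightarrow>
    (\<exists>B. finite B \<and> B \<subseteq> carrier M \<and>
      (\<forall>x\<in>carrier M. \<exists>t. x = (\<Oplus>\<^bsub>M\<^esub>b\<in>B. scalar k Q (t b) \<odot>\<^bsub>M\<^esub> b)))"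

definition annihilated_by :: "('r, 'm) module \<Rightarrow> 'r set \<Rightarrow> bool" where
  "annihilated_by M I \<longleftrightarrow> (\<forall>x\<in>carrier M. \<forall>r\<in>I. r \<odot>\<^bsub>M\<^esub> x = \<zero>\<^bsub>M\<^esub>)"

section \<open>The Coxeter group\<close>

definition num_arrows :: "('v, 'a) pre_digraph \<Rightarrow> 'v \<Rightarrow> 'v \<Rightarrow> nat" where
  "num_arrows Q i j =
    card {a \<in> arcs Q. (tail Q a = i \<and> head Q a = j) \<or> (tail Q a = j \<and> head Q a = i)}"

text \<open>
  The congruence on words in the generators that is generated by the defining relations.  As the
  generators are involutions, the quotient of the free monoid is the group with this presentation.
\<close>

inductive coxeter_equiv :: "('v, 'a) pre_digraph \<Rightarrow> 'v list \<Rightarrow> 'v list \<Rightarrow> bool" for Q where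
  square: "i \<in> verts Q \<Longrightarrow> coxeter_equiv Q [i, i] []"
| commute: "\<lbrakk>i \<in> verts Q; j \<in> verts Q; num_arrows Q i j = 0\<rbrakk> \<Longrightarrow> coxeter_equiv Q [i, j] [j, i]"
| braid: "\<lbrakk>i \<in> verts Q; j \<in> verts Q; num_arrows Q i j = 1\<rbrakk> \<Longrightarrow> coxeter_equiv Q [i, j, i] [j, i, j]"
| refl: "x \<in> lists (verts Q) \<Longrightarrow> coxeter_equiv Q x x"
| sym: "coxeter_equiv Q x y \<Longrightarrow> coxeter_equiv Q y x"
| trans: "\<lbrakk>coxeter_equiv Q x y; coxeter_equiv Q y z\<rbrakk> \<Longrightarrow> coxeter_equiv Q x z"
| append: "\<lbrakk>coxeter_equiv Q x x'; coxeter_equiv Q y y'\<rbrakk> \<Longrightarrow> coxeter_equiv Q (x @ y) (x' @ y')"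

definition coxeter_group :: "('v, 'a) pre_digraph \<Rightarrow> 'v list set monoid" where
  "coxeter_group Q =
    \<lparr>carrier = lists (verts Q) // {(x, y). coxeter_equiv Q x y},
     mult = (\<lambda>X Y. {z. \<exists>x\<in>X. \<exists>y\<in>Y. coxeter_equiv Q (x @ y) z}),
     one = {z. coxeter_equiv Q [] z}\<rparr>"

definition generator :: "('v, 'a) pre_digraph \<Rightarrow> 'v \<Rightarrow> 'v list set" where
  "generator Q i = {z. coxeter_equiv Q [i] z}"

definition is_expression :: "('v, 'a) pre_digraph \<Rightarrow> 'v list set \<Rightarrow> 'v list \<Rightarrow> bool" where
  "is_expression Q w u \<longleftrightarrow>
    u \<in> lists (verts Q) \<and>
    w = foldr (\<lambda>i x. generator Q i \<otimes>\<^bsub>coxeter_group Q\<^esub> x) u \<one>\<^bsub>coxeter_group Q\<^esub>"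

definition reduced_expression :: "('v, 'a) pre_digraph \<Rightarrow> 'v list set \<Rightarrow> 'v list \<Rightarrow> bool" where
  "reduced_expression Q w u \<longleftrightarrow>
    is_expression Q w u \<and> (\<forall>u'. is_expression Q w u' \<longrightarrow> length u \<le> length u')"

section \<open>Coxeter elements, orientations and sortability\<close>

definition coxeter_word :: "('v, 'a) pre_digraph \<Rightarrow> 'v list \<Rightarrow> bool" where
  "coxeter_word Q v \<longleftrightarrow> distinct v \<and> set v = verts Q"

definition coxeter_element :: "('v, 'a) pre_digraph \<Rightarrow> 'v list set \<Rightarrow> bool" where
  "coxeter_element Q c \<longleftrightarrow> (\<exists>v. coxeter_word Q v \<and> is_expression Q c v)"

definition is_orientation :: "('v, 'a) pre_digraph \<Rightarrow> ('v, 'a) pre_digraph \<Rightarrow> bool" where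
  "is_orientation Q Q' \<longleftrightarrow>
    verts Q' = verts Q \<and> arcs Q' = arcs Q \<and>
    (\<forall>a\<in>arcs Q. (tail Q' a = tail Q a \<and> head Q' a = head Q a) \<or>
                (tail Q' a = head Q a \<and> head Q' a = tail Q a))"

definition admissible_word :: "('v, 'a) pre_digraph \<Rightarrow> 'v list \<Rightarrow> bool" where
  "admissible_word Q' v \<longleftrightarrow>
    coxeter_word Q' v \<and>
    (\<forall>i<length v. \<forall>j<length v. (v ! i, v ! j) \<in> arcs_ends Q' \<longrightarrow> i < j)"

definition admissible :: "('v, 'a) pre_digraph \<Rightarrow> 'v list set \<Rightarrow> bool" where
  "admissible Q' c \<longleftrightarrow> (\<exists>v. admissible_word Q' v \<and> is_expression Q' c v)"

text \<open>
  For an orientation \<open>Q'\<close> of \<open>Q\<close>, the right modules over the complete preprojective algebra of \<open>Q\<close>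
  that lie in the category of finite dimensional modules over the path algebra of \<open>Q'\<close>: the latter
  is the quotient by \<open>I\<^sub>c\<close>, where \<open>c\<close> is admissible with respect to \<open>Q'\<close>.
\<close>

definition in_mod_path_algebra ::
    "'k::field itself \<Rightarrow> ('v, 'a) pre_digraph \<Rightarrow> ('v, 'a) pre_digraph \<Rightarrow>
     (('k, 'v, 'a) cpp, 'm) module \<Rightarrow> bool" where
  "in_mod_path_algebra k Q Q' M \<longleftrightarrow>
    finite_dimensional k Q M \<and>
    (\<exists>v. admissible_word Q' v \<and> annihilated_by M (word_ideal k Q v))"

text \<open>
  \<open>u\<close> is the \<open>c\<close>-sortable expression of \<open>w\<close>, where \<open>v\<close> is the chosen reduced word of the Coxeter
  element \<open>c\<close>.
\<close>

definition sortable_expression ::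
    "('v, 'a) pre_digraph \<Rightarrow> 'v list \<Rightarrow> 'v list set \<Rightarrow> 'v list \<Rightarrow> bool" where
  "sortable_expression Q v w u \<longleftrightarrow>
    reduced_expression Q w u \<and>
    (\<exists>cs. cs \<noteq> [] \<and> u = concat cs \<and> (\<forall>x\<in>set cs. subseq x v) \<and>
          sorted_wrt (\<lambda>x y. set y \<subseteq> set x) cs)"

definition sortable :: "('v, 'a) pre_digraph \<Rightarrow> 'v list \<Rightarrow> 'v list set \<Rightarrow> bool" where
  "sortable Q v w \<longleftrightarrow> (\<exists>u. sortable_expression Q v w u)"

end

(*
The layer after a prefix x with next letter i is I_x / I_i I_x, and it lies in mod kQ iff
I_x I_c <= I_i I_x. If s is the first letter of c and c' is the rotated Coxeter word, then
I_s I_c = I_c' I_s. Part (1) follows by reading a sortable word against c, each time either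
rotating c or dropping a letter that no longer occurs.

For part (2) the rotation has to be undone, that is, I_s has to be cancelled on the right.
This works when the simple module at s does not map nontrivially to Lambda / I_v, which holds
whenever the word s v is reduced: by induction one splits off a longest word in s and one other
letter using braid moves only, and in rank two a homomorphism from the simple module is extended
along reflections of the Kronecker quiver until it reaches a quotient without such homomorphisms.
If the first vertex s of the orientation does not occur in x, lying in mod kQ forces a next letter
s to commute with x.

All ideals involved contain a power of the arrow ideal, so the computations can be done in the
path algebra of the double quiver. That every reduced word of an admissible Coxeter element is
admissible is seen in the reflection representation.
*)
theory Submission
  imports
    Defs
    "HOL-Library.Function_Algebras"
begin

section \<open>Words in the Coxeter group\<close>

text \<open>In the path algebra an element has coefficients, but its class modulo the relation
  \<open>rho\<close> has none. The device against this is to remove the first arrow of every path: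
  along \<open>c\<close> this turns \<open>z * rho\<close> into a signed \<open>z * dual c\<close>.
  Membership in \<open>X I_t\<close> modulo the relations then means that one witness
  \<open>z\<close> corrects the quotients along all arrows leaving \<open>t\<close> at once. The
  commutation and braid relations of the vertex ideals come from changing such witnesses, and in
  rank two the witnesses are themselves the values of a homomorphism from the reflected Kronecker
  module.

  Cancelling \<open>I_s\<close> is an obstacle only for products \<open>f d\<close> with
  \<open>d\<close> an arrow starting at \<open>s\<close>: all other columns are left alone by
  \<open>I_s\<close>. Every arrow into \<open>s\<close> is reversed when \<open>s\<close> comes
  first, so these products are killed by all of them, and that is exactly the situation of a simple
  submodule at \<open>s\<close>.

  Reducedness is used in the form that braid moves never produce a repeated letter. This form passes
  to factors of a word, and a minimal choice among braid-equivalent words then plays the role of the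
  decomposition along a dihedral subgroup.\<close>

inductive braid_move :: "('v, 'a) pre_digraph \<Rightarrow> 'v list \<Rightarrow> 'v list \<Rightarrow> bool" for Q where
  commute: "\<lbrakk>i \<in> verts Q; j \<in> verts Q; num_arrows Q i j = 0\<rbrakk>
    \<Longrightarrow> braid_move Q (p @ [i, j] @ q) (p @ [j, i] @ q)"
| braid: "\<lbrakk>i \<in> verts Q; j \<in> verts Q; num_arrows Q i j = 1\<rbrakk>
    \<Longrightarrow> braid_move Q (p @ [i, j, i] @ q) (p @ [j, i, j] @ q)"

abbreviation braid_equiv :: "('v, 'a) pre_digraph \<Rightarrow> 'v list \<Rightarrow> 'v list \<Rightarrow> bool" where
  "braid_equiv Q \<equiv> (braid_move Q)\<^sup>*\<^sup>*"

text \<open>Tits' description of reduced words, taken as a definition because it is visibly stable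
  under braid moves and under passage to factors.\<close>

definition braid_reduced :: "('v, 'a) pre_digraph \<Rightarrow> 'v list \<Rightarrow> bool" where
  "braid_reduced Q x \<longleftrightarrow> (\<forall>p i q. \<not> braid_equiv Q x (p @ [i, i] @ q))"

lemma num_arrows_commute: "num_arrows Q i j = num_arrows Q j i"
  unfolding num_arrows_def by (rule arg_cong[where f = card]) auto

lemma braid_move_context: "braid_move Q x y \<Longrightarrow> braid_move Q (p @ x @ q) (p @ y @ q)"
proof (induction rule: braid_move.induct)
  case (commute i j p' q')
  then show ?case using braid_move.commute[of i Q j "p @ p'" "q' @ q"] by simp
next
  case (braid i j p' q')
  then show ?case using braid_move.braid[of i Q j "p @ p'" "q' @ q"] by simp
qed

lemma braid_equiv_context: "braid_equiv Q x y \<Longrightarrow> braid_equiv Q (p @ x @ q) (p @ y @ q)"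
  by (induction rule: rtranclp_induct) (auto intro: braid_move_context rtranclp.rtrancl_into_rtrancl)

lemma braid_equiv_Cons: "braid_equiv Q x y \<Longrightarrow> braid_equiv Q (s # x) (s # y)"
  using braid_equiv_context[of Q x y "[s]" "[]"] by simp

lemma braid_equiv_snoc: "braid_equiv Q x y \<Longrightarrow> braid_equiv Q (x @ [s]) (y @ [s])"
  using braid_equiv_context[of Q x y "[]" "[s]"] by simp

lemma braid_move_set: "braid_move Q x y \<Longrightarrow> set y = set x \<and> length y = length x"
  by (induction rule: braid_move.induct) auto

lemma braid_equiv_set: "braid_equiv Q x y \<Longrightarrow> set y = set x \<and> length y = length x"
  by (induction rule: rtranclp_induct) (auto dest: braid_move_set)

lemma braid_reduced_equiv: "braid_reduced Q x \<Longrightarrow> braid_equiv Q x y \<Longrightarrow> braid_reduced Q y"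
  unfolding braid_reduced_def by (meson rtranclp_trans)

lemma braid_reduced_infix: "braid_reduced Q (p @ x @ q) \<Longrightarrow> braid_reduced Q x"
  unfolding braid_reduced_def
proof (intro allI notI)
  fix p' i q'
  assume *: "\<forall>p' i q'. \<not> braid_equiv Q (p @ x @ q) (p' @ [i, i] @ q')" "braid_equiv Q x (p' @ [i, i] @ q')"
  then have "braid_equiv Q (p @ x @ q) ((p @ p') @ [i, i] @ (q' @ q))"
    using braid_equiv_context[OF *(2), of p q] by simp
  then show False using *(1) by blast
qed

lemma braid_reduced_suffix: "braid_reduced Q (p @ x) \<Longrightarrow> braid_reduced Q x"
  using braid_reduced_infix[of Q p x "[]"] by simp

lemma braid_reduced_prefix: "braid_reduced Q (x @ q) \<Longrightarrow> braid_reduced Q x"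
  using braid_reduced_infix[of Q "[]" x q] by simp

lemma coxeter_equiv_lists: "coxeter_equiv Q x y \<Longrightarrow> x \<in> lists (verts Q) \<and> y \<in> lists (verts Q)"
  by (induction rule: coxeter_equiv.induct) auto

lemma coxeter_equiv_context:
  assumes "coxeter_equiv Q x y" "p \<in> lists (verts Q)" "q \<in> lists (verts Q)"
  shows "coxeter_equiv Q (p @ x @ q) (p @ y @ q)"
  using assms by (intro coxeter_equiv.append coxeter_equiv.refl)

lemma braid_move_coxeter_equiv:
  assumes "braid_move Q x y" "x \<in> lists (verts Q)"
  shows "coxeter_equiv Q x y"
  using assms
proof (induction rule: braid_move.induct)
  case (commute i j p q)
  then show ?case by (intro coxeter_equiv_context coxeter_equiv.commute) auto
next
  case (braid i j p q)
  then show ?case by (intro coxeter_equiv_context coxeter_equiv.braid) auto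
qed

lemma braid_equiv_coxeter_equiv:
  assumes "braid_equiv Q x y" "x \<in> lists (verts Q)"
  shows "coxeter_equiv Q x y"
  using assms
proof (induction rule: rtranclp_induct)
  case base
  then show ?case by (intro coxeter_equiv.refl)
next
  case (step y z)
  then show ?case using coxeter_equiv_lists braid_move_coxeter_equiv coxeter_equiv.trans by metis
qed

text \<open>Classes are multiplied through representatives, so the product of the generators along a
  word is the class of that word. This allows elements of the group to be handled as words modulo
  \<open>coxeter_equiv\<close>.\<close>

lemma is_expression_iff:
  "is_expression Q w u \<longleftrightarrow> u \<in> lists (verts Q) \<and> w = {z. coxeter_equiv Q u z}"
proof -
  have *: "foldr (\<lambda>i x. generator Q i \<otimes>\<^bsub>coxeter_group Q\<^esub> x) u \<one>\<^bsub>coxeter_group Q\<^esub> = {z. coxeter_equiv Q u z}"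
    if "set u \<subseteq> verts Q"
    using that
  proof (induction u)
    case Nil
    then show ?case by (simp add: coxeter_group_def)
  next
    case (Cons i u)
    have u: "u \<in> lists (verts Q)" and i: "i \<in> verts Q" using Cons.prems by auto
    have iu: "coxeter_equiv Q [i] [i]" "coxeter_equiv Q u u"
      using i coxeter_equiv.refl[OF u] coxeter_equiv.refl[of "[i]" Q] by auto
    have "{z. \<exists>x\<in>generator Q i. \<exists>y\<in>{z. coxeter_equiv Q u z}. coxeter_equiv Q (x @ y) z}
        = {z. coxeter_equiv Q (i # u) z}" (is "?L = ?R")
    proof (intro equalityI subsetI)
      fix z assume "z \<in> ?L"
      then obtain x y where "coxeter_equiv Q [i] x" "coxeter_equiv Q u y" "coxeter_equiv Q (x @ y) z"
        by (auto simp: generator_def)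
      then show "z \<in> ?R"
        using coxeter_equiv.append[of Q "[i]" x u y] coxeter_equiv.trans by fastforce
    next
      fix z assume "z \<in> ?R"
      moreover have "[i] \<in> generator Q i" "coxeter_equiv Q u u"
        using iu by (auto simp: generator_def)
      ultimately show "z \<in> ?L" by force
    qed
    then show ?case using Cons by (simp add: coxeter_group_def)
  qed
  show ?thesis
  proof (cases "set u \<subseteq> verts Q")
    case True
    show ?thesis unfolding is_expression_def *[OF True] ..
  qed (auto simp: is_expression_def)
qed

lemma is_expression_cong:
  "is_expression Q w x \<Longrightarrow> coxeter_equiv Q x y \<Longrightarrow> is_expression Q w y"
  unfolding is_expression_iff using coxeter_equiv_lists coxeter_equiv.trans coxeter_equiv.sym
  by (metis (no_types, lifting) Collect_cong)

lemma is_expression_equiv: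
  "is_expression Q w x \<Longrightarrow> is_expression Q w y \<Longrightarrow> coxeter_equiv Q x y"
  unfolding is_expression_iff using coxeter_equiv.refl by (metis mem_Collect_eq)

lemma reduced_expression_braid_equiv:
  assumes "reduced_expression Q w x" "braid_equiv Q x y"
  shows "reduced_expression Q w y"
  using assms braid_equiv_coxeter_equiv[of Q x y] braid_equiv_set[of Q x y] is_expression_cong[of Q w x y]
  by (auto simp: reduced_expression_def is_expression_iff)

text \<open>Braid moves keep both the element and the length, whereas a repeated letter could be
  deleted by \<open>square\<close> to give a shorter expression.\<close>

lemma reduced_expression_braid_reduced:
  assumes "reduced_expression Q w u"
  shows "braid_reduced Q u"
  unfolding braid_reduced_def
proof (intro allI notI)
  fix p i q assume "braid_equiv Q u (p @ [i, i] @ q)"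
  then have r: "reduced_expression Q w (p @ [i, i] @ q)"
    using assms reduced_expression_braid_equiv by blast
  then have "p @ [i, i] @ q \<in> lists (verts Q)" by (auto simp: reduced_expression_def is_expression_iff)
  then have "coxeter_equiv Q (p @ [i, i] @ q) (p @ [] @ q)"
    by (intro coxeter_equiv_context coxeter_equiv.square) auto
  then have "is_expression Q w (p @ [] @ q)"
    using r is_expression_cong by (auto simp: reduced_expression_def)
  then show False using r by (auto simp: reduced_expression_def)
qed

section \<open>Sortable words\<close>

text \<open>Reading's recursion for sortable elements, on the level of words. If the first letter
  \<open>s\<close> of the Coxeter word also starts the word, it is removed and the Coxeter word is
  conjugated by \<open>s\<close>; otherwise the word has to live in the parabolic subgroup without
  \<open>s\<close>.\<close>

inductive sortable_word :: "'v list \<Rightarrow> 'v list \<Rightarrow> bool" where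
  Nil: "sortable_word v []"
| rotate: "sortable_word (v @ [s]) u \<Longrightarrow> sortable_word (s # v) (s # u)"
| skip: "s \<notin> set u \<Longrightarrow> sortable_word v u \<Longrightarrow> sortable_word (s # v) u"

lemma sortable_word_set: "sortable_word v u \<Longrightarrow> set u \<subseteq> set v"
  by (induction rule: sortable_word.induct) auto

lemma sortable_word_singleton: "i \<in> set v \<Longrightarrow> sortable_word v [i]"
proof (induction v)
  case (Cons s v)
  then show ?case
    by (cases "s = i") (auto intro: sortable_word.intros)
qed simp

text \<open>A letter outside the support is carried along by rotations and skipped once it reaches
  the front. It is used to put a skipped letter back into the Coxeter word.\<close>

lemma sortable_word_insert:
  "sortable_word v u \<Longrightarrow> v = v1 @ v2 \<Longrightarrow> s \<notin> set u \<Longrightarrow> sortable_word (v1 @ s # v2) u"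
proof (induction arbitrary: v1 v2 rule: sortable_word.induct)
  case (Nil v)
  then show ?case by (auto intro: sortable_word.Nil)
next
  case (rotate v a u)
  show ?case
  proof (cases v1)
    case Nil
    then show ?thesis using rotate by (auto intro: sortable_word.intros)
  next
    case (Cons b v1')
    then show ?thesis using rotate.IH[of v1' "v2 @ [a]"] rotate.prems
      by (auto intro: sortable_word.rotate)
  qed
next
  case (skip a u v)
  show ?case
  proof (cases v1)
    case Nil
    then show ?thesis using skip by (auto intro: sortable_word.intros)
  next
    case (Cons b v1')
    then show ?thesis using skip.IH[of v1' "v2"] skip.prems skip.hyps
      by (auto intro: sortable_word.skip)
  qed
qed

lemma subseq_Cons_right:
  "subseq b (s # v) \<longleftrightarrow> (\<exists>b'. b = s # b' \<and> subseq b' v) \<or> subseq b v"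
  by (cases b) (auto dest: subseq_Cons')

lemma subseq_Nil_right: "subseq b [] \<longleftrightarrow> b = []"
  by (cases b) auto

lemma subseq_set_subset: "subseq b v \<Longrightarrow> set b \<subseteq> set v"
  by (auto simp: subseq_conv_nths dest: in_set_nthsD)

text \<open>One pass through the Coxeter word: \<open>v\<close> is still to be read, and
  \<open>acc\<close> holds the letters already used and rotated to the end. Letters of
  \<open>v\<close> outside \<open>b\<close> are dropped, which is legitimate because
  \<open>rest\<close> only uses letters of \<open>acc\<close> and \<open>b\<close>; what remains
  after the pass is \<open>acc @ b\<close>.\<close>

lemma sortable_word_block:
  assumes "subseq b v" "distinct (v @ acc)" "set rest \<subseteq> set acc \<union> set b" "sortable_word (acc @ b) rest"
  shows "sortable_word (v @ acc) (b @ rest)"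
  using assms
proof (induction v arbitrary: b acc rule: list.induct)
  case Nil
  then show ?case by (simp add: subseq_Nil_right)
next
  case (Cons s v)
  show ?case
  proof (cases "\<exists>b'. b = s # b' \<and> subseq b' v")
    case True
    then obtain b' where b: "b = s # b'" "subseq b' v" by blast
    then have "sortable_word (v @ (acc @ [s])) (b' @ rest)"
      using Cons.prems by (intro Cons.IH) auto
    then show ?thesis using b by (auto intro: sortable_word.rotate)
  next
    case False
    then have sub: "subseq b v" using Cons.prems(1) by (auto simp: subseq_Cons_right)
    then have "set b \<subseteq> set v" by (rule subseq_set_subset)
    then have "s \<notin> set (b @ rest)" using Cons.prems by auto
    moreover have "sortable_word (v @ acc) (b @ rest)"
      using Cons.prems sub by (intro Cons.IH) auto
    ultimately show ?thesis by (auto intro: sortable_word.skip)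
  qed
qed

lemma subseq_eq_filter:
  "distinct v \<Longrightarrow> subseq b v \<Longrightarrow> b = filter (\<lambda>x. x \<in> set b) v"
proof (induction v arbitrary: b rule: list.induct)
  case (Cons s v)
  show ?case
  proof (cases "\<exists>b'. b = s # b' \<and> subseq b' v")
    case True
    then obtain b' where b: "b = s # b'" "subseq b' v" by blast
    have "filter (\<lambda>x. x = s \<or> x \<in> set b') v = filter (\<lambda>x. x \<in> set b') v"
      using Cons.prems by (intro filter_cong) auto
    then show ?thesis using b Cons by (auto simp flip: Cons.IH)
  next
    case False
    then have sub: "subseq b v" using Cons.prems(2) by (auto simp: subseq_Cons_right)
    then have "set b \<subseteq> set v" by (rule subseq_set_subset)
    then show ?thesis using sub Cons by (auto simp flip: Cons.IH)
  qed
qed simp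

text \<open>A subword of a word without repetitions is determined by its support, so nested supports
  give nested subwords.\<close>

lemma subseq_of_subset:
  assumes "distinct v" "subseq b v" "subseq b' v" "set b' \<subseteq> set b"
  shows "subseq b' b"
proof -
  have "b' = filter (\<lambda>x. x \<in> set b') v" "b = filter (\<lambda>x. x \<in> set b) v"
    using assms subseq_eq_filter by blast+
  moreover have "filter (\<lambda>x. x \<in> set b') v = filter (\<lambda>x. x \<in> set b') (filter (\<lambda>x. x \<in> set b) v)"
    using assms(4) by (auto intro!: filter_cong)
  ultimately show ?thesis by (metis subseq_filter_left)
qed

text \<open>Once the first block \<open>b\<close> has been read, the Coxeter word has shrunk to
  \<open>b\<close> itself, and all later blocks are subwords of it.\<close>

lemma sortable_word_concat:
  assumes "distinct v" "\<forall>x\<in>set cs. subseq x v" "sorted_wrt (\<lambda>x y. set y \<subseteq> set x) cs"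
  shows "sortable_word v (concat cs)"
  using assms
proof (induction cs arbitrary: v)
  case Nil
  then show ?case by (auto intro: sortable_word.Nil)
next
  case (Cons b cs)
  have b: "subseq b v" using Cons.prems by simp
  have "distinct b" using b Cons.prems(1) subseq_eq_filter by (metis distinct_filter)
  moreover have "\<forall>x\<in>set cs. subseq x b" using Cons.prems b by (auto intro: subseq_of_subset)
  ultimately have "sortable_word b (concat cs)" using Cons by auto
  moreover have "set (concat cs) \<subseteq> set b" using Cons.prems by auto
  ultimately show ?case using sortable_word_block[OF b, of "[]" "concat cs"] Cons.prems(1) by simp
qed

text \<open>The cut points move by one letter: a block \<open>d s\<close> gives up its final
  \<open>s\<close> to the block after it and receives an \<open>s\<close> in front from the one
  before it. The chain stops at the first block without \<open>s\<close>, after which nestedness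
  excludes \<open>s\<close> altogether.\<close>

lemma rotate_blocks:
  assumes "\<forall>x\<in>set cs. subseq x (v @ [s])" "sorted_wrt (\<lambda>x y. set y \<subseteq> set x) cs" "s \<notin> set v"
  shows "\<exists>cs'. cs' \<noteq> [] \<and> (\<forall>x\<in>set cs'. subseq x (s # v)) \<and> sorted_wrt (\<lambda>x y. set y \<subseteq> set x) cs' \<and>
    concat cs' = s # concat cs"
  using assms(1,2)
proof (induction cs)
  case Nil
  show ?case by (rule exI[of _ "[[s]]"]) auto
next
  case (Cons b cs)
  show ?case
  proof (cases "s \<in> set b")
    case True
    obtain cs' where cs': "cs' \<noteq> []" "\<forall>x\<in>set cs'. subseq x (s # v)" "sorted_wrt (\<lambda>x y. set y \<subseteq> set x) cs'"
      "concat cs' = s # concat cs" using Cons by auto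
    have "subseq b (v @ [s])" using Cons.prems(1) by simp
    then obtain d e where d: "b = d @ e" "subseq d v" "subseq e [s]"
      by (rule subseq_appendE)
    have "s \<notin> set d" using subseq_set_subset[OF d(2)] assms(3) by blast
    then have "s \<in> set e" using True d by auto
    then have "e = [s]" using d(3) by (auto simp: subseq_Cons_right subseq_Nil_right)
    then have b: "b = d @ [s]" using d by simp
    have "\<forall>x\<in>set cs'. set x \<subseteq> set (s # d)"
    proof
      fix x assume "x \<in> set cs'"
      then have "set x \<subseteq> set (concat cs')" by auto
      also have "\<dots> \<subseteq> set (s # d)" using cs'(4) Cons.prems(2) b by auto
      finally show "set x \<subseteq> set (s # d)" .
    qed
    moreover have "subseq (s # d) (s # v)" using d by simp
    ultimately show ?thesis using cs' b by (intro exI[of _ "(s # d) # cs'"]) simp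
  next
    case False
    have "subseq b' v" if b': "subseq b' (v @ [s])" "s \<notin> set b'" for b'
    proof -
      obtain d e where d: "b' = d @ e" "subseq d v" "subseq e [s]"
        using b'(1) by (rule subseq_appendE)
      then have "e = []" using b'(2) by (auto simp: subseq_Cons_right subseq_Nil_right)
      then show ?thesis using d by simp
    qed
    moreover have "\<forall>x\<in>set cs. s \<notin> set x" using False Cons.prems(2) by auto
    ultimately have sub: "\<forall>x\<in>set (b # cs). subseq x v" using Cons.prems(1) False by simp
    then have "\<forall>x\<in>set ((s # b) # cs). subseq x (s # v)" by (simp add: subseq_Cons_right)
    moreover have "sorted_wrt (\<lambda>x y. set y \<subseteq> set x) ((s # b) # cs)"
      using Cons.prems(2) by (simp add: subset_insertI2)
    ultimately show ?thesis by (intro exI[of _ "(s # b) # cs"]) simp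
  qed
qed

lemma sortable_word_blocks:
  assumes "sortable_word v u" "distinct v"
  shows "\<exists>cs. cs \<noteq> [] \<and> u = concat cs \<and> (\<forall>x\<in>set cs. subseq x v) \<and>
    sorted_wrt (\<lambda>x y. set y \<subseteq> set x) cs"
  using assms
proof (induction rule: sortable_word.induct)
  case (Nil v)
  \<comment> \<open>A nonempty list of blocks is required, so the empty word gets one empty
    block.\<close>
  show ?case by (rule exI[of _ "[[]]"]) auto
next
  case (rotate v s u)
  then obtain cs where "u = concat cs" "\<forall>x\<in>set cs. subseq x (v @ [s])" "sorted_wrt (\<lambda>x y. set y \<subseteq> set x) cs"
    by auto
  then obtain cs' where "cs' \<noteq> []" "\<forall>x\<in>set cs'. subseq x (s # v)"
    "sorted_wrt (\<lambda>x y. set y \<subseteq> set x) cs'" "concat cs' = s # u"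
    using rotate_blocks[of cs v s] rotate.prems by auto
  then show ?case by (intro exI[of _ cs']) simp
next
  case (skip s u v)
  then obtain cs where "cs \<noteq> []" "u = concat cs" "\<forall>x\<in>set cs. subseq x v" "sorted_wrt (\<lambda>x y. set y \<subseteq> set x) cs"
    by auto
  moreover from this have "\<forall>x\<in>set cs. subseq x (s # v)" by (simp add: subseq_Cons_right)
  ultimately show ?case by blast
qed

lemma sortable_expression_iff:
  "distinct v \<Longrightarrow> sortable_expression Q v w u \<longleftrightarrow> reduced_expression Q w u \<and> sortable_word v u"
  unfolding sortable_expression_def
  by (rule conj_cong[OF HOL.refl]) (blast intro: sortable_word_concat dest: sortable_word_blocks)


section \<open>Reduced words of Coxeter elements\<close>

locale loopfree_quiver = fin_digraph Q for Q :: "('v, 'a) pre_digraph" +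
  assumes no_loop: "a \<in> arcs Q \<Longrightarrow> tail Q a \<noteq> head Q a"

text \<open>The simple reflection on the root lattice in coordinates, for the symmetric Cartan
  matrix with 2 on the diagonal and the negated numbers of arrows elsewhere.\<close>

definition reflect :: "('v, 'a) pre_digraph \<Rightarrow> 'v \<Rightarrow> ('v \<Rightarrow> int) \<Rightarrow> 'v \<Rightarrow> int" where
  "reflect Q i f = f(i := (\<Sum>j\<in>verts Q. int (num_arrows Q i j) * f j) - f i)"

abbreviation simple_root :: "'v \<Rightarrow> 'v \<Rightarrow> int" where
  "simple_root i \<equiv> (\<lambda>j. if j = i then 1 else 0)"

lemma reflect_other: "j \<noteq> i \<Longrightarrow> reflect Q i f j = f j"
  by (simp add: reflect_def)

lemma foldr_reflect_other: "j \<notin> set x \<Longrightarrow> foldr (reflect Q) x f j = f j"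
  by (induction x) (auto simp: reflect_other)

context loopfree_quiver begin

lemma num_arrows_self: "num_arrows Q i i = 0"
proof -
  have "{a \<in> arcs Q. (tail Q a = i \<and> head Q a = i) \<or> (tail Q a = i \<and> head Q a = i)} = {}"
    by (auto dest: no_loop)
  then show ?thesis unfolding num_arrows_def by (metis card.empty)
qed

lemma sum_num_arrows_upd:
  assumes "i \<in> verts Q"
  shows "(\<Sum>k\<in>verts Q. int (num_arrows Q j k) * (f(i := x)) k) =
    (\<Sum>k\<in>verts Q. int (num_arrows Q j k) * f k) + int (num_arrows Q j i) * (x - f i)"
proof -
  have "(\<Sum>k\<in>verts Q. int (num_arrows Q j k) * (f(i := x)) k)
      = int (num_arrows Q j i) * x + (\<Sum>k\<in>verts Q - {i}. int (num_arrows Q j k) * f k)"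
    using assms by (subst sum.remove[of _ i]) auto
  moreover have "(\<Sum>k\<in>verts Q. int (num_arrows Q j k) * f k)
      = int (num_arrows Q j i) * f i + (\<Sum>k\<in>verts Q - {i}. int (num_arrows Q j k) * f k)"
    using assms by (subst sum.remove[of _ i]) auto
  ultimately show ?thesis by (simp add: algebra_simps)
qed

lemma reflect_upd:
  assumes "i \<in> verts Q"
  shows "reflect Q j (f(i := x)) = (f(i := x))(j := (\<Sum>k\<in>verts Q. int (num_arrows Q j k) * f k)
    + int (num_arrows Q j i) * (x - f i) - (f(i := x)) j)"
  unfolding reflect_def sum_num_arrows_upd[OF assms] ..

lemma reflect_involution: "i \<in> verts Q \<Longrightarrow> reflect Q i (reflect Q i f) = f"
  by (subst (2) reflect_def) (simp add: reflect_upd num_arrows_self)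

lemma reflect_commute:
  assumes "i \<in> verts Q" "j \<in> verts Q" "num_arrows Q i j = 0"
  shows "reflect Q i (reflect Q j f) = reflect Q j (reflect Q i f)"
proof (cases "i = j")
  case False
  have "reflect Q i (reflect Q j f) = f(j := (\<Sum>k\<in>verts Q. int (num_arrows Q j k) * f k) - f j,
      i := (\<Sum>k\<in>verts Q. int (num_arrows Q i k) * f k) - f i)"
    if "i \<noteq> j" "num_arrows Q i j = 0" "j \<in> verts Q" for i j
    using that by (subst (2) reflect_def) (simp add: reflect_upd)
  from this[of i j] this[of j i] show ?thesis
    using assms False by (simp add: num_arrows_commute[of Q j i] fun_upd_twist)
qed simp

lemma reflect_braid:
  assumes "i \<in> verts Q" "j \<in> verts Q" "num_arrows Q i j = 1"
  shows "reflect Q i (reflect Q j (reflect Q i f)) = reflect Q j (reflect Q i (reflect Q j f))"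
proof -
  define N where "N = (\<lambda>i. \<Sum>k\<in>verts Q. int (num_arrows Q i k) * f k)"
  \<comment> \<open>The composite is brought into a closed form that is symmetric in
    \<open>i\<close> and \<open>j\<close>.\<close>
  have "reflect Q i (reflect Q j (reflect Q i f)) =
      f(j := N i + N j - 2 * f i - f j, i := N i + N j - f i - 2 * f j)"
    if "i \<noteq> j" "i \<in> verts Q" "j \<in> verts Q" "num_arrows Q i j = 1" for i j
  proof -
    define f1 where "f1 = f(i := N i - f i)"
    define f2 where "f2 = f1(j := N j + N i - 2 * f i - f j)"
    have sym: "num_arrows Q j i = 1" using that num_arrows_commute by metis
    have 1: "reflect Q i f = f1" by (simp add: reflect_def f1_def N_def)
    have 2: "reflect Q j f1 = f2"
      unfolding f2_def f1_def using that sym by (subst reflect_upd) (auto simp: N_def)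
    have s: "(\<Sum>k\<in>verts Q. int (num_arrows Q i k) * f1 k) = N i"
      unfolding f1_def using that by (subst sum_num_arrows_upd) (auto simp: N_def num_arrows_self)
    have 3: "reflect Q i f2 = f(j := N i + N j - 2 * f i - f j, i := N i + N j - f i - 2 * f j)"
      unfolding f2_def using that s by (subst reflect_upd) (auto simp: f1_def fun_eq_iff)
    show ?thesis by (simp only: 1 2 3)
  qed
  note * = this
  have "i \<noteq> j" using assms(3) num_arrows_self by (metis zero_neq_one)
  with *[of i j] *[of j i] assms num_arrows_commute[of Q i j] show ?thesis
    by (simp add: fun_upd_twist algebra_simps)
qed

lemma coxeter_equiv_reflect:
  "coxeter_equiv Q x y \<Longrightarrow> foldr (reflect Q) x f = foldr (reflect Q) y f"
proof (induction arbitrary: f rule: coxeter_equiv.induct)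
  case (commute i j)
  then show ?case using reflect_commute by simp
next
  case (braid i j)
  then show ?case using reflect_braid by simp
qed (simp_all add: reflect_involution)

lemma foldr_reflect_rev:
  "set x \<subseteq> verts Q \<Longrightarrow> foldr (reflect Q) (rev x) (foldr (reflect Q) x f) = f"
  by (induction x arbitrary: f) (auto simp: reflect_involution)

text \<open>Each letter \<open>k\<close> of \<open>p\<close> is met once, when the coordinate at
  \<open>k\<close> is still 0; it is then replaced by a sum of nonnegative terms, one of which is
  the number of arrows to \<open>s\<close> times the coordinate 1 at \<open>s\<close>.\<close>

lemma foldr_reflect_simple_root:
  assumes "distinct p" "s \<notin> set p" "s \<in> verts Q"
  shows "0 \<le> foldr (reflect Q) p (simple_root s) j" "foldr (reflect Q) p (simple_root s) s = 1"
    "j \<in> set p \<Longrightarrow> int (num_arrows Q j s) \<le> foldr (reflect Q) p (simple_root s) j"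
  using assms
proof (induction p arbitrary: j)
  case (Cons k p)
  let ?f = "foldr (reflect Q) p (simple_root s)"
  {
    case 2
    then show ?case by (simp add: foldr_reflect_other reflect_other)
  }
  have f: "\<And>j. 0 \<le> ?f j" "?f s = 1" "?f k = 0"
    "\<And>j. j \<in> set p \<Longrightarrow> int (num_arrows Q j s) \<le> ?f j" if "distinct (k # p)" "s \<notin> set (k # p)"
    using Cons.IH that assms(3) by (auto simp: foldr_reflect_other)
  have k: "reflect Q k ?f k \<ge> int (num_arrows Q k s)" if "distinct (k # p)" "s \<notin> set (k # p)"
  proof -
    have "int (num_arrows Q k s) * ?f s \<le> (\<Sum>j\<in>verts Q. int (num_arrows Q k j) * ?f j)"
      using f[OF that] assms(3) by (intro member_le_sum) auto
    then show ?thesis using f[OF that] by (simp add: reflect_def)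
  qed
  {
    case 1
    then show ?case using f k[OF 1(1,2)] by (cases "j = k") (auto simp: reflect_other)
  next
    case 3
    then show ?case using f k by (cases "j = k") (auto simp: reflect_other)
  }
qed auto

lemma foldr_reflect_commute:
  assumes "\<And>k. k \<in> set p \<Longrightarrow> k \<in> verts Q \<and> num_arrows Q s k = 0" "s \<in> verts Q"
  shows "foldr (reflect Q) p (reflect Q s f) = reflect Q s (foldr (reflect Q) p f)"
  using assms by (induction p) (auto simp: reflect_commute[of s])

lemma reflect_simple_root: "reflect Q i (simple_root i) = (\<lambda>j. - simple_root i j)"
proof -
  have "(\<Sum>j\<in>verts Q. int (num_arrows Q i j) * simple_root i j) = 0"
    by (rule sum.neutral) (simp add: num_arrows_self)
  then show ?thesis unfolding reflect_def by (auto simp: fun_eq_iff)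
qed

lemma foldr_reflect_uminus:
  "foldr (reflect Q) x (\<lambda>j. - f j) = (\<lambda>j. - foldr (reflect Q) x f j)"
  by (induction x arbitrary: f) (auto simp: reflect_def fun_eq_iff sum_negf)

text \<open>A word without \<open>i\<close> fixes the coordinate at \<open>i\<close>. A word
  containing \<open>i\<close> exactly once changes it for a suitable vector: the one that reaches
  the reflection at \<open>i\<close> as the simple root, so that the coordinate goes from 1 to
  -1.\<close>

lemma foldr_reflect_eq_support:
  assumes "distinct v'" "set v' \<subseteq> verts Q" "\<And>f. foldr (reflect Q) v f = foldr (reflect Q) v' f"
  shows "set v' \<subseteq> set v"
proof
  fix i assume "i \<in> set v'"
  then obtain p q where v': "v' = p @ i # q" by (meson split_list)
  define f where "f = foldr (reflect Q) (rev q) (simple_root i)"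
  have "reflect Q i (simple_root i) i = -1"
    by (simp add: reflect_simple_root)
  moreover have "foldr (reflect Q) q f = simple_root i"
    unfolding f_def using foldr_reflect_rev[of "rev q"] assms(2) v' by simp
  ultimately have "foldr (reflect Q) v' f i = -1"
    using assms(1) v' by (simp add: foldr_reflect_other)
  moreover have "f i = 1" unfolding f_def using assms(1) v' by (simp add: foldr_reflect_other)
  ultimately show "i \<in> set v"
    using foldr_reflect_other[of i v Q f] assms(3)[of f] by auto
qed

text \<open>Let \<open>v' = s # q'\<close> and \<open>v = p @ s # q\<close>, and apply both inverses
  to the simple root at \<open>s\<close>. The inverse of \<open>v'\<close> gives a vector without
  positive coordinates, while the inverse of \<open>v\<close> has at \<open>k\<close> in
  \<open>p\<close> a coordinate at least the number of arrows between \<open>k\<close> and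
  \<open>s\<close>. So \<open>s\<close> commutes with all of \<open>p\<close> and can be cancelled
  from both words.\<close>

lemma foldr_reflect_eq_order:
  assumes "distinct v'" "distinct v" "set v = set v'" "set v' \<subseteq> verts Q"
    and "\<And>f. foldr (reflect Q) v f = foldr (reflect Q) v' f"
    and "num_arrows Q i j \<noteq> 0" "subseq [i, j] v'"
  shows "subseq [i, j] v"
  using assms
proof (induction v' arbitrary: v rule: list.induct)
  case Nil
  then show ?case by (simp add: subseq_Nil_right)
next
  case (Cons s q')
  obtain p q where v: "v = p @ s # q" using Cons.prems(3) by (metis list.set_intros(1) split_list)
  have s: "s \<in> verts Q" and verts: "set v \<subseteq> verts Q" using Cons.prems by auto
  have p: "k \<in> verts Q \<and> num_arrows Q s k = 0" if k: "k \<in> set p" for k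
  proof -
    let ?r = "foldr (reflect Q) (rev p) (simple_root s)"
    have "foldr (reflect Q) (rev v) g = foldr (reflect Q) (rev (s # q')) g" for g
    proof -
      have v': "set (rev (s # q')) \<subseteq> verts Q" using Cons.prems by auto
      have g: "foldr (reflect Q) (s # q') (foldr (reflect Q) (rev (s # q')) g) = g"
        using foldr_reflect_rev[OF v', of g] by simp
      have "foldr (reflect Q) (rev v) (foldr (reflect Q) v (foldr (reflect Q) (rev (s # q')) g))
          = foldr (reflect Q) (rev (s # q')) g"
        by (rule foldr_reflect_rev[OF verts])
      then show ?thesis using g Cons.prems(5) by simp
    qed
    from this[of "simple_root s"]
    have eq: "foldr (reflect Q) (rev q) (reflect Q s ?r) k
        = foldr (reflect Q) (rev q') (reflect Q s (simple_root s)) k"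
      by (simp add: v)
    have ks: "k \<noteq> s" "k \<notin> set q" using k v Cons.prems(2) by auto
    have "foldr (reflect Q) (rev q) (reflect Q s ?r) k = ?r k"
      using ks by (simp add: foldr_reflect_other reflect_other)
    moreover have "int (num_arrows Q k s) \<le> ?r k"
      using Cons.prems(2) v s k by (intro foldr_reflect_simple_root(3)) auto
    moreover have "foldr (reflect Q) (rev q') (reflect Q s (simple_root s)) k \<le> 0"
    proof -
      have "0 \<le> foldr (reflect Q) (rev q') (simple_root s) k"
        using Cons.prems s by (intro foldr_reflect_simple_root(1)) auto
      then show ?thesis by (simp add: reflect_simple_root foldr_reflect_uminus)
    qed
    ultimately have "num_arrows Q k s = 0" using eq by simp
    then show ?thesis using k v verts by (auto simp: num_arrows_commute[of Q s k])
  qed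
  have pq: "foldr (reflect Q) (p @ q) f = foldr (reflect Q) q' f" for f
  proof -
    have "reflect Q s (foldr (reflect Q) (p @ q) f) = foldr (reflect Q) v f"
      using foldr_reflect_commute[of p s] p s v by simp
    also have "\<dots> = reflect Q s (foldr (reflect Q) q' f)" using Cons.prems(5) by simp
    finally show ?thesis using reflect_involution[OF s] by metis
  qed
  consider "i = s" "j \<in> set q'" | "subseq [i, j] q'"
    using Cons.prems(7) by (auto simp: subseq_Cons_right subseq_singleton_left)
  then show ?case
  proof cases
    case 1
    then have "j \<in> set (p @ q)" using v Cons.prems(1,2,3) by auto
    then have "j \<in> set q" using p 1 Cons.prems(6) by auto
    then have "subseq [i, j] (s # q)" using 1 by (simp add: subseq_singleton_left)
    then show ?thesis unfolding v by (rule subseq_drop_many)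
  next
    case 2
    have "set (p @ q) = set q'" using v Cons.prems(1,2,3) by auto
    moreover have "distinct q'" "distinct (p @ q)" "set q' \<subseteq> verts Q"
      using Cons.prems(1,2,4) v by auto
    ultimately have "subseq [i, j] (p @ q)"
      using Cons.IH[OF _ _ _ _ pq] Cons.prems(6) 2 by blast
    moreover have "subseq (p @ q) v" unfolding v by (simp add: list_emb_append_mono subseq_Cons_right)
    ultimately show ?thesis by (rule subseq_order.order_trans)
  qed
qed


end

section \<open>Admissibility through two-letter subwords\<close>

lemma subseq_pair_iff: "subseq [a, b] v \<longleftrightarrow> (\<exists>i j. i < j \<and> j < length v \<and> v ! i = a \<and> v ! j = b)"
proof (induction v rule: list.induct)
  case Nil
  then show ?case by (simp add: subseq_Nil_right)
next
  case (Cons c v)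
  show ?case (is "?L = ?R")
  proof
    assume ?L
    then consider "c = a" "b \<in> set v" | "subseq [a, b] v"
      by (auto simp: subseq_Cons_right subseq_singleton_left)
    then show ?R
    proof cases
      case 1
      then obtain j where "j < length v" "v ! j = b" by (auto simp: in_set_conv_nth)
      with 1 show ?thesis by (intro exI[of _ 0] exI[of _ "Suc j"]) auto
    next
      case 2
      then obtain i j where "i < j" "j < length v" "v ! i = a" "v ! j = b" using Cons by auto
      then show ?thesis by (intro exI[of _ "Suc i"] exI[of _ "Suc j"]) auto
    qed
  next
    assume ?R
    then obtain i j where ij: "i < j" "j < length (c # v)" "(c # v) ! i = a" "(c # v) ! j = b" by blast
    then obtain j' where j: "j = Suc j'" by (cases j) auto
    show ?L
    proof (cases i)
      case 0
      then have "a = c" "b \<in> set v" using ij j by auto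
      then show ?thesis by (simp add: subseq_singleton_left)
    next
      case (Suc i')
      then have "subseq [a, b] v" using ij j Cons by auto
      then show ?thesis by (simp add: subseq_Cons_right)
    qed
  qed
qed

lemma subseq_pair_asym: "distinct v \<Longrightarrow> subseq [a, b] v \<Longrightarrow> \<not> subseq [b, a] v"
  unfolding subseq_pair_iff by (auto simp: nth_eq_iff_index_eq)

lemma admissible_word_iff:
  "admissible_word Q' v \<longleftrightarrow> coxeter_word Q' v \<and>
    (\<forall>a\<in>set v. \<forall>b\<in>set v. (a, b) \<in> arcs_ends Q' \<longrightarrow> subseq [a, b] v)"
  unfolding admissible_word_def
proof (rule conj_cong[OF HOL.refl])
  assume "coxeter_word Q' v"
  then have d: "distinct v" by (simp add: coxeter_word_def)
  have "subseq [v ! i, v ! j] v \<longleftrightarrow> i < j" if "i < length v" "j < length v" for i j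
    unfolding subseq_pair_iff using d that nth_eq_iff_index_eq
    by (metis order.strict_trans)
  then show "(\<forall>i<length v. \<forall>j<length v. (v ! i, v ! j) \<in> arcs_ends Q' \<longrightarrow> i < j) \<longleftrightarrow>
    (\<forall>a\<in>set v. \<forall>b\<in>set v. (a, b) \<in> arcs_ends Q' \<longrightarrow> subseq [a, b] v)"
    by (simp add: all_set_conv_all_nth)
qed

lemma num_arrows_orientation:
  assumes "is_orientation Q Q'"
  shows "num_arrows Q' = num_arrows Q"
proof (intro ext)
  fix i j
  have "{a \<in> arcs Q'. tail Q' a = i \<and> head Q' a = j \<or> tail Q' a = j \<and> head Q' a = i}
      = {a \<in> arcs Q. tail Q a = i \<and> head Q a = j \<or> tail Q a = j \<and> head Q a = i}"
    using assms unfolding is_orientation_def by auto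
  then show "num_arrows Q' i j = num_arrows Q i j" by (simp add: num_arrows_def)
qed

lemma coxeter_equiv_mono:
  assumes "verts Q = verts Q'" "num_arrows Q = num_arrows Q'"
  shows "coxeter_equiv Q x y \<Longrightarrow> coxeter_equiv Q' x y"
proof (induction rule: coxeter_equiv.induct)
  case (square i)
  then show ?case using assms by (intro coxeter_equiv.square) simp
next
  case (commute i j)
  then show ?case using assms by (intro coxeter_equiv.commute) simp_all
next
  case (braid i j)
  then show ?case using assms by (intro coxeter_equiv.braid) simp_all
next
  case (refl x)
  then show ?case using assms by (intro coxeter_equiv.refl) simp
next
  case (sym x y)
  then show ?case by (rule_tac coxeter_equiv.sym)
next
  case (trans x y z)
  then show ?case by (rule_tac coxeter_equiv.trans)
next
  case (append x x' y y')
  then show ?case by (rule_tac coxeter_equiv.append)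
qed

lemma is_expression_orientation:
  assumes "is_orientation Q Q'"
  shows "is_expression Q' c v \<longleftrightarrow> is_expression Q c v"
proof -
  have "verts Q' = verts Q" using assms by (simp add: is_orientation_def)
  then have "coxeter_equiv Q' = coxeter_equiv Q"
    using coxeter_equiv_mono[of Q Q'] coxeter_equiv_mono[of Q' Q] num_arrows_orientation[OF assms]
    by (auto simp: fun_eq_iff)
  then show ?thesis using assms by (simp add: is_expression_iff is_orientation_def)
qed

text \<open>Compared with an admissible word of \<open>c\<close>, the reflection representation
  forces full support, minimality of length then excludes repetitions, and the order of adjacent
  letters is again read off from the action.\<close>

lemma (in loopfree_quiver) admissible_reduced_expression:
  assumes Q': "is_orientation Q Q'" and c: "admissible Q' c" and v: "reduced_expression Q c v"
  shows "admissible_word Q' v"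
proof -
  obtain v' where v': "admissible_word Q' v'" "is_expression Q c v'"
    using c is_expression_orientation[OF Q'] by (auto simp: admissible_def)
  have verts: "distinct v'" "set v' = verts Q" "verts Q' = verts Q"
    using v'(1) Q' by (auto simp: admissible_word_def coxeter_word_def is_orientation_def)
  have vQ: "set v \<subseteq> verts Q" using v by (auto simp: reduced_expression_def is_expression_iff)
  have eq: "foldr (reflect Q) v f = foldr (reflect Q) v' f" for f
    using v v'(2) by (intro coxeter_equiv_reflect is_expression_equiv) (auto simp: reduced_expression_def)
  have set: "set v = verts Q"
    using foldr_reflect_eq_support[of v' v] verts vQ eq by auto
  have "length v \<le> length v'" using v v'(2) by (auto simp: reduced_expression_def)
  also have "\<dots> = card (set v)" using verts set distinct_card by metis
  finally have "distinct v" using card_distinct card_length le_antisym by metis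
  moreover have "subseq [a, b] v" if ab: "a \<in> set v" "b \<in> set v" "(a, b) \<in> arcs_ends Q'" for a b
  proof -
    have "subseq [a, b] v'" using v'(1) ab set verts by (auto simp: admissible_word_iff)
    moreover have "num_arrows Q' a b \<noteq> 0"
    proof -
      obtain e where e: "e \<in> arcs Q'" "tail Q' e = a" "head Q' e = b"
        using ab(3) by (auto simp: arcs_ends_def arc_to_ends_def)
      moreover have "finite (arcs Q')" using Q' by (simp add: is_orientation_def)
      ultimately show ?thesis unfolding num_arrows_def by auto
    qed
    ultimately show ?thesis
      using num_arrows_orientation[OF Q'] verts set eq \<open>distinct v\<close>
      by (intro foldr_reflect_eq_order[of v' v]) auto
  qed
  ultimately show ?thesis using set verts(3) by (auto simp: admissible_word_iff coxeter_word_def)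
qed

section \<open>The path algebra\<close>

definition path_mult :: "('v, 'a) pre_digraph \<Rightarrow> (('v, 'a) path \<Rightarrow> 'k::field) \<Rightarrow> (('v, 'a) path \<Rightarrow> 'k) \<Rightarrow>
    ('v, 'a) path \<Rightarrow> 'k" where
  "path_mult G f g = (\<lambda>(i, p). \<Sum>n\<le>length p.
     f (pre_digraph.awlast G i (take n p), drop n p) * g (i, take n p))"

definition scale :: "'k::field \<Rightarrow> ('x \<Rightarrow> 'k) \<Rightarrow> 'x \<Rightarrow> 'k" where
  "scale t f = (\<lambda>x. t * f x)"

interpretation fun_space: vector_space "scale :: 'k::field \<Rightarrow> ('x \<Rightarrow> 'k) \<Rightarrow> 'x \<Rightarrow> 'k"
  by unfold_locales (auto simp: scale_def fun_eq_iff algebra_simps)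

text \<open>Right multiplication by the trivial path at \<open>r\<close> and by the arrow \<open>c\<close>, and the left inverse of the latter.\<close>

definition col :: "'v \<Rightarrow> (('v, 'a) path \<Rightarrow> 'k::field) \<Rightarrow> ('v, 'a) path \<Rightarrow> 'k" where
  "col r f = (\<lambda>(i, p). if i = r then f (i, p) else 0)"

definition shift :: "('v, 'a) pre_digraph \<Rightarrow> 'a \<Rightarrow> (('v, 'a) path \<Rightarrow> 'k::field) \<Rightarrow> ('v, 'a) path \<Rightarrow> 'k" where
  "shift G c f = (\<lambda>(i, p). if p \<noteq> [] \<and> hd p = c \<and> i = tail G c then f (head G c, tl p) else 0)"

definition unshift :: "('v, 'a) pre_digraph \<Rightarrow> 'a \<Rightarrow> (('v, 'a) path \<Rightarrow> 'k::field) \<Rightarrow> ('v, 'a) path \<Rightarrow> 'k" where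
  "unshift G c f = (\<lambda>(i, p). if i = head G c then f (tail G c, c # p) else 0)"

lemma path_algebra_simps:
  "f \<in> carrier (path_algebra k G) \<longleftrightarrow> finite {x. f x \<noteq> 0} \<and> {x. f x \<noteq> 0} \<subseteq> paths G"
  "f \<otimes>\<^bsub>path_algebra k G\<^esub> g = path_mult G f g"
  "f \<oplus>\<^bsub>path_algebra k G\<^esub> g = f + g"
  "\<zero>\<^bsub>path_algebra k G\<^esub> = 0"
  "\<one>\<^bsub>path_algebra k G\<^esub> = (\<lambda>(i, p). if i \<in> verts G \<and> p = [] then 1 else 0)"
  by (auto simp: path_algebra_def path_mult_def fun_eq_iff zero_fun_def plus_fun_def)

declare pre_digraph.awalk_verts.simps [simp] pre_digraph.awalk_verts_non_Nil [simp]

lemma path_mult_Nil: "path_mult G f g (i, []) = f (i, []) * g (i, [])"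
  by (simp add: path_mult_def)

lemma path_mult_Cons:
  "path_mult G f g (i, c # p) = f (i, c # p) * g (i, [])
    + (\<Sum>n\<le>length p. f (pre_digraph.awlast G (head G c) (take n p), drop n p) * g (i, c # take n p))"
  unfolding path_mult_def
  by (simp add: sum.atMost_Suc_shift del: sum.atMost_Suc)

lemma path_mult_add_left: "path_mult G (f + g) h = path_mult G f h + path_mult G g h"
  and path_mult_add_right: "path_mult G h (f + g) = path_mult G h f + path_mult G h g"
  and path_mult_scale: "path_mult G f (scale t g) = scale t (path_mult G f g)"
    "path_mult G (scale t f) g = scale t (path_mult G f g)"
  by (auto simp: path_mult_def fun_eq_iff algebra_simps sum.distrib scale_def sum_distrib_left
      intro!: sum.cong)

lemma path_mult_assoc: "path_mult G (path_mult G f g) h = path_mult G f (path_mult G g h)"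
proof (intro ext, clarify)
  fix i p
  let ?aw = "\<lambda>n. pre_digraph.awlast G i (take n p)"
  let ?L = "length p"
  \<comment> \<open>The path is cut twice: \<open>h\<close> sees the first \<open>k\<close> arrows,
    \<open>g\<close> the next \<open>j\<close> and \<open>f\<close> the rest.\<close>
  define F where "F = (\<lambda>k j. f (?aw (k + j), drop (k + j) p) * g (?aw k, drop k (take (k + j) p)) * h (i, take k p))"
  have "path_mult G f (path_mult G g h) (i, p) = (\<Sum>n\<le>?L. \<Sum>k\<le>n. F k (n - k))"
    unfolding path_mult_def F_def
    by (auto simp: sum_distrib_left mult.assoc min_def intro!: sum.cong)
  also have "\<dots> = (\<Sum>(k, j)\<in>{(k, j). k + j \<le> ?L}. F k j)"
    by (rule sum.triangle_reindex_eq[symmetric])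
  also have "{(k, j). k + j \<le> ?L} = Sigma {..?L} (\<lambda>k. {..?L - k})" by auto
  also have "(\<Sum>(k, j)\<in>Sigma {..?L} (\<lambda>k. {..?L - k}). F k j) = (\<Sum>k\<le>?L. \<Sum>j\<le>?L - k. F k j)"
    by (subst sum.Sigma) auto
  also have "\<dots> = path_mult G (path_mult G f g) h (i, p)"
  proof -
    have "pre_digraph.awlast G (?aw k) (take j (drop k p)) = ?aw (k + j)" for k j
      by (simp add: take_add pre_digraph.awalk_verts_conv)
    then show ?thesis unfolding path_mult_def F_def
      by (auto simp: sum_distrib_right drop_take add.commute intro!: sum.cong)
  qed
  finally show "path_mult G (path_mult G f g) h (i, p) = path_mult G f (path_mult G g h) (i, p)" by simp
qed

text \<open>A product rule as in Fox calculus: the first arrow of a path in the product comes from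
  \<open>g\<close>, unless \<open>g\<close> contributes only a trivial path, in which case it comes
  from \<open>f\<close>.\<close>

lemma unshift_mult:
  "unshift G c (path_mult G f g) = scale (g (tail G c, [])) (unshift G c f) + path_mult G f (unshift G c g)"
  by (auto simp: fun_eq_iff unshift_def scale_def path_mult_Cons) (simp_all add: path_mult_def)

lemma mult_shift: "path_mult G h (shift G c f) = shift G c (path_mult G h f)"
proof (intro ext, clarify)
  fix i p
  show "path_mult G h (shift G c f) (i, p) = shift G c (path_mult G h f) (i, p)"
    by (cases p) (auto simp: path_mult_Nil path_mult_Cons shift_def, simp add: path_mult_def)
qed

lemma shift_linear:
  "shift G c (f + g) = shift G c f + shift G c g"
  "shift G c (f - g) = shift G c f - shift G c g"
  "shift G c (scale t f) = scale t (shift G c f)"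
  "shift G c 0 = 0"
  by (auto simp: fun_eq_iff shift_def scale_def)

lemma unshift_linear:
  "unshift G c (f + g) = unshift G c f + unshift G c g"
  "unshift G c (f - g) = unshift G c f - unshift G c g"
  "unshift G c (scale t f) = scale t (unshift G c f)"
  "unshift G c 0 = 0"
  by (auto simp: fun_eq_iff unshift_def scale_def)

lemma col_linear:
  "col r (f + g) = col r f + col r g"
  "col r (f - g) = col r f - col r g"
  "col r (scale t f) = scale t (col r f)"
  "col r 0 = 0"
  by (auto simp: fun_eq_iff col_def scale_def)

lemma col_col: "col r (col r' f) = (if r = r' then col r f else 0)"
  by (auto simp: fun_eq_iff col_def)

lemma col_shift: "col r (shift G c f) = (if r = tail G c then shift G c f else 0)"
  by (auto simp: fun_eq_iff col_def shift_def)

lemma shift_col: "shift G c (col r f) = (if r = head G c then shift G c f else 0)"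
  by (auto simp: fun_eq_iff col_def shift_def)

lemma unshift_col: "unshift G c (col r f) = (if r = tail G c then unshift G c f else 0)"
  by (auto simp: fun_eq_iff col_def unshift_def)

lemma col_unshift: "col (head G c) (unshift G c f) = unshift G c f"
  by (auto simp: fun_eq_iff col_def unshift_def)

lemma unshift_shift: "unshift G c (shift G c' f) = (if c = c' then col (head G c) f else 0)"
  by (auto simp: fun_eq_iff col_def unshift_def shift_def)

lemma mult_of_path_Nil: "path_mult G f (of_path (i, [])) = col i f"
  by (auto simp: fun_eq_iff of_path_def path_mult_def col_def sum.atMost_shift)

lemma mult_of_path_Cons:
  fixes f :: "('v, 'a) path \<Rightarrow> 'k::field"
  shows "path_mult G f (of_path (tail G c, c # p)) = shift G c (path_mult G f (of_path (head G c, p)))"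
proof -
  have "of_path (tail G c, c # p) = (shift G c (of_path (head G c, p)) :: ('v, 'a) path \<Rightarrow> 'k)"
    by (auto simp: fun_eq_iff of_path_def shift_def neq_Nil_conv)
  then show ?thesis by (simp only: mult_shift)
qed

lemma mult_of_arrow: "path_mult G f (of_arrow G c) = shift G c f"
  using mult_of_path_Cons[of G f c "[]"]
  by (simp add: of_arrow_def mult_of_path_Nil shift_col)

lemma (in wf_digraph) paths_Nil: "(i, []) \<in> paths G \<longleftrightarrow> i \<in> verts G"
  by (auto simp: paths_def awalk_def)

lemma (in wf_digraph) paths_Cons: "(i, c # p) \<in> paths G \<longleftrightarrow> c \<in> arcs G \<and> i = tail G c \<and> (head G c, p) \<in> paths G"
  by (auto simp: paths_def awalk_simps)

lemma (in wf_digraph) paths_append: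
  "(i, p @ q) \<in> paths G \<longleftrightarrow> (i, p) \<in> paths G \<and> (awlast i p, q) \<in> paths G"
  by (auto simp: paths_def)

lemma carrier_eqI:
  assumes "f \<in> carrier (path_algebra k G)" "\<And>x. g x \<noteq> 0 \<Longrightarrow> f x \<noteq> 0"
  shows "g \<in> carrier (path_algebra k G)"
proof -
  have "{x. g x \<noteq> 0} \<subseteq> {x. f x \<noteq> 0}" using assms(2) by auto
  then show ?thesis using assms(1) by (auto simp: path_algebra_simps intro: finite_subset)
qed

section \<open>The path algebra as a ring\<close>

context fin_digraph begin

lemma path_mult_closed:
  assumes f: "f \<in> carrier (path_algebra k G)" and g: "g \<in> carrier (path_algebra k G)"
  shows "path_mult G f g \<in> carrier (path_algebra k G)"
proof -
  let ?h = "\<lambda>((j, q), (i, p)). (i, p @ q)"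
  have *: "x \<in> ?h ` ({x. f x \<noteq> 0} \<times> {x. g x \<noteq> 0}) \<and> x \<in> paths G" if nz: "path_mult G f g x \<noteq> 0" for x
  proof -
    obtain i p where x: "x = (i, p)" by (cases x)
    obtain n where n: "f (awlast i (take n p), drop n p) \<noteq> 0" "g (i, take n p) \<noteq> 0"
      using nz x by (fastforce simp: path_mult_def elim: sum.not_neutral_contains_not_neutral)
    then have "(awlast i (take n p), drop n p) \<in> paths G" "(i, take n p) \<in> paths G"
      using f g by (auto simp: path_algebra_simps)
    then have "x \<in> paths G" using paths_append[of i "take n p" "drop n p"] x by simp
    moreover have "x \<in> ?h ` ({x. f x \<noteq> 0} \<times> {x. g x \<noteq> 0})"
      using n x by (intro image_eqI[of _ _ "((awlast i (take n p), drop n p), (i, take n p))"]) auto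
    ultimately show ?thesis by blast
  qed
  moreover have "finite (?h ` ({x. f x \<noteq> 0} \<times> {x. g x \<noteq> 0}))"
    using f g by (auto simp: path_algebra_simps)
  ultimately show ?thesis unfolding path_algebra_simps
    by (intro conjI subsetI) (rule finite_subset[rotated], assumption, auto)
qed

lemma path_algebra_add_closed:
  assumes "f \<in> carrier (path_algebra k G)" "g \<in> carrier (path_algebra k G)"
  shows "f + g \<in> carrier (path_algebra k G)"
proof -
  have "{x. (f + g) x \<noteq> 0} \<subseteq> {x. f x \<noteq> 0} \<union> {x. g x \<noteq> 0}" by auto
  then show ?thesis using assms unfolding path_algebra_simps
    by (meson finite_UnI finite_subset le_sup_iff subset_trans)
qed

lemma scale_closed: "f \<in> carrier (path_algebra k G) \<Longrightarrow> scale t f \<in> carrier (path_algebra k G)"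
  by (erule carrier_eqI) (auto simp: scale_def)

lemma col_closed: "f \<in> carrier (path_algebra k G) \<Longrightarrow> col r f \<in> carrier (path_algebra k G)"
  by (erule carrier_eqI) (auto simp: col_def split: if_splits)

lemma zero_closed: "0 \<in> carrier (path_algebra k G)"
  by (auto simp: path_algebra_simps)

lemma uminus_closed: "f \<in> carrier (path_algebra k G) \<Longrightarrow> - f \<in> carrier (path_algebra k G)"
  by (erule carrier_eqI) auto

lemma one_closed: "\<one>\<^bsub>path_algebra k G\<^esub> \<in> carrier (path_algebra k G)"
proof -
  have "{x. \<one>\<^bsub>path_algebra k G\<^esub> x \<noteq> 0} = (\<lambda>i. (i, [])) ` verts G"
    by (auto simp: path_algebra_simps split: if_splits)
  then show ?thesis by (auto simp: path_algebra_simps(1) paths_Nil)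
qed

lemma of_path_closed: "x \<in> paths G \<Longrightarrow> of_path x \<in> carrier (path_algebra k G)"
  by (auto simp: path_algebra_simps of_path_def)

lemma of_arrow_closed: "c \<in> arcs G \<Longrightarrow> of_arrow G c \<in> carrier (path_algebra k G)"
  unfolding of_arrow_def by (rule of_path_closed) (simp add: paths_Cons paths_Nil)

lemma shift_closed: "c \<in> arcs G \<Longrightarrow> f \<in> carrier (path_algebra k G) \<Longrightarrow> shift G c f \<in> carrier (path_algebra k G)"
  using path_mult_closed[OF _ of_arrow_closed[of c k]] by (simp add: mult_of_arrow)

lemma unshift_closed:
  assumes f: "f \<in> carrier (path_algebra k G)"
  shows "unshift G c f \<in> carrier (path_algebra k G)"
proof -
  have "{x. unshift G c f x \<noteq> 0} \<subseteq> (\<lambda>(i, p). (head G c, tl p)) ` {x. f x \<noteq> 0}"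
    by (auto simp: unshift_def image_iff split: if_splits) force
  moreover have "{x. unshift G c f x \<noteq> 0} \<subseteq> paths G"
    using f by (auto simp: unshift_def path_algebra_simps paths_Cons[symmetric] split: if_splits)
      (metis (mono_tags, lifting) mem_Collect_eq paths_Cons subsetD)
  ultimately show ?thesis using f unfolding path_algebra_simps by (meson finite_imageI finite_subset)
qed

lemma path_mult_one:
  assumes f: "f \<in> carrier (path_algebra k G)"
  shows "path_mult G f \<one>\<^bsub>path_algebra k G\<^esub> = f" "path_mult G \<one>\<^bsub>path_algebra k G\<^esub> f = f"
proof -
  have verts: "i \<in> verts G" "awlast i p \<in> verts G" if "f (i, p) \<noteq> 0" for i p
    using that f by (auto simp: path_algebra_simps paths_def intro: awalk_hd_in_verts awalk_last_in_verts)
  show "path_mult G f \<one>\<^bsub>path_algebra k G\<^esub> = f"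
    using verts(1) by (auto simp: fun_eq_iff path_mult_def path_algebra_simps sum.atMost_shift)
  show "path_mult G \<one>\<^bsub>path_algebra k G\<^esub> f = f"
  proof (intro ext, clarify)
    fix i p
    have "(\<Sum>n\<le>length p. \<one>\<^bsub>path_algebra k G\<^esub> (awlast i (take n p), drop n p) * f (i, take n p))
        = (\<Sum>n\<in>{length p}. \<one>\<^bsub>path_algebra k G\<^esub> (awlast i (take n p), drop n p) * f (i, take n p))"
      by (intro sum.mono_neutral_right) (auto simp: path_algebra_simps)
    also have "\<dots> = f (i, p)" using verts(2) by (auto simp: path_algebra_simps)
    finally show "path_mult G \<one>\<^bsub>path_algebra k G\<^esub> f (i, p) = f (i, p)" by (simp add: path_mult_def)
  qed
qed

lemma path_algebra_ring: "ring (path_algebra k G)"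
proof (rule ringI)
  show "abelian_group (path_algebra k G)"
  proof (rule abelian_groupI)
    fix f assume "f \<in> carrier (path_algebra k G)"
    then show "\<exists>g\<in>carrier (path_algebra k G). g \<oplus>\<^bsub>path_algebra k G\<^esub> f = \<zero>\<^bsub>path_algebra k G\<^esub>"
      by (intro bexI[of _ "- f"]) (auto simp: path_algebra_simps(3,4) uminus_closed)
  qed (auto simp: path_algebra_simps(3,4) path_algebra_add_closed zero_closed algebra_simps)
  show "Group.monoid (path_algebra k G)"
    by (rule monoidI) (auto simp: path_algebra_simps(2) path_mult_closed one_closed path_mult_one path_mult_assoc)
qed (auto simp: path_algebra_simps(2,3) path_mult_add_left path_mult_add_right)

lemma path_algebra_minus:
  assumes "f \<in> carrier (path_algebra k G)" "g \<in> carrier (path_algebra k G)"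
  shows "f \<ominus>\<^bsub>path_algebra k G\<^esub> g = f - g"
proof -
  interpret A: ring "path_algebra k G" by (rule path_algebra_ring)
  have "\<ominus>\<^bsub>path_algebra k G\<^esub> g = - g"
    using assms(2) by (intro A.minus_equality) (auto simp: path_algebra_simps(3,4) uminus_closed)
  then show ?thesis by (simp add: a_minus_def path_algebra_simps(3))
qed

end

section \<open>Right ideals above the preprojective relations\<close>

abbreviation dual :: "'a + 'a \<Rightarrow> 'a + 'a" where
  "dual \<equiv> case_sum Inr Inl"

text \<open>The sign with which the path \<open>dual c\<close> after \<open>c\<close> occurs in the preprojective relation.\<close>

definition arrow_sign :: "'a + 'a \<Rightarrow> 'k::field" where
  "arrow_sign c = case_sum (\<lambda>_. - 1) (\<lambda>_. 1) c"

lemma arrow_sign_square: "arrow_sign c * arrow_sign c = 1" and arrow_sign_nonzero: "arrow_sign c \<noteq> 0"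
  by (auto simp: arrow_sign_def split: sum.split)

lemma dual_dual [simp]: "dual (dual c) = c"
  by (simp split: sum.split)

lemma dual_eq_iff: "dual c = d \<longleftrightarrow> c = dual d"
  by (metis dual_dual)

lemma double_quiver_simps [simp]:
  "verts (double_quiver Q) = verts Q"
  "dual c \<in> arcs (double_quiver Q) \<longleftrightarrow> c \<in> arcs (double_quiver Q)"
  "tail (double_quiver Q) (dual c) = head (double_quiver Q) c"
  "head (double_quiver Q) (dual c) = tail (double_quiver Q) c"
  by (auto simp: double_quiver_def split: sum.split)

lemma arcs_double_quiver [simp]:
  "Inl a \<in> arcs (double_quiver Q) \<longleftrightarrow> a \<in> arcs Q" "Inr a \<in> arcs (double_quiver Q) \<longleftrightarrow> a \<in> arcs Q"
  by (auto simp: double_quiver_def)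

lemma sum_fun_apply: "(\<Sum>i\<in>I. F i) x = (\<Sum>i\<in>I. F i x)"
  by (induction I rule: infinite_finite_induct) auto

lemma (in ring) idealI_closed:
  assumes "I \<subseteq> carrier R" "\<zero> \<in> I" and add: "\<And>a b. a \<in> I \<Longrightarrow> b \<in> I \<Longrightarrow> a \<oplus> b \<in> I"
    and left: "\<And>a x. a \<in> I \<Longrightarrow> x \<in> carrier R \<Longrightarrow> x \<otimes> a \<in> I"
    and right: "\<And>a x. a \<in> I \<Longrightarrow> x \<in> carrier R \<Longrightarrow> a \<otimes> x \<in> I"
  shows "ideal I R"
proof (rule idealI)
  show "subgroup I (add_monoid R)"
  proof (rule add.subgroupI)
    fix a assume "a \<in> I"
    then have "a \<in> carrier R" "(\<ominus> \<one>) \<otimes> a \<in> I" using assms(1) left by auto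
    then show "\<ominus> a \<in> I" by (simp add: l_minus)
  qed (use assms in auto)
qed (auto simp: left right ring_axioms)

locale preprojective_quiver = loopfree_quiver Q for Q :: "('v, 'a) pre_digraph" +
  fixes k :: "'k::field itself"
begin

abbreviation D :: "('v, 'a + 'a) pre_digraph" where "D \<equiv> double_quiver Q"
abbreviation A :: "(('v, 'a + 'a) path \<Rightarrow> 'k) ring" where "A \<equiv> path_algebra k D"
abbreviation P :: "(('v, 'a + 'a) path \<Rightarrow> 'k) set" where "P \<equiv> preprojective_ideal k Q"
abbreviation rho :: "('v, 'a + 'a) path \<Rightarrow> 'k" where "rho \<equiv> preprojective_relation k Q"

text \<open>For an arrow \<open>c\<close> and \<open>z\<close> in the path algebra this is
  \<open>unshift D c\<close> applied to \<open>f - z * rho\<close>, by the product rule and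
  \<open>unshift_rho\<close>. The same \<open>z\<close> is meant to serve for several arrows
  simultaneously.\<close>

abbreviation residual where
  "residual c f z \<equiv> unshift D c f - scale (arrow_sign c) (shift D (dual c) z)"

sublocale D: fin_digraph D
  by unfold_locales (auto simp: double_quiver_def)

sublocale A: ring A
  by (rule D.path_algebra_ring)

lemma head_neq_tail: "c \<in> arcs D \<Longrightarrow> head D c \<noteq> tail D c"
  by (auto simp: double_quiver_def dest: no_loop)

lemma head_tail_in_verts:
  assumes "c \<in> arcs D"
  shows "head D c \<in> verts Q" "tail D c \<in> verts Q"
  using D.head_in_verts[OF assms] D.tail_in_verts[OF assms] by (simp_all only: double_quiver_simps)

lemma finsum_eq_sum:
  "finite I \<Longrightarrow> (\<And>i. i \<in> I \<Longrightarrow> F i \<in> carrier A) \<Longrightarrow> (\<Oplus>\<^bsub>A\<^esub>i\<in>I. F i) = (\<Sum>i\<in>I. F i)"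
proof (induction I rule: finite_induct)
  case empty
  then show ?case by (simp add: path_algebra_simps(4))
next
  case (insert i I)
  then show ?case by (subst A.finsum_insert) (auto simp: path_algebra_simps(3))
qed

lemma rho_closed: "rho \<in> carrier A"
  unfolding preprojective_relation_def Let_def
  by (intro A.finsum_closed Pi_I A.minus_closed A.m_closed D.of_arrow_closed) (auto simp: double_quiver_def)

lemma rho_eq: "rho = (\<Sum>a\<in>arcs Q. shift D (Inr a) (of_arrow D (Inl a)) - shift D (Inl a) (of_arrow D (Inr a)))"
proof -
  let ?x = "of_arrow D :: _ \<Rightarrow> _ \<Rightarrow> 'k"
  have x: "?x (Inl a) \<in> carrier A" "?x (Inr a) \<in> carrier A" if "a \<in> arcs Q" for a
    using that by (simp_all add: D.of_arrow_closed)
  have *: "?x (Inl a) \<otimes>\<^bsub>A\<^esub> ?x (Inr a) \<ominus>\<^bsub>A\<^esub> ?x (Inr a) \<otimes>\<^bsub>A\<^esub> ?x (Inl a)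
      = shift D (Inr a) (?x (Inl a)) - shift D (Inl a) (?x (Inr a))" if "a \<in> arcs Q" for a
    using x[OF that] that
    by (subst D.path_algebra_minus) (auto simp: path_algebra_simps(2) mult_of_arrow D.shift_closed)
  show ?thesis
    unfolding preprojective_relation_def Let_def
    using x by (subst finsum_eq_sum) (auto intro!: sum.cong *)
qed

lemma rho_Nil: "rho (i, []) = 0"
  unfolding rho_eq by (auto simp: sum_fun_apply shift_def)

text \<open>The relation is the sum over all arrows \<open>c\<close> of the double quiver of the
  signed paths \<open>dual c\<close> after \<open>c\<close>, so exactly one summand begins with a
  given \<open>c\<close>.\<close>

lemma unshift_rho:
  assumes "c \<in> arcs D"
  shows "unshift D c rho = scale (arrow_sign c) (of_arrow D (dual c))"
proof -
  have linear: "unshift D c (\<Sum>a\<in>I. F a) = (\<Sum>a\<in>I. unshift D c (F a))" for I :: "'a set" and F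
    by (auto simp: fun_eq_iff unshift_def sum_fun_apply)
  have col: "col (head D c) (of_arrow D (dual c)) = (of_arrow D (dual c) :: _ \<Rightarrow> 'k)"
    by (auto simp: of_arrow_def of_path_def col_def fun_eq_iff)
  obtain b where b: "b \<in> arcs Q" "c = Inl b \<or> c = Inr b"
    using assms by (auto simp: double_quiver_def)
  have "unshift D c rho = (\<Sum>a\<in>arcs Q. if a = b then scale (arrow_sign c) (of_arrow D (dual c)) else 0)"
    unfolding rho_eq linear
  proof (rule sum.cong[OF HOL.refl])
    fix a
    show "unshift D c (shift D (Inr a) (of_arrow D (Inl a)) - shift D (Inl a) (of_arrow D (Inr a)))
        = (if a = b then scale (arrow_sign c) (of_arrow D (dual c)) else (0 :: _ \<Rightarrow> 'k))"
      using b(2) col by (auto simp: unshift_linear unshift_shift arrow_sign_def scale_def fun_eq_iff)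
  qed
  then show ?thesis using b(1) by simp
qed

lemma ideal_P: "ideal P A"
  unfolding preprojective_ideal_def by (rule A.genideal_ideal) (simp add: rho_closed)

lemma rho_in_P: "rho \<in> P"
  unfolding preprojective_ideal_def by (rule A.genideal_self'[OF rho_closed])

lemma shift_one: "shift D c \<one>\<^bsub>A\<^esub> = (of_arrow D c :: _ \<Rightarrow> 'k)" if "c \<in> arcs D"
proof -
  have "\<one>\<^bsub>A\<^esub> (head D c, p) = (if p = [] then 1 else 0)" for p
    using head_tail_in_verts(1)[OF that] by (simp add: path_algebra_simps(5))
  then show ?thesis by (auto simp: fun_eq_iff shift_def of_arrow_def of_path_def neq_Nil_conv)
qed

lemma mult_unshift_rho:
  assumes "c \<in> arcs D" "z \<in> carrier A"
  shows "path_mult D z (unshift D c rho) = scale (arrow_sign c) (shift D (dual c) z)"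
  using assms by (simp add: unshift_rho path_mult_scale mult_of_arrow)

text \<open>These correspond to the right ideals of the preprojective algebra, but are kept inside
  the path algebra, where coefficients and first arrows of paths are available.\<close>

definition right_ideal :: "(('v, 'a + 'a) path \<Rightarrow> 'k) set \<Rightarrow> bool" where
  "right_ideal X \<longleftrightarrow> X \<subseteq> carrier A \<and> P \<subseteq> X \<and> (\<forall>f\<in>X. \<forall>g\<in>X. f + g \<in> X) \<and>
    (\<forall>f\<in>X. \<forall>g\<in>carrier A. path_mult D f g \<in> X)"

lemma right_ideal_carrier: "right_ideal (carrier A)"
  using ideal.Icarr[OF ideal_P] by (auto simp: right_ideal_def D.path_algebra_add_closed D.path_mult_closed)

lemma right_ideal_P: "right_ideal P"
proof -
  interpret P: ideal P A by (rule ideal_P)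
  show ?thesis using P.Icarr P.a_closed P.I_r_closed
    by (auto simp: right_ideal_def path_algebra_simps(2,3))
qed

text \<open>A path of positive length has exactly one first arrow, so an element without constant
  terms is the sum of its quotients times the arrows.\<close>

lemma sum_shift_unshift:
  assumes f: "f \<in> carrier A" and no_const: "\<And>r. f (r, []) = 0"
  shows "(\<Sum>c\<in>arcs D. shift D c (unshift D c f)) = f"
proof -
  have "f = (\<Sum>c\<in>arcs D. shift D c (unshift D c f))"
  proof (intro ext, clarify)
    fix i p
    show "f (i, p) = (\<Sum>c\<in>arcs D. shift D c (unshift D c f)) (i, p)"
    proof (cases p)
      case Nil
      then show ?thesis using no_const by (simp add: sum_fun_apply shift_def)
    next
      case (Cons c' q)
      have "(\<Sum>c\<in>arcs D. shift D c (unshift D c f)) (i, p)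
          = (\<Sum>c\<in>arcs D. if c = c' then (if i = tail D c' then f (i, p) else 0) else 0)"
        unfolding sum_fun_apply by (intro sum.cong) (auto simp: shift_def unshift_def Cons)
      also have "\<dots> = f (i, p)"
        using f Cons D.paths_Cons[of i c' q] by (auto simp: path_algebra_simps sum.delta)
      finally show ?thesis by simp
    qed
  qed
  then show ?thesis ..
qed

context
  fixes X assumes X: "right_ideal X"
begin

lemma right_ideal_subset: "f \<in> X \<Longrightarrow> f \<in> carrier A"
  and right_ideal_add: "f \<in> X \<Longrightarrow> g \<in> X \<Longrightarrow> f + g \<in> X"
  and right_ideal_mult: "f \<in> X \<Longrightarrow> g \<in> carrier A \<Longrightarrow> path_mult D f g \<in> X"
  and right_ideal_P_subset: "f \<in> P \<Longrightarrow> f \<in> X"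
  using X by (auto simp: right_ideal_def)

lemma right_ideal_zero: "0 \<in> X"
  using additive_subgroup.zero_closed[OF ideal.axioms(1)[OF ideal_P]] right_ideal_P_subset
  by (simp add: path_algebra_simps(4))

lemma right_ideal_scale: "f \<in> X \<Longrightarrow> scale t f \<in> X"
  using right_ideal_mult[of f "scale t \<one>\<^bsub>A\<^esub>"] right_ideal_subset[of f]
  by (simp add: path_mult_scale D.path_mult_one D.scale_closed D.one_closed)

lemma right_ideal_minus: "f \<in> X \<Longrightarrow> g \<in> X \<Longrightarrow> f - g \<in> X"
  using right_ideal_add[of f "scale (-1) g"] right_ideal_scale[of g "-1"]
  by (simp add: scale_def fun_diff_def plus_fun_def)

lemma right_ideal_scale_iff: "t \<noteq> 0 \<Longrightarrow> scale t f \<in> X \<longleftrightarrow> f \<in> X"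
  using right_ideal_scale[of "scale t f" "inverse t"] right_ideal_scale[of f t] by auto

lemma right_ideal_diff_iff: "f - g \<in> X \<Longrightarrow> f \<in> X \<longleftrightarrow> g \<in> X"
  using right_ideal_minus[of f "f - g"] right_ideal_add[of "f - g" g] by auto

lemma right_ideal_col: "f \<in> X \<Longrightarrow> col r f \<in> X"
proof (cases "r \<in> verts Q")
  case True
  then show "f \<in> X \<Longrightarrow> col r f \<in> X"
    using right_ideal_mult[of f "of_path (r, [])"] D.of_path_closed[of "(r, [])" k]
    by (simp add: mult_of_path_Nil D.paths_Nil)
next
  case False
  assume "f \<in> X"
  then have "f (r, p) = 0" for p
    using right_ideal_subset[of f] False
    by (auto simp: path_algebra_simps paths_def dest!: D.awalk_hd_in_verts)
  then have "col r f = 0" by (auto simp: col_def fun_eq_iff)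
  then show "col r f \<in> X" using right_ideal_zero by simp
qed

lemma right_ideal_shift: "c \<in> arcs D \<Longrightarrow> f \<in> X \<Longrightarrow> shift D c f \<in> X"
  using right_ideal_mult[of f "of_arrow D c"] D.of_arrow_closed[of c k] by (simp add: mult_of_arrow)

lemma right_ideal_sum: "(\<And>i. i \<in> I \<Longrightarrow> F i \<in> X) \<Longrightarrow> (\<Sum>i\<in>I. F i) \<in> X"
  by (induction I rule: infinite_finite_induct) (auto intro: right_ideal_zero right_ideal_add)

lemma right_ideal_unshiftI:
  assumes f: "f \<in> carrier A" and "\<And>r. f (r, []) = 0" and "\<And>c. c \<in> arcs D \<Longrightarrow> unshift D c f \<in> X"
  shows "f \<in> X"
proof -
  have "(\<Sum>c\<in>arcs D. shift D c (unshift D c f)) \<in> X"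
    using assms(3) by (intro right_ideal_sum right_ideal_shift)
  then show ?thesis using sum_shift_unshift[OF f assms(2)] by simp
qed

lemma right_ideal_colI:
  assumes f: "f \<in> carrier A" and "\<And>r. r \<in> verts Q \<Longrightarrow> col r f \<in> X"
  shows "f \<in> X"
proof -
  have "f = (\<Sum>r\<in>verts Q. col r f)"
  proof (intro ext, clarify)
    fix i p
    have "f (i, p) \<noteq> 0 \<Longrightarrow> i \<in> verts Q"
      using f by (auto simp: path_algebra_simps paths_def dest!: D.awalk_hd_in_verts)
    then show "f (i, p) = (\<Sum>r\<in>verts Q. col r f) (i, p)"
      by (auto simp: sum_fun_apply col_def)
  qed
  then show ?thesis using assms(2) right_ideal_sum[of "verts Q" "\<lambda>r. col r f"] by simp
qed

end

text \<open>
  The relation \<open>\<rho>\<close> freely generates the ideal up to elements \<open>p c\<close> with \<open>p\<close> in the ideal and \<open>c\<close>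
  an arrow.
\<close>

lemma P_unshift:
  assumes "f \<in> P"
  shows "f (i, []) = 0"
    and "\<exists>z\<in>carrier A. \<forall>c\<in>arcs D. residual c f z \<in> P"
proof -
  \<comment> \<open>The elements with the desired property form a two-sided ideal containing
    \<open>rho\<close>, hence all of \<open>P\<close>.\<close>
  define S where "S = {f \<in> P. (\<forall>i. f (i, []) = 0) \<and>
    (\<exists>z\<in>carrier A. \<forall>c\<in>arcs D. residual c f z \<in> P)}"
  interpret P: ideal P A by (rule ideal_P)
  note RP = right_ideal_P
  have mult_left: "path_mult D g f \<in> P" if "f \<in> P" "g \<in> carrier A" for f g
    using P.I_l_closed[OF that] by (simp add: path_algebra_simps(2))
  have S_add: "f + g \<in> S" if fg: "f \<in> S" "g \<in> S" for f g
  proof -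
    obtain z z' where z: "z \<in> carrier A" "\<forall>c\<in>arcs D. residual c f z \<in> P"
      "z' \<in> carrier A" "\<forall>c\<in>arcs D. unshift D c g - scale (arrow_sign c) (shift D (dual c) z') \<in> P"
      using fg by (auto simp: S_def)
    have "residual c (f + g) (z + z') =
      (residual c f z) + (unshift D c g - scale (arrow_sign c) (shift D (dual c) z'))" for c
      by (simp add: unshift_linear shift_linear fun_space.scale_right_distrib)
    then have "\<forall>c\<in>arcs D. residual c (f + g) (z + z') \<in> P"
      using z right_ideal_add[OF RP] by simp
    then show ?thesis using fg z right_ideal_add[OF RP]
      by (auto simp: S_def intro!: bexI[of _ "z + z'"] D.path_algebra_add_closed)
  qed
  have S_left: "path_mult D g f \<in> S" if fg: "f \<in> S" "g \<in> carrier A" for f g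
  proof -
    obtain z where z: "z \<in> carrier A" "\<forall>c\<in>arcs D. residual c f z \<in> P"
      using fg by (auto simp: S_def)
    have "residual c (path_mult D g f) (path_mult D g z) =
      path_mult D g (residual c f z)" if "f (tail D c, []) = 0" for c
      using that path_mult_add_right[of D g "residual c f z" "scale (arrow_sign c) (shift D (dual c) z)"]
      by (simp add: unshift_mult mult_shift path_mult_scale)
    then show ?thesis using fg z mult_left
      by (auto simp: S_def path_mult_Nil intro!: bexI[of _ "path_mult D g z"] D.path_mult_closed)
  qed
  have S_right: "path_mult D f g \<in> S" if fg: "f \<in> S" "g \<in> carrier A" for f g
  proof -
    obtain z where z: "z \<in> carrier A" "\<forall>c\<in>arcs D. residual c f z \<in> P"
      using fg by (auto simp: S_def)
    \<comment> \<open>On the right only the constant terms of \<open>g\<close> meet the witness, and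
      they rescale it column by column; all other contributions have \<open>f\<close> itself as a
      left factor.\<close>
    define z' where "z' = (\<lambda>(i, p). g (i, []) * z (i, p))"
    have z': "z' \<in> carrier A" by (rule carrier_eqI[OF z(1)]) (auto simp: z'_def split: prod.splits)
    have sh: "shift D (dual c) z' = scale (g (tail D c, [])) (shift D (dual c) z)" for c
      by (auto simp: fun_eq_iff shift_def z'_def scale_def)
    have "unshift D c (path_mult D f g) - scale (arrow_sign c) (shift D (dual c) z')
      = scale (g (tail D c, [])) (residual c f z)
        + path_mult D f (unshift D c g)" for c
      unfolding unshift_mult sh by (auto simp: fun_eq_iff scale_def algebra_simps)
    moreover have "f \<in> P" using fg by (simp add: S_def)
    ultimately show ?thesis using fg z z' RP
      by (auto simp: S_def path_mult_Nil intro!: bexI[of _ z'] right_ideal_add right_ideal_scale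
          right_ideal_mult D.unshift_closed)
  qed
  \<comment> \<open>The relation is its own multiple by the unit, which is therefore the
    witness.\<close>
  have S_rho: "rho \<in> S"
    using rho_in_P rho_Nil right_ideal_zero[OF RP]
    by (auto simp: S_def unshift_rho shift_one D.one_closed intro!: bexI[of _ "\<one>\<^bsub>A\<^esub>"])
  have S_zero: "0 \<in> S"
    using right_ideal_zero[OF RP]
    by (auto simp: S_def unshift_linear shift_linear D.zero_closed intro!: bexI[of _ 0])
  have S_sub: "S \<subseteq> carrier A" using P.a_subset by (auto simp: S_def)
  have "ideal S A"
    using S_sub S_zero S_add S_left S_right
    by (intro A.idealI_closed) (simp_all add: path_algebra_simps(2,3), simp only: path_algebra_simps(4))
  then have "P \<subseteq> S"
    unfolding preprojective_ideal_def using S_rho by (intro A.genideal_minimal) auto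
  then have "f \<in> S" using assms by blast
  then show "f (i, []) = 0"
    "\<exists>z\<in>carrier A. \<forall>c\<in>arcs D. residual c f z \<in> P"
    by (auto simp: S_def)
qed

end

section \<open>Right multiplication by vertex ideals, and its commutation and braid
  relations\<close>

context preprojective_quiver begin

text \<open>
  For a right ideal \<open>X\<close> above the relations, \<open>vmul X t\<close> is \<open>X I\<^sub>t\<close> plus the relations, where \<open>I\<^sub>t\<close>
  is the ideal of all elements without constant term at \<open>t\<close>: only the part starting at \<open>t\<close> changes,
  and it becomes the sum of the \<open>X c\<close> over the arrows \<open>c\<close> starting at \<open>t\<close>.
\<close>

definition vertex_part :: "(('v, 'a + 'a) path \<Rightarrow> 'k) set \<Rightarrow> 'v \<Rightarrow> (('v, 'a + 'a) path \<Rightarrow> 'k) \<Rightarrow> bool" where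
  "vertex_part X t f \<longleftrightarrow> f (t, []) = 0 \<and>
    (\<exists>z\<in>carrier A. \<forall>c\<in>arcs D. tail D c = t \<longrightarrow>
      residual c f z \<in> X)"

definition vmul :: "(('v, 'a + 'a) path \<Rightarrow> 'k) set \<Rightarrow> 'v \<Rightarrow> (('v, 'a + 'a) path \<Rightarrow> 'k) set" where
  "vmul X t = {f \<in> carrier A. (\<forall>r. r \<noteq> t \<longrightarrow> col r f \<in> X) \<and> vertex_part X t f}"

lemma residual_closed:
  assumes "f \<in> carrier A" "z \<in> carrier A" "c \<in> arcs D"
  shows "unshift D c f - scale t (shift D (dual c) z) \<in> carrier A"
  using assms right_ideal_minus[OF right_ideal_carrier]
  by (simp add: D.unshift_closed D.scale_closed D.shift_closed)

lemma col_residual: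
  "col (head D c) (unshift D c f - scale t (shift D (dual c) z)) = unshift D c f - scale t (shift D (dual c) z)"
  by (simp add: col_linear col_unshift col_shift)

lemma vertex_part_col: "vertex_part X t (col t f) \<longleftrightarrow> vertex_part X t f"
proof -
  have "col t f (t, []) = f (t, [])" by (simp add: col_def)
  then show ?thesis by (auto simp: vertex_part_def unshift_col)
qed

lemma vertex_part_mono: "vertex_part X t f \<Longrightarrow> X \<subseteq> Y \<Longrightarrow> vertex_part Y t f"
  by (auto simp: vertex_part_def)

lemma vmul_mono: "X \<subseteq> Y \<Longrightarrow> vmul X t \<subseteq> vmul Y t"
  unfolding vmul_def using vertex_part_mono by blast

context
  fixes X assumes X: "right_ideal X"
begin

text \<open>Subtracting the column at \<open>t\<close> of \<open>z * rho\<close> makes the witness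
  disappear: the quotients of the difference along the arrows out of \<open>t\<close> are the
  residuals, and along all other arrows they vanish.\<close>

lemma vmul_decomp:
  assumes f: "f \<in> vmul X t"
  shows "\<exists>h\<in>carrier A. \<exists>p\<in>P. col t f = h + p \<and> (\<forall>r. h (r, []) = 0) \<and> (\<forall>c\<in>arcs D. unshift D c h \<in> X)"
proof -
  obtain z where z: "z \<in> carrier A"
    "\<And>c. c \<in> arcs D \<Longrightarrow> tail D c = t \<Longrightarrow> residual c f z \<in> X"
    using f by (auto simp: vmul_def vertex_part_def)
  have fA: "f \<in> carrier A" using f by (simp add: vmul_def)
  have "path_mult D z rho \<in> P"
    using ideal.I_l_closed[OF ideal_P rho_in_P z(1)] by (simp add: path_algebra_simps(2))
  then have p: "col t (path_mult D z rho) \<in> P" by (rule right_ideal_col[OF right_ideal_P])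
  define h where "h = col t f - col t (path_mult D z rho)"
  have hA: "h \<in> carrier A" unfolding h_def
    using fA z(1) right_ideal_minus[OF right_ideal_carrier]
    by (simp add: D.col_closed D.path_mult_closed rho_closed)
  have hNil: "h (r, []) = 0" for r
    using f by (auto simp: h_def vmul_def vertex_part_def path_mult_Nil rho_Nil col_def)
  have "unshift D c h \<in> X" if c: "c \<in> arcs D" for c
  proof (cases "tail D c = t")
    case True
    then have "unshift D c h = residual c f z"
      using c z(1) rho_Nil[of "tail D c"]
      by (simp add: h_def unshift_linear unshift_col unshift_mult mult_unshift_rho)
    then show ?thesis using z(2)[OF c True] by simp
  next
    case False
    then show ?thesis using right_ideal_zero[OF X] by (simp add: h_def unshift_linear unshift_col)
  qed
  moreover have "col t f = h + col t (path_mult D z rho)" by (simp add: h_def)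
  ultimately show ?thesis using hA hNil p by blast
qed

lemma vmul_subset: "vmul X t \<subseteq> X"
proof
  fix f assume f: "f \<in> vmul X t"
  have fA: "f \<in> carrier A" using f by (simp add: vmul_def)
  obtain h p where h: "h \<in> carrier A" "p \<in> P" "col t f = h + p" "\<And>r. h (r, []) = 0"
    "\<And>c. c \<in> arcs D \<Longrightarrow> unshift D c h \<in> X"
    using vmul_decomp[OF f] by blast
  have "h \<in> X" by (rule right_ideal_unshiftI[OF X h(1,4,5)])
  then have "col t f \<in> X" using h(2,3) right_ideal_add[OF X] right_ideal_P_subset[OF X] by simp
  then have "col r f \<in> X" for r using f by (cases "r = t") (auto simp: vmul_def)
  then show "f \<in> X" by (rule right_ideal_colI[OF X fA])
qed

lemma vmul_right_ideal: "right_ideal (vmul X t)"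
  unfolding right_ideal_def
proof (intro conjI ballI subsetI)
  fix f assume "f \<in> vmul X t"
  then show "f \<in> carrier A" by (simp add: vmul_def)
next
  fix f assume f: "f \<in> P"
  have "vertex_part P t f" unfolding vertex_part_def using P_unshift[OF f] by blast
  then have "vertex_part X t f"
    using vertex_part_mono right_ideal_P_subset[OF X] by blast
  then show "f \<in> vmul X t"
    using right_ideal_subset[OF right_ideal_P f] right_ideal_col[OF right_ideal_P f] right_ideal_P_subset[OF X]
    by (auto simp: vmul_def)
next
  fix f g assume f: "f \<in> vmul X t" and g: "g \<in> vmul X t"
  obtain z z' where z: "z \<in> carrier A" "z' \<in> carrier A"
    "\<And>c. c \<in> arcs D \<Longrightarrow> tail D c = t \<Longrightarrow> residual c f z \<in> X"
    "\<And>c. c \<in> arcs D \<Longrightarrow> tail D c = t \<Longrightarrow> unshift D c g - scale (arrow_sign c) (shift D (dual c) z') \<in> X"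
    using f g by (auto simp: vmul_def vertex_part_def)
  have "residual c (f + g) (z + z') =
      (residual c f z) + (unshift D c g - scale (arrow_sign c) (shift D (dual c) z'))" for c
    by (simp add: unshift_linear shift_linear fun_space.scale_right_distrib)
  then have "vertex_part X t (f + g)"
    using f g z right_ideal_add[OF X]
    by (auto simp: vmul_def vertex_part_def intro!: bexI[of _ "z + z'"] D.path_algebra_add_closed)
  then show "f + g \<in> vmul X t"
    using f g right_ideal_add[OF X] by (auto simp: vmul_def D.path_algebra_add_closed col_linear)
next
  fix f g assume f: "f \<in> vmul X t" and g: "g \<in> carrier A"
  obtain z where z: "z \<in> carrier A"
    "\<And>c. c \<in> arcs D \<Longrightarrow> tail D c = t \<Longrightarrow> residual c f z \<in> X"
    using f by (auto simp: vmul_def vertex_part_def)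
  have fX: "f \<in> X" using f vmul_subset by blast
  \<comment> \<open>By the product rule the witness is only multiplied by the constant term of
    \<open>g\<close> at \<open>t\<close>.\<close>
  define z' where "z' = scale (g (t, [])) z"
  have "unshift D c (path_mult D f g) - scale (arrow_sign c) (shift D (dual c) z')
      = scale (g (t, [])) (residual c f z)
        + path_mult D f (unshift D c g)" if "tail D c = t" for c
    unfolding unshift_mult z'_def shift_linear that by (auto simp: fun_eq_iff scale_def algebra_simps)
  then have "vertex_part X t (path_mult D f g)"
    using f z g fX X
    by (auto simp: vmul_def vertex_part_def path_mult_Nil z'_def D.scale_closed intro!: bexI[of _ z']
        right_ideal_add right_ideal_scale right_ideal_mult D.unshift_closed)
  moreover have "col r (path_mult D f g) \<in> X" for r
    by (rule right_ideal_col[OF X right_ideal_mult[OF X fX g]])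
  ultimately show "path_mult D f g \<in> vmul X t"
    using f g by (auto simp: vmul_def D.path_mult_closed)
qed

text \<open>The trivial path at \<open>r\<close> lies in \<open>I_t\<close> for \<open>r\<close>
  different from \<open>t\<close>, so multiplication by \<open>I_t\<close> does not shrink the other
  columns.\<close>

lemma vmul_other:
  assumes "g \<in> carrier A" "col r g = g" "r \<noteq> t"
  shows "g \<in> vmul X t \<longleftrightarrow> g \<in> X"
proof -
  have "col r' g \<in> X" if "g \<in> X" for r'
    using that by (rule right_ideal_col[OF X])
  moreover have "vertex_part X t g"
  proof -
    have "unshift D c g = 0" if "tail D c = t" for c
      using that assms unshift_col[of D c r g] by simp
    moreover have "g (t, []) = 0" using assms(2,3) by (metis (mono_tags, lifting) case_prod_conv col_def)
    ultimately show ?thesis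
      using right_ideal_zero[OF X]
      by (auto simp: vertex_part_def shift_linear D.zero_closed intro!: bexI[of _ 0])
  qed
  ultimately show ?thesis using assms vmul_subset by (auto simp: vmul_def)
qed

lemma col_vmul: "f \<in> carrier A \<Longrightarrow> r \<noteq> t \<Longrightarrow> col r f \<in> vmul X t \<longleftrightarrow> col r f \<in> X"
  by (rule vmul_other[of _ r]) (auto simp: D.col_closed col_col)

lemma col_vmul_same:
  assumes "f \<in> carrier A"
  shows "col t f \<in> vmul X t \<longleftrightarrow> vertex_part X t f"
  using assms right_ideal_zero[OF X] by (auto simp: vmul_def vertex_part_col col_col D.col_closed)

lemma vmul_shift:
  assumes "f \<in> X" "c \<in> arcs D" "tail D c = t"
  shows "shift D c f \<in> vmul X t"
proof -
  have "shift D c f (t, []) = 0" by (simp add: shift_def)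
  then have "vertex_part X t (shift D c f)"
    using right_ideal_zero[OF X] right_ideal_col[OF X assms(1)]
    by (auto simp: vertex_part_def unshift_shift shift_linear D.zero_closed intro!: bexI[of _ 0])
  then show ?thesis using assms right_ideal_subset[OF X] right_ideal_zero[OF X]
    by (auto simp: vmul_def D.shift_closed col_shift)
qed

text \<open>A residual along \<open>c\<close> lies in the column at \<open>head D c\<close>, so a
  further multiplication at another vertex \<open>t\<close> does not restrict it.\<close>

lemma residual_vmul:
  assumes "f \<in> carrier A" "z \<in> carrier A" "c \<in> arcs D" "head D c \<noteq> t"
  shows "unshift D c f - scale e (shift D (dual c) z) \<in> vmul X t \<longleftrightarrow>
    unshift D c f - scale e (shift D (dual c) z) \<in> X"
  using assms residual_closed col_residual by (intro vmul_other[of _ "head D c"])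

end

text \<open>A common normal form for products of two and of three vertex ideals at \<open>s\<close>
  and \<open>t\<close>: \<open>Y\<close> is \<open>X\<close> for the commutation relation and
  \<open>X\<close> multiplied once at one of the two vertices for the braid relation. Both choices
  agree with \<open>X\<close> outside the two columns.\<close>

lemma vmul_vmul_iff:
  assumes X: "right_ideal X" and Y: "right_ideal Y" and st: "s \<noteq> t"
    and YX: "\<And>g r. g \<in> carrier A \<Longrightarrow> col r g = g \<Longrightarrow> r \<notin> {s, t} \<Longrightarrow> g \<in> Y \<longleftrightarrow> g \<in> X"
    and f: "f \<in> carrier A"
  shows "f \<in> vmul (vmul Y s) t \<longleftrightarrow> (\<forall>r. r \<notin> {s, t} \<longrightarrow> col r f \<in> X) \<and> vertex_part Y s f \<and>
    vertex_part (vmul Y s) t f"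
proof -
  have "col r f \<in> vmul Y s \<longleftrightarrow> (if r = s then vertex_part Y s f else col r f \<in> X)" if "r \<noteq> t" for r
  proof (cases "r = s")
    case True
    then show ?thesis using col_vmul_same[OF Y f] by simp
  next
    case False
    then show ?thesis using that f YX[of "col r f" r]
      by (simp add: col_vmul[OF Y f] D.col_closed col_col)
  qed
  then show ?thesis using f st by (auto simp: vmul_def[of "vmul Y s"])
qed

text \<open>Without arrows between \<open>s\<close> and \<open>t\<close> the condition at either
  vertex only inspects columns untouched by the other one.\<close>

lemma vmul_commute:
  assumes X: "right_ideal X" and st: "s \<noteq> t"
    and no: "\<And>c. c \<in> arcs D \<Longrightarrow> \<not> (tail D c = t \<and> head D c = s) \<and> \<not> (tail D c = s \<and> head D c = t)"
  shows "vmul (vmul X s) t = vmul (vmul X t) s"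
proof -
  have *: "vertex_part (vmul X s) t f \<longleftrightarrow> vertex_part X t f"
    if "s \<noteq> t" "\<And>c. c \<in> arcs D \<Longrightarrow> \<not> (tail D c = t \<and> head D c = s)" "f \<in> carrier A" for s t f
    unfolding vertex_part_def using that
    by (intro conj_cong bex_cong ball_cong imp_cong HOL.refl residual_vmul[OF X]) auto
  show ?thesis
  proof (rule Set.set_eqI)
    fix f
    show "f \<in> vmul (vmul X s) t \<longleftrightarrow> f \<in> vmul (vmul X t) s"
    proof (cases "f \<in> carrier A")
      case True
      then show ?thesis
        using st no *[of s t f] *[of t s f]
          vmul_vmul_iff[OF X X st _ True] vmul_vmul_iff[OF X X st[symmetric] _ True]
        by (auto simp: insert_commute)
    qed (simp add: vmul_def)
  qed
qed

text \<open>The residual \<open>u\<close> along the only arrow \<open>c0\<close> from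
  \<open>t\<close> to \<open>s\<close> has a witness of its own. Its residual \<open>x\<close> along
  \<open>dual c0\<close> ends up back in the column at \<open>t\<close>, and it can be absorbed into
  the original witness; afterwards the residual along \<open>dual c0\<close> is 0. By uniqueness of
  \<open>c0\<close> every other arrow out of \<open>s\<close> avoids \<open>t\<close>, and there the
  stronger condition costs nothing.\<close>

lemma vertex_part_braid:
  assumes X: "right_ideal X" and st: "s \<noteq> t"
    and c0: "c0 \<in> arcs D" "tail D c0 = t" "head D c0 = s"
    and unique: "\<And>c. c \<in> arcs D \<Longrightarrow> tail D c = t \<Longrightarrow> head D c = s \<Longrightarrow> c = c0"
    and f: "f \<in> carrier A" and vp: "vertex_part (vmul X s) t f"
  shows "vertex_part (vmul (vmul X t) s) t f"
proof -
  note Xs = vmul_right_ideal[OF X, of s] and Xt = vmul_right_ideal[OF X, of t]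
  note Xts = vmul_right_ideal[OF Xt, of s]
  let ?res = "\<lambda>c f z. residual c f z"
  obtain z where z: "z \<in> carrier A" "f (t, []) = 0"
    "\<And>c. c \<in> arcs D \<Longrightarrow> tail D c = t \<Longrightarrow> ?res c f z \<in> vmul X s"
    using vp by (auto simp: vertex_part_def)
  define u where "u = ?res c0 f z"
  have uA: "u \<in> carrier A" unfolding u_def using f z(1) c0(1) by (rule residual_closed)
  have ucol: "col s u = u" unfolding u_def using col_residual[of c0] c0(3) by simp
  have "u \<in> vmul X s" unfolding u_def using z(3) c0 by blast
  then obtain z' where z': "z' \<in> carrier A" "u (s, []) = 0"
    "\<And>d. d \<in> arcs D \<Longrightarrow> tail D d = s \<Longrightarrow> ?res d u z' \<in> X"
    by (auto simp: vmul_def vertex_part_def)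
  let ?d0 = "dual c0"
  have d0: "?d0 \<in> arcs D" "tail D ?d0 = s" "head D ?d0 = t" using c0 by simp_all
  define x where "x = ?res ?d0 u z'"
  have x: "x \<in> X" unfolding x_def using z'(3) d0 by blast
  have xA: "x \<in> carrier A" using right_ideal_subset[OF X x] .
  have xcol: "col t x = x" unfolding x_def using col_residual[of ?d0] d0(3) by simp
  \<comment> \<open>Since signs square to 1, this correction changes the residual along
    \<open>c0\<close> by exactly \<open>x * dual c0\<close>, and all other residuals by elements of
    \<open>X\<close>.\<close>
  define w where "w = z + scale (arrow_sign c0) x"
  have wA: "w \<in> carrier A" unfolding w_def using z(1) xA by (simp add: D.path_algebra_add_closed D.scale_closed)
  have res_w: "?res c f w = ?res c f z - scale (arrow_sign c * arrow_sign c0) (shift D (dual c) x)" for c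
    unfolding w_def shift_linear by (simp add: fun_eq_iff scale_def algebra_simps)
  have "?res c f w \<in> vmul (vmul X t) s" if c: "c \<in> arcs D" "tail D c = t" for c
  proof (cases "c = c0")
    case False
    then have h: "head D c \<noteq> s" "head D c \<noteq> t" using unique c head_neq_tail[OF c(1)] by auto
    have "?res c f z \<in> X" using z(3)[OF c] vmul_subset[OF X] by blast
    moreover have "shift D (dual c) x \<in> X" using c x by (intro right_ideal_shift[OF X]) simp_all
    ultimately have "?res c f w \<in> X"
      unfolding res_w by (rule right_ideal_minus[OF X _ right_ideal_scale[OF X]])
    then show ?thesis
      using h c residual_vmul[OF Xt f wA c(1)] residual_vmul[OF X f wA c(1)] by simp
  next
    case True
    define u' where "u' = u - shift D ?d0 x"
    have u'_eq: "?res c f w = u'"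
      unfolding res_w u'_def u_def True by (simp add: arrow_sign_square)
    have u'A: "u' \<in> carrier A" unfolding u'_eq[symmetric] using f wA c(1) by (rule residual_closed)
    have u'col: "col s u' = u'" unfolding u'_eq[symmetric] True using col_residual[of c0] c0(3) by simp
    have "vertex_part (vmul X t) s u'"
      unfolding vertex_part_def
    proof (intro conjI bexI[of _ z'] ballI impI z'(1))
      show "u' (s, []) = 0" using z'(2) by (simp add: u'_def shift_def)
      fix d assume d: "d \<in> arcs D" "tail D d = s"
      show "?res d u' z' \<in> vmul X t"
      proof (cases "d = ?d0")
        case True
        have "?res d u' z' = 0"
          unfolding u'_def True unshift_linear unshift_shift using xcol d0(3)
          by (simp add: x_def)
        then show ?thesis using right_ideal_zero[OF Xt] by simp
      next
        case False
        have "head D d \<noteq> t"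
        proof
          assume "head D d = t"
          then have "dual d = c0" using d by (intro unique) simp_all
          then show False using False by (metis dual_dual)
        qed
        moreover have "?res d u' z' = ?res d u z'"
          unfolding u'_def unshift_linear unshift_shift using False by simp
        ultimately show ?thesis
          using z'(3)[OF d] residual_vmul[OF X uA z'(1) d(1)] by simp
      qed
    qed
    then have "col s u' \<in> vmul (vmul X t) s" using col_vmul_same[OF Xt u'A] by simp
    then show ?thesis using u'_eq u'col by simp
  qed
  then show ?thesis using z(2) wA by (auto simp: vertex_part_def)
qed

text \<open>Both triple products reduce to the same three conditions: membership in \<open>X\<close>
  off the two columns, the condition at \<open>t\<close> over \<open>vmul X s\<close>, and the
  condition at \<open>s\<close> over \<open>vmul X t\<close>.\<close>

lemma vmul_braid:
  assumes X: "right_ideal X" and st: "s \<noteq> t"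
    and c0: "c0 \<in> arcs D" "tail D c0 = t" "head D c0 = s"
    and unique: "\<And>c. c \<in> arcs D \<Longrightarrow> tail D c = t \<Longrightarrow> head D c = s \<Longrightarrow> c = c0"
  shows "vmul (vmul (vmul X s) t) s = vmul (vmul (vmul X t) s) t"
proof -
  note Xs = vmul_right_ideal[OF X, of s] and Xt = vmul_right_ideal[OF X, of t]
  have unique': "c = dual c0" if "c \<in> arcs D" "tail D c = s" "head D c = t" for c
    using unique[of "dual c"] that by (simp add: dual_eq_iff)
  have eq1: "vertex_part (vmul X s) t f \<longleftrightarrow> vertex_part (vmul (vmul X t) s) t f" if "f \<in> carrier A" for f
    using vertex_part_braid[OF X st c0 unique that] vertex_part_mono[OF _ vmul_mono[OF vmul_subset[OF X]]]
    by blast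
  have eq2: "vertex_part (vmul X t) s f \<longleftrightarrow> vertex_part (vmul (vmul X s) t) s f" if "f \<in> carrier A" for f
    using vertex_part_braid[OF X st[symmetric], of "dual c0" f] c0 unique' that
      vertex_part_mono[OF _ vmul_mono[OF vmul_subset[OF X]]] by auto
  have YX: "g \<in> vmul X p \<longleftrightarrow> g \<in> X" if "g \<in> carrier A" "col r g = g" "r \<notin> {s, t}" "p \<in> {s, t}" for g r p
    using that by (intro vmul_other[OF X, of g r]) auto
  show ?thesis
  proof (rule Set.set_eqI)
    fix f
    show "f \<in> vmul (vmul (vmul X s) t) s \<longleftrightarrow> f \<in> vmul (vmul (vmul X t) s) t"
    proof (cases "f \<in> carrier A")
      case True
      have "f \<in> vmul (vmul (vmul X s) t) s \<longleftrightarrow> (\<forall>r. r \<notin> {t, s} \<longrightarrow> col r f \<in> X) \<and> vertex_part (vmul X s) t f \<and>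
          vertex_part (vmul (vmul X s) t) s f"
        using YX by (intro vmul_vmul_iff[OF X Xs st[symmetric] _ True]) auto
      moreover have "f \<in> vmul (vmul (vmul X t) s) t \<longleftrightarrow> (\<forall>r. r \<notin> {s, t} \<longrightarrow> col r f \<in> X) \<and> vertex_part (vmul X t) s f \<and>
          vertex_part (vmul (vmul X t) s) t f"
        using YX by (intro vmul_vmul_iff[OF X Xt st _ True]) auto
      ultimately show ?thesis using eq1[OF True] eq2[OF True] by (simp add: insert_commute) blast
    qed (simp add: vmul_def)
  qed
qed

end

section \<open>Saturation\<close>

primrec alternating :: "'v \<Rightarrow> 'v \<Rightarrow> nat \<Rightarrow> 'v list" where
  "alternating p q 0 = []"
| "alternating p q (Suc n) = p # alternating q p n"

lemma eq_alternating:
  assumes "set d \<subseteq> {p, q}" "d \<noteq> []" "hd d = p" "\<And>a i b. d \<noteq> a @ [i, i] @ b"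
  shows "d = alternating p q (length d)"
  using assms
proof (induction d arbitrary: p q)
  case (Cons x d)
  show ?case
  proof (cases d)
    case (Cons y d')
    then have "x \<noteq> y" using Cons.prems(4)[of "[]" x d'] by auto
    then have "d = alternating q p (length d)"
      using Cons Cons.prems Cons.prems(4)[of "x # _"]
      by (intro Cons.IH) auto
    then show ?thesis using Cons.prems by simp
  qed (use Cons.prems in auto)
qed simp

context preprojective_quiver begin

text \<open>With \<open>foldr\<close> the first letter acts last, as its ideal is the rightmost
  factor of the ideal of a word.\<close>

abbreviation word_mul :: "'v list \<Rightarrow> (('v, 'a + 'a) path \<Rightarrow> 'k) set \<Rightarrow> (('v, 'a + 'a) path \<Rightarrow> 'k) set" where
  "word_mul x X \<equiv> foldr (\<lambda>t X. vmul X t) x X"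

abbreviation W :: "'v list \<Rightarrow> (('v, 'a + 'a) path \<Rightarrow> 'k) set" where
  "W x \<equiv> word_mul x (carrier A)"

lemma vmul_residual:
  "f \<in> vmul X t \<Longrightarrow> \<exists>z. z \<in> carrier A \<and> (\<forall>c\<in>arcs D. tail D c = t \<longrightarrow>
    residual c f z \<in> X)"
  by (auto simp: vmul_def vertex_part_def)

text \<open>\<open>X\<close> is saturated at \<open>s\<close> if the simple module at \<open>s\<close> is no submodule of the quotient by \<open>X\<close>.\<close>

definition saturated :: "'v \<Rightarrow> (('v, 'a + 'a) path \<Rightarrow> 'k) set \<Rightarrow> bool" where
  "saturated s X \<longleftrightarrow> (\<forall>q\<in>carrier A. (\<forall>d\<in>arcs D. head D d = s \<longrightarrow> shift D d q \<in> X) \<longrightarrow> col s q \<in> X)"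

lemma word_mul_right_ideal: "right_ideal X \<Longrightarrow> right_ideal (word_mul x X)"
  by (induction x) (auto intro: vmul_right_ideal)

lemma word_mul_subset: "right_ideal X \<Longrightarrow> word_mul x X \<subseteq> X"
proof (induction x)
  case (Cons t x)
  then show ?case using vmul_subset[OF word_mul_right_ideal, of X x t] by auto
qed simp

lemma word_mul_other:
  assumes "right_ideal X" "g \<in> carrier A" "col r g = g" "r \<notin> set x"
  shows "g \<in> word_mul x X \<longleftrightarrow> g \<in> X"
  using assms(4)
proof (induction x)
  case (Cons t x)
  then show ?case using vmul_other[OF word_mul_right_ideal[OF assms(1)] assms(2,3), of t x] by auto
qed simp

lemma W_right_ideal: "right_ideal (W x)"
  by (rule word_mul_right_ideal[OF right_ideal_carrier])

lemma W_append_subset: "W (x @ y) \<subseteq> W y"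
  by (simp add: word_mul_subset W_right_ideal)

text \<open>In the double quiver every edge between \<open>s\<close> and \<open>t\<close>
  contributes one arrow in each direction.\<close>

lemma card_arrows:
  assumes "s \<noteq> t"
  shows "card {c \<in> arcs D. tail D c = t \<and> head D c = s} = num_arrows Q s t"
proof -
  let ?S = "{a \<in> arcs Q. tail Q a = t \<and> head Q a = s}" and ?T = "{a \<in> arcs Q. tail Q a = s \<and> head Q a = t}"
  have "{c \<in> arcs D. tail D c = t \<and> head D c = s} = Inl ` ?S \<union> Inr ` ?T"
    by (auto simp: double_quiver_def)
  then have "card {c \<in> arcs D. tail D c = t \<and> head D c = s} = card ?S + card ?T"
    by (simp, subst card_Un_disjoint) (auto simp: card_image)
  also have "\<dots> = card (?S \<union> ?T)"
    using assms by (subst card_Un_disjoint) auto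
  also have "?S \<union> ?T = {a \<in> arcs Q. tail Q a = s \<and> head Q a = t \<or> tail Q a = t \<and> head Q a = s}"
    by auto
  finally show ?thesis by (simp add: num_arrows_def)
qed

lemma word_mul_braid_move:
  assumes X: "right_ideal X" and xy: "braid_move Q x y"
  shows "word_mul x X = word_mul y X"
  using xy
proof (induction rule: braid_move.induct)
  case (commute i j p q)
  have Y: "right_ideal (word_mul q X)" by (rule word_mul_right_ideal[OF X])
  show ?case
  proof (cases "i = j")
    case False
    have none: "{c \<in> arcs D. tail D c = t \<and> head D c = s} = {}" if "s \<noteq> t" "num_arrows Q s t = 0" for s t
      using card_arrows[OF that(1)] that(2) by simp
    have "vmul (vmul (word_mul q X) i) j = vmul (vmul (word_mul q X) j) i"
      using none[of i j] none[of j i] False commute(3) num_arrows_commute[of Q i j]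
      by (intro vmul_commute[OF Y]) auto
    then show ?thesis by simp
  qed simp
next
  case (braid i j p q)
  have Y: "right_ideal (word_mul q X)" by (rule word_mul_right_ideal[OF X])
  have ij: "i \<noteq> j" using braid(3) num_arrows_self by (metis zero_neq_one)
  have "card {c \<in> arcs D. tail D c = j \<and> head D c = i} = 1" using card_arrows[OF ij] braid(3) by simp
  then obtain c0 where c0: "{c \<in> arcs D. tail D c = j \<and> head D c = i} = {c0}"
    by (rule card_1_singletonE)
  have "vmul (vmul (vmul (word_mul q X) i) j) i = vmul (vmul (vmul (word_mul q X) j) i) j"
    using c0 by (intro vmul_braid[OF Y ij, of c0]) auto
  then show ?case by simp
qed

lemma W_braid_equiv: "braid_equiv Q x y \<Longrightarrow> W x = W y"
  by (induction rule: rtranclp_induct) (auto dest: word_mul_braid_move[OF right_ideal_carrier])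

lemma saturatedD:
  "saturated s X \<Longrightarrow> q \<in> carrier A \<Longrightarrow> (\<And>d. d \<in> arcs D \<Longrightarrow> head D d = s \<Longrightarrow> shift D d q \<in> X) \<Longrightarrow> col s q \<in> X"
  by (auto simp: saturated_def)

section \<open>Saturation in rank two\<close>

lemma saturated_vmul:
  assumes X: "right_ideal X" and "saturated s X" "s \<noteq> t"
  shows "saturated s (vmul X t)"
  unfolding saturated_def
proof (intro ballI impI)
  fix q assume q: "q \<in> carrier A" "\<forall>d\<in>arcs D. head D d = s \<longrightarrow> shift D d q \<in> vmul X t"
  then have "col s q \<in> X"
    using vmul_subset[OF X] by (intro saturatedD[OF assms(2)]) auto
  then show "col s q \<in> vmul X t" using col_vmul[OF X q(1) assms(3)] by simp
qed

text \<open>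
  The family \<open>z\<close> is, modulo \<open>M\<close>, a homomorphism from a module over the Kronecker quiver with arrows
  \<open>c\<^sub>1\<close>, \<open>c\<^sub>2\<close> from \<open>p\<close> to \<open>q\<close>, whose values at \<open>q\<close> are given by \<open>y\<close>.
\<close>

definition kronecker_hom where
  "kronecker_hom X M p q c1 c2 \<kappa> z y \<longleftrightarrow>
    c1 \<in> arcs D \<and> tail D c1 = q \<and> head D c1 = p \<and> c2 \<in> arcs D \<and> tail D c2 = q \<and> head D c2 = p \<and> c1 \<noteq> c2 \<and>
    (\<forall>j :: int. z j \<in> carrier A \<and> y j \<in> X \<and>
      shift D c1 (z j) - y (j - 1) \<in> M \<and> shift D c2 (z j) - scale \<kappa> (y j) \<in> M \<and>
      (\<forall>d\<in>arcs D. head D d = p \<longrightarrow> d \<noteq> c1 \<longrightarrow> d \<noteq> c2 \<longrightarrow> shift D d (z j) \<in> M))"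

lemma kronecker_hom_shift:
  assumes X: "right_ideal X" and MX: "M \<subseteq> X" and h: "kronecker_hom X M p q c1 c2 \<kappa> z y"
    and d: "d \<in> arcs D" "head D d = p"
  shows "shift D d (z j) \<in> X"
proof -
  have "shift D c1 (z j) - y (j - 1) \<in> X" "shift D c2 (z j) - scale \<kappa> (y j) \<in> X"
    "y (j - 1) \<in> X" "scale \<kappa> (y j) \<in> X"
    using h MX right_ideal_scale[OF X] by (auto simp: kronecker_hom_def)
  then have "shift D c1 (z j) \<in> X" "shift D c2 (z j) \<in> X" using right_ideal_diff_iff[OF X] by blast+
  moreover have "d \<noteq> c1 \<Longrightarrow> d \<noteq> c2 \<Longrightarrow> shift D d (z j) \<in> X"
    using h MX d by (auto simp: kronecker_hom_def)
  ultimately show ?thesis by (cases "d = c1"; cases "d = c2") simp_all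
qed

text \<open>
  The relations extend such a homomorphism to one from the reflection of the module. Iterating this,
  one arrives at a homomorphism into the quotient by \<open>X\<close>, which vanishes by saturation.
\<close>

lemma alternating_lift:
  assumes X: "right_ideal X" and "saturated p X" "saturated q X"
    and "kronecker_hom X (word_mul (alternating q p R) X) p q c1 c2 \<kappa> z y"
  shows "col p (z j) \<in> word_mul (alternating p q (R - 1)) X"
  using assms(2-)
proof (induction R arbitrary: p q c1 c2 z y \<kappa> j)
  case (0 p q c1 c2 z y \<kappa> j)
  have "shift D d (z j) \<in> X" if d: "d \<in> arcs D" "head D d = p" for d
    using kronecker_hom_shift[OF X _ 0(3) d] word_mul_subset[OF X] by blast
  moreover have "z j \<in> carrier A" using 0(3) by (simp add: kronecker_hom_def)
  ultimately show ?case using saturatedD[OF 0(1)] by simp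
next
  case (Suc n p q c1 c2 z y \<kappa> j)
  note sat = Suc.prems(1,2) and hom = Suc.prems(3)[unfolded kronecker_hom_def]
  have c1: "c1 \<in> arcs D" "tail D c1 = q" "head D c1 = p" and c2: "c2 \<in> arcs D" "tail D c2 = q" "head D c2 = p"
    and ne: "c1 \<noteq> c2" and z: "\<And>j. z j \<in> carrier A" and y: "\<And>j. y j \<in> X"
    and h1: "\<And>j. shift D c1 (z j) - y (j - 1) \<in> word_mul (alternating q p (Suc n)) X"
    and h2: "\<And>j. shift D c2 (z j) - scale \<kappa> (y j) \<in> word_mul (alternating q p (Suc n)) X"
    using hom by blast+
  let ?B = "word_mul (alternating p q n) X"
  have B: "right_ideal ?B" by (rule word_mul_right_ideal[OF X])
  have M: "right_ideal (vmul ?B q)" by (rule vmul_right_ideal[OF B])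
  have MX: "vmul ?B q \<subseteq> X" using vmul_subset[OF B] word_mul_subset[OF X] by blast
  have h1': "shift D c1 (z j) - y (j - 1) \<in> vmul ?B q"
    and h2': "shift D c2 (z j) - scale \<kappa> (y j) \<in> vmul ?B q" for j
    using h1[of j] h2[of j] by simp_all
  have "shift D d (z j) \<in> X" if d: "d \<in> arcs D" "head D d = p" for d j
    using kronecker_hom_shift[OF X _ Suc.prems(3) d] word_mul_subset[OF X] by blast
  then have zX: "col p (z j) \<in> X" for j using saturatedD[OF sat(1) z] by simp
  \<comment> \<open>Modulo the target both terms equal the same multiple of
    \<open>y (j - 1)\<close>, so the values \<open>y\<close> cancel and \<open>f j\<close> lies in
    the product by \<open>I_q\<close>. Its witness provides the values on the reflected
    module.\<close>
  define f where "f j = scale \<kappa> (shift D c1 (z j)) - shift D c2 (z (j - 1))" for j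
  have "f j \<in> vmul ?B q" for j
  proof -
    have "f j = scale \<kappa> (shift D c1 (z j) - y (j - 1)) - (shift D c2 (z (j - 1)) - scale \<kappa> (y (j - 1)))"
      by (simp add: f_def fun_space.scale_right_diff_distrib)
    then show ?thesis
      using right_ideal_minus[OF M right_ideal_scale[OF M h1'] h2'] by simp
  qed
  then have "\<forall>j. \<exists>z. z \<in> carrier A \<and> (\<forall>c\<in>arcs D. tail D c = q \<longrightarrow>
      residual c (f j) z \<in> ?B)"
    using vmul_residual by blast
  then obtain zp where zp: "\<And>j. zp j \<in> carrier A"
    "\<And>j c. c \<in> arcs D \<Longrightarrow> tail D c = q \<Longrightarrow>
      residual c (f j) (zp j) \<in> ?B"
    by metis
  have unshift_f: "unshift D c (f j) =
      scale \<kappa> (if c = c1 then col p (z j) else 0) - (if c = c2 then col p (z (j - 1)) else 0)" for c j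
    unfolding f_def unshift_linear unshift_shift using c1 c2 by auto
  have r1: "scale \<kappa> (col p (z j)) - scale (arrow_sign c1) (shift D (dual c1) (zp j)) \<in> ?B" for j
    using zp(2)[of c1 j] c1 ne by (simp add: unshift_f)
  have r2: "- col p (z (j - 1)) - scale (arrow_sign c2) (shift D (dual c2) (zp j)) \<in> ?B" for j
    using zp(2)[of c2 j] c2 ne by (simp add: unshift_f)
  have r3: "shift D d (zp j) \<in> ?B"
    if "d \<in> arcs D" "head D d = q" "d \<noteq> dual c1" "d \<noteq> dual c2" for d j
  proof -
    have "dual d \<noteq> c1" "dual d \<noteq> c2" using that(3,4) dual_eq_iff by metis+
    then have "- scale (arrow_sign (dual d)) (shift D d (zp j)) \<in> ?B"
      using zp(2)[of "dual d" j] that(1,2) by (simp add: unshift_f)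
    then have "scale (- arrow_sign (dual d)) (shift D d (zp j)) \<in> ?B"
      by (simp add: fun_space.scale_minus_left)
    then show ?thesis using right_ideal_scale_iff[OF B] arrow_sign_nonzero by (metis neg_equal_0_iff_equal)
  qed
  \<comment> \<open>The vertices are exchanged, the arrows become \<open>dual c2\<close> and
    \<open>dual c1\<close>, and the modulus has lost its last factor \<open>I_q\<close>. The new
    \<open>y\<close> is the column of \<open>z\<close> at \<open>p\<close> up to sign, which lies in
    \<open>X\<close> by saturation at \<open>p\<close>.\<close>
  have IH: "col q (zp j) \<in> word_mul (alternating q p (n - 1)) X" for j
  proof (rule Suc.IH[OF sat(2,1)])
    have 1: "scale (- arrow_sign c2) (col p (z j)) \<in> X" for j
      by (rule right_ideal_scale[OF X zX])
    have 2: "shift D (dual c2) (zp j) - scale (- arrow_sign c2) (col p (z (j - 1))) \<in> ?B" for j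
    proof -
      have "scale (- arrow_sign c2) (- col p (z (j - 1)) - scale (arrow_sign c2) (shift D (dual c2) (zp j))) =
          scale (arrow_sign c2) (col p (z (j - 1))) + scale (arrow_sign c2 * arrow_sign c2) (shift D (dual c2) (zp j))"
        by (auto simp: fun_eq_iff scale_def algebra_simps)
      also have "\<dots> = shift D (dual c2) (zp j) - scale (- arrow_sign c2) (col p (z (j - 1)))"
        by (simp add: arrow_sign_square fun_space.scale_minus_left)
      finally show ?thesis using right_ideal_scale[OF B r2[of j], of "- arrow_sign c2"] by simp
    qed
    have 3: "shift D (dual c1) (zp j) - scale (- arrow_sign c1 * \<kappa> * arrow_sign c2) (scale (- arrow_sign c2) (col p (z j))) \<in> ?B" for j
    proof -
      have "scale (- arrow_sign c1) (scale \<kappa> (col p (z j)) - scale (arrow_sign c1) (shift D (dual c1) (zp j))) =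
          scale (arrow_sign c1 * arrow_sign c1) (shift D (dual c1) (zp j)) - scale (arrow_sign c1 * \<kappa>) (col p (z j))"
        by (auto simp: fun_eq_iff scale_def algebra_simps)
      also have "\<dots> = shift D (dual c1) (zp j) - scale (arrow_sign c1 * \<kappa> * (arrow_sign c2 * arrow_sign c2)) (col p (z j))"
        by (simp add: arrow_sign_square)
      also have "\<dots> = shift D (dual c1) (zp j) - scale (- arrow_sign c1 * \<kappa> * arrow_sign c2) (scale (- arrow_sign c2) (col p (z j)))"
        by (simp add: mult.assoc)
      finally show ?thesis using right_ideal_scale[OF B r1[of j], of "- arrow_sign c1"] by simp
    qed
    have "dual c2 \<noteq> dual c1" using ne dual_dual by metis
    then show "kronecker_hom X ?B q p (dual c2) (dual c1) (- arrow_sign c1 * \<kappa> * arrow_sign c2) zp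
        (\<lambda>j. scale (- arrow_sign c2) (col p (z j)))"
      unfolding kronecker_hom_def using c1 c2 zp(1) 1 2 3 r3 by (simp only: double_quiver_simps) blast
  qed
  \<comment> \<open>The index is \<open>j + 1\<close> because \<open>r2\<close> links
    \<open>z j\<close> to \<open>zp (j + 1)\<close>. As \<open>dual c2\<close> starts at
    \<open>p\<close>, multiplying by it gains the factor \<open>I_p\<close> of \<open>?B\<close>
    that the induction hypothesis does not provide.\<close>
  have "shift D (dual c2) (zp (j + 1)) \<in> ?B"
  proof -
    have eq: "shift D (dual c2) (zp (j + 1)) = shift D (dual c2) (col q (zp (j + 1)))"
      using c2 by (simp add: shift_col)
    have d: "dual c2 \<in> arcs D" "tail D (dual c2) = p" using c2 by simp_all
    show ?thesis
    proof (cases n)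
      case 0
      then show ?thesis using IH[of "j + 1"] right_ideal_shift[OF X d(1)] eq by simp
    next
      case (Suc m)
      have "right_ideal (word_mul (alternating q p m) X)" by (rule word_mul_right_ideal[OF X])
      then show ?thesis using IH[of "j + 1"] vmul_shift[OF _ _ d] eq Suc by simp
    qed
  qed
  then have "scale (arrow_sign c2) (shift D (dual c2) (zp (j + 1))) \<in> ?B" by (rule right_ideal_scale[OF B])
  then have "- col p (z j) \<in> ?B" using r2[of "j + 1"] right_ideal_diff_iff[OF B] by simp
  then have "scale (- 1) (col p (z j)) \<in> ?B" by (simp add: fun_space.scale_minus_left)
  then show ?case using right_ideal_scale_iff[OF B, of "-1"] by simp
qed

text \<open>The bounds on \<open>n\<close> say that \<open>s\<close> in front of the alternating
  word is still reduced in the dihedral group, whose longest element has length 2 without arrows and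
  3 with a single one. With at least two arrows the group is infinite and \<open>n\<close> is
  arbitrary.\<close>

lemma saturated_alternating:
  assumes X: "right_ideal X" and sat: "saturated s X" "saturated t X" and st: "s \<noteq> t"
    and "num_arrows Q s t = 0 \<Longrightarrow> n \<le> 1" "num_arrows Q s t = 1 \<Longrightarrow> n \<le> 2"
  shows "saturated s (word_mul (alternating t s n) X)"
proof -
  consider "n = 0" | "n = 1" | "n = 2" "num_arrows Q s t = 1" | "2 \<le> num_arrows Q s t" "n \<ge> 1"
    using assms(5,6) by linarith
  then show ?thesis
  proof cases
    case 1
    then show ?thesis using sat by simp
  next
    case 2
    then show ?thesis using saturated_vmul[OF X sat(1) st] by simp
  next
    case 3
    have "card {c \<in> arcs D. tail D c = t \<and> head D c = s} = 1" using card_arrows[OF st] 3(2) by simp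
    then obtain c0 where c0: "{c \<in> arcs D. tail D c = t \<and> head D c = s} = {c0}"
      by (rule card_1_singletonE)
    note Xs = vmul_right_ideal[OF X, of s]
    have "saturated s (vmul (vmul X s) t)"
      unfolding saturated_def
    proof (intro ballI impI)
      fix q assume q: "q \<in> carrier A" and h: "\<forall>d\<in>arcs D. head D d = s \<longrightarrow> shift D d q \<in> vmul (vmul X s) t"
      have qX: "col s q \<in> X"
        using h vmul_subset[OF Xs] vmul_subset[OF X] by (intro saturatedD[OF sat(1) q]) blast
      have c0': "c0 \<in> arcs D" "tail D c0 = t" "head D c0 = s" using c0 by auto
      then have "shift D c0 q \<in> vmul (vmul X s) t" using h by blast
      from vmul_residual[OF this] obtain z where "z \<in> carrier A \<and> (\<forall>c\<in>arcs D. tail D c = t \<longrightarrow>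
          residual c (shift D c0 q) z \<in> vmul X s)" ..
      then have z: "z \<in> carrier A" "\<And>c. c \<in> arcs D \<Longrightarrow> tail D c = t \<Longrightarrow>
          residual c (shift D c0 q) z \<in> vmul X s"
        by blast+
      \<comment> \<open>Up to sign the column of \<open>q\<close> at \<open>s\<close> is now
        \<open>z * dual c0\<close>. It remains to bring the column of \<open>z\<close> at
        \<open>t\<close> into \<open>X\<close>, which is done by saturation at
        \<open>t\<close>.\<close>
      have r: "col s q - scale (arrow_sign c0) (shift D (dual c0) z) \<in> vmul X s"
        using z(2)[of c0] c0' by (simp add: unshift_shift)
      have "shift D d z \<in> X" if d: "d \<in> arcs D" "head D d = t" for d
      proof (cases "d = dual c0")
        case True
        have "scale (arrow_sign c0) (shift D (dual c0) z) \<in> X"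
          using r vmul_subset[OF X] qX right_ideal_diff_iff[OF X] by blast
        then show ?thesis using True right_ideal_scale_iff[OF X arrow_sign_nonzero] by metis
      next
        case False
        have "c0 \<noteq> dual d" using False by (metis dual_dual)
        then have "- scale (arrow_sign (dual d)) (shift D d z) \<in> vmul X s"
          using z(2)[of "dual d"] d by (simp add: unshift_shift)
        then have "scale (- arrow_sign (dual d)) (shift D d z) \<in> X"
          using vmul_subset[OF X] by (auto simp: fun_space.scale_minus_left)
        then show ?thesis using right_ideal_scale_iff[OF X] arrow_sign_nonzero by (metis neg_equal_0_iff_equal)
      qed
      then have "col t z \<in> X" by (rule saturatedD[OF sat(2) z(1)])
      then have "shift D (dual c0) (col t z) \<in> vmul X s"
        using c0' by (intro vmul_shift[OF X]) simp_all
      then have "scale (arrow_sign c0) (shift D (dual c0) z) \<in> vmul X s"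
        using c0' by (simp add: shift_col right_ideal_scale[OF Xs])
      then have "col s q \<in> vmul X s" using r right_ideal_diff_iff[OF Xs] by blast
      then show "col s q \<in> vmul (vmul X s) t" using col_vmul[OF Xs q st] by simp
    qed
    then show ?thesis using 3 by (simp add: numeral_2_eq_2)
  next
    case 4
    have "\<not> card {c \<in> arcs D. tail D c = t \<and> head D c = s} \<le> Suc 0"
      using 4 card_arrows[OF st] by simp
    then obtain c1 c2 where c: "c1 \<in> arcs D" "tail D c1 = t" "head D c1 = s"
      "c2 \<in> arcs D" "tail D c2 = t" "head D c2 = s" "c1 \<noteq> c2"
      by (subst (asm) card_le_Suc0_iff_eq) auto
    let ?M = "word_mul (alternating t s n) X"
    have M: "right_ideal ?M" by (rule word_mul_right_ideal[OF X])
    show ?thesis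
      unfolding saturated_def
    proof (intro ballI impI)
      fix q assume q: "q \<in> carrier A" and h: "\<forall>d\<in>arcs D. head D d = s \<longrightarrow> shift D d q \<in> ?M"
      \<comment> \<open>The simple module at \<open>s\<close> is viewed as a Kronecker module
        concentrated at index 0, with all \<open>y\<close> equal to 0. The other indices are present
        because each reflection combines neighbouring ones.\<close>
      define z where "z j = (if j = 0 then q else 0)" for j :: int
      have hz: "shift D d (z j) \<in> ?M" if "d \<in> arcs D" "head D d = s" for d j
        using h that right_ideal_zero[OF M] by (auto simp: z_def shift_linear)
      have "col s (z 0) \<in> word_mul (alternating s t (n - 1)) X"
      proof (rule alternating_lift[OF X sat])
        show "kronecker_hom X ?M s t c1 c2 0 z (\<lambda>_. 0)"
          unfolding kronecker_hom_def using q hz c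
          by (auto simp: z_def D.zero_closed right_ideal_zero[OF X])
      qed
      then have "col s q \<in> word_mul (alternating s t (n - 1)) X" by (simp add: z_def)
      \<comment> \<open>The one factor still missing is \<open>I_t\<close>, which does not restrict
        the column at \<open>s\<close>.\<close>
      then show "col s q \<in> ?M"
        using 4(2) col_vmul[OF word_mul_right_ideal[OF X, of "alternating s t (n - 1)"] q st]
        by (cases n) auto
    qed
  qed
qed

theorem braid_reduced_saturated:
  assumes "braid_reduced Q x" "set x \<subseteq> verts Q" "s \<in> verts Q"
  shows "(\<exists>y. braid_equiv Q x (s # y)) \<or> saturated s (W x)"
  using assms
proof (induction "length x" arbitrary: x s rule: less_induct)
  case less
  show ?case
  proof (cases x)
    case Nil
    then show ?thesis by (simp add: saturated_def D.col_closed)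
  next
    case (Cons t x1)
    show ?thesis
    proof (cases "t = s")
      case True
      then show ?thesis using Cons by blast
    next
      case False
      \<comment> \<open>A shortest \<open>x'\<close> stands in for the minimal representative of a
        coset of the dihedral subgroup on \<open>s\<close> and \<open>t\<close>: no braid-equivalent
        form of it begins with either letter, so the induction hypothesis gives saturation at
        both.\<close>
      define Pr where "Pr = (\<lambda>(d, x'). set d \<subseteq> {s, t} \<and> braid_equiv Q x (d @ x'))"
      have "Pr ([t], x1)" by (simp add: Pr_def Cons)
      then obtain dx where dx: "Pr dx" "\<And>y. Pr y \<Longrightarrow> length (snd dx) \<le> length (snd y)"
        using ex_has_least_nat[of Pr "([t], x1)" "\<lambda>y. length (snd y)"] by blast
      obtain d x' where "dx = (d, x')" by (cases dx)
      with dx have d: "set d \<subseteq> {s, t}" "braid_equiv Q x (d @ x')"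
        and least: "\<And>d' y. set d' \<subseteq> {s, t} \<Longrightarrow> braid_equiv Q x (d' @ y) \<Longrightarrow> length x' \<le> length y"
        by (force simp: Pr_def)+
      have len: "length x' < length x" using least[of "[t]" x1] Cons by simp
      have red: "braid_reduced Q (d @ x')" using less.prems(1) d(2) by (rule braid_reduced_equiv)
      have verts: "set (d @ x') \<subseteq> verts Q" using braid_equiv_set[OF d(2)] less.prems(2) by simp
      have "\<nexists>y. braid_equiv Q x' (r # y)" if "r \<in> {s, t}" for r
      proof
        assume "\<exists>y. braid_equiv Q x' (r # y)"
        then obtain y where y: "braid_equiv Q x' (r # y)" by blast
        then have "braid_equiv Q (d @ x') (d @ r # y)"
          using braid_equiv_context[of Q x' "r # y" d "[]"] by simp
        then have "braid_equiv Q x ((d @ [r]) @ y)" using d(2) by (simp add: rtranclp_trans)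
        then have "length x' \<le> length y" using d(1) that by (intro least[of "d @ [r]"]) auto
        then show False using braid_equiv_set[OF y] by simp
      qed
      moreover have "(\<exists>y. braid_equiv Q x' (r # y)) \<or> saturated r (W x')" if "r \<in> {s, t}" for r
        using len braid_reduced_suffix[OF red] verts less.prems(2,3) that Cons
        by (intro less.hyps) auto
      ultimately have sat: "saturated s (W x')" "saturated t (W x')" by blast+
      have "d \<noteq> []" using len braid_equiv_set[OF d(2)] by auto
      have adj: "d \<noteq> a @ [i, i] @ b" for a i b
        using red unfolding braid_reduced_def by (metis append.assoc rtranclp.rtrancl_refl)
      consider "hd d = s" | "hd d = t" using d(1) \<open>d \<noteq> []\<close> by (cases d) auto
      then show ?thesis
      proof cases
        case 1
        then have "d @ x' = s # tl d @ x'" using \<open>d \<noteq> []\<close> by (cases d) auto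
        then show ?thesis using d(2) by metis
      next
        case 2
        define n where "n = length d"
        have dn: "d = alternating t s n"
          unfolding n_def using d(1) \<open>d \<noteq> []\<close> 2 adj by (intro eq_alternating) auto
        have s: "s \<in> verts Q" "t \<in> verts Q" using less.prems(2,3) Cons by auto
        \<comment> \<open>If \<open>d\<close> is at least as long as the longest dihedral element, a
          single move brings \<open>s\<close> to the front; otherwise the rank-two result
          applies.\<close>
        consider "num_arrows Q s t = 0" "n \<ge> 2" | "num_arrows Q s t = 1" "n \<ge> 3"
          | "num_arrows Q s t = 0 \<Longrightarrow> n \<le> 1" "num_arrows Q s t = 1 \<Longrightarrow> n \<le> 2"
          by linarith
        then show ?thesis
        proof cases
          case 1
          then obtain n' where "n = Suc (Suc n')" by (metis add_2_eq_Suc le_Suc_ex)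
          then have dx: "d @ x' = [] @ [t, s] @ (alternating t s n' @ x')" by (simp add: dn)
          have "braid_move Q (d @ x') ([] @ [s, t] @ (alternating t s n' @ x'))"
            unfolding dx using s 1 by (intro braid_move.commute) (simp_all add: num_arrows_commute)
          then have "braid_equiv Q x ([] @ [s, t] @ (alternating t s n' @ x'))"
            using d(2) by (rule rtranclp.rtrancl_into_rtrancl[rotated])
          then show ?thesis by auto
        next
          case 2
          then obtain n' where "n = Suc (Suc (Suc n'))" by (metis add_Suc numeral_3_eq_3 add_0 le_Suc_ex)
          then have dx: "d @ x' = [] @ [t, s, t] @ (alternating s t n' @ x')" by (simp add: dn)
          have "braid_move Q (d @ x') ([] @ [s, t, s] @ (alternating s t n' @ x'))"
            unfolding dx using s 2 by (intro braid_move.braid) (simp_all add: num_arrows_commute)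
          then have "braid_equiv Q x ([] @ [s, t, s] @ (alternating s t n' @ x'))"
            using d(2) by (rule rtranclp.rtrancl_into_rtrancl[rotated])
          then show ?thesis by auto
        next
          case 3
          have "saturated s (word_mul (alternating t s n) (W x'))"
            using 3 False by (intro saturated_alternating[OF W_right_ideal sat]) auto
          then have "saturated s (W (d @ x'))" by (simp add: dn)
          then show ?thesis using W_braid_equiv[OF d(2)] by simp
        qed
      qed
    qed
  qed
qed

end

section \<open>Sortability from the vanishing of reversed arrows\<close>

context preprojective_quiver begin

text \<open>
  The layer belonging to the letter \<open>i\<close> after the word \<open>x\<close> is annihilated by the arrows that run
  against the orientation in which the arrows go from earlier to later letters of \<open>v\<close>.
\<close>

definition oriented_layer :: "'v list \<Rightarrow> 'v list \<Rightarrow> 'v \<Rightarrow> bool" where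
  "oriented_layer v x i \<longleftrightarrow>
    (\<forall>d\<in>arcs D. subseq [head D d, tail D d] v \<longrightarrow> (\<forall>f\<in>W x. shift D d f \<in> W (x @ [i])))"

lemma W_Nil_coeff: "f \<in> W x \<Longrightarrow> r \<in> set x \<Longrightarrow> f (r, []) = 0"
proof (induction x)
  case (Cons t x)
  have "f \<in> vmul (W x) t" using Cons.prems(1) by simp
  then have "f \<in> W x" "f (t, []) = 0"
    using vmul_subset[OF W_right_ideal] by (auto simp: vmul_def vertex_part_def)
  then show ?case using Cons.IH Cons.prems(2) by auto
qed simp

text \<open>The relation only has paths of length two, so the coefficient of a single arrow
  \<open>d\<close> is not changed by multiples of it. That coefficient is the constant term at
  \<open>head D d\<close> of an element of \<open>W q\<close>, hence 0.\<close>

lemma W_arrow_coeff: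
  assumes f: "f \<in> W (p @ r # q)" and d: "d \<in> arcs D" "tail D d = r" "head D d \<in> set q"
  shows "f (r, [d]) = 0"
proof -
  have "f \<in> vmul (W q) r" using W_append_subset[of p "r # q"] f by auto
  from vmul_residual[OF this] obtain z where
    "unshift D d f - scale (arrow_sign d) (shift D (dual d) z) \<in> W q" using d by blast
  then have "(unshift D d f - scale (arrow_sign d) (shift D (dual d) z)) (head D d, []) = 0"
    using d(3) by (rule W_Nil_coeff)
  then show ?thesis using d(2) by (simp add: unshift_def scale_def shift_def)
qed

lemma col_of_path: "col r (of_path (r, p)) = of_path (r, p)"
  by (auto simp: col_def of_path_def fun_eq_iff)

lemma vertex_in_W:
  assumes "s \<in> verts Q" "s \<notin> set x"
  shows "of_path (s, []) \<in> W x"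
proof -
  have "of_path (s, []) \<in> carrier A" using assms(1) by (intro D.of_path_closed) (simp add: D.paths_Nil)
  then show ?thesis
    using word_mul_other[OF right_ideal_carrier _ col_of_path assms(2)] by blast
qed

text \<open>The arrow is the trivial path at its head times the arrow itself. The trivial path stays
  in every \<open>W x\<close> avoiding that vertex, and the factor \<open>d\<close> accounts for the
  letter at the tail.\<close>

lemma arrow_in_W_if_head_notin:
  assumes d: "d \<in> arcs D" and "head D d \<notin> set x"
  shows "of_arrow D d \<in> W x"
  using assms(2)
proof (induction x)
  case Nil
  then show ?case using D.of_arrow_closed[OF d] by simp
next
  case (Cons u x)
  have aA: "of_arrow D d \<in> carrier A" using d by (rule D.of_arrow_closed)
  have acol: "col (tail D d) (of_arrow D d) = of_arrow D d" unfolding of_arrow_def by (rule col_of_path)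
  show ?case
  proof (cases "u = tail D d")
    case True
    have "of_path (head D d, []) \<in> W x"
      using head_tail_in_verts[OF d] Cons.prems by (intro vertex_in_W) auto
    then have "shift D d (of_path (head D d, [])) \<in> vmul (W x) u"
      using True d by (intro vmul_shift[OF W_right_ideal]) simp_all
    moreover have "shift D d (of_path (head D d, [])) = (of_arrow D d :: _ \<Rightarrow> 'k)"
      by (auto simp: of_arrow_def of_path_def shift_def fun_eq_iff neq_Nil_conv)
    ultimately show ?thesis by simp
  next
    case False
    then show ?thesis using Cons vmul_other[OF W_right_ideal aA acol, of u x] by auto
  qed
qed

text \<open>These are the arrows that become zero in \<open>kQ\<close>. The suffix after the head of
  \<open>d\<close> contains the arrow because it avoids the head, and the letters in front of that
  suffix differ from the tail, so they leave its column alone.\<close>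

lemma arrow_in_W:
  assumes d: "d \<in> arcs D" "subseq [head D d, tail D d] v" and v: "distinct v"
  shows "of_arrow D d \<in> W v"
  using d(2) v
proof (induction v rule: list.induct)
  case Nil
  then show ?case by (simp add: subseq_Nil_right)
next
  case (Cons t v)
  have aA: "of_arrow D d \<in> carrier A" using d(1) by (rule D.of_arrow_closed)
  have acol: "col (tail D d) (of_arrow D d) = of_arrow D d" unfolding of_arrow_def by (rule col_of_path)
  have "of_arrow D d \<in> W v \<and> tail D d \<noteq> t"
  proof (cases "t = head D d")
    case True
    then show ?thesis
      using Cons.prems(2) head_neq_tail[OF d(1)] arrow_in_W_if_head_notin[OF d(1), of v] by auto
  next
    case False
    then have sub: "subseq [head D d, tail D d] v"
      using Cons.prems(1) by (auto simp: subseq_Cons_right)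
    then show ?thesis using Cons subseq_set_subset[OF sub] by auto
  qed
  then show ?case using vmul_other[OF W_right_ideal aA acol] by simp
qed

text \<open>For arrows \<open>d\<close> not starting at \<open>s\<close> the condition is
  transferred directly, since it concerns columns that \<open>I_s\<close> does not touch. If
  \<open>d\<close> starts at \<open>s\<close>, then \<open>f d\<close> lies in the product by
  \<open>I_s\<close>, every arrow into \<open>s\<close> from a letter of \<open>v\<close> is
  reversed with respect to \<open>s # v\<close> and maps \<open>f d\<close> into the smaller ideal,
  and saturation removes that arrow again.\<close>

lemma oriented_layer_rotate:
  assumes v: "distinct (s # v)" and set: "set x \<subseteq> insert s (set v)" "i \<in> insert s (set v)"
    and sat: "saturated s (W (x @ [i]))" and layer: "oriented_layer (s # v) (s # x) i"
  shows "oriented_layer (v @ [s]) x i"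
  unfolding oriented_layer_def
proof (intro ballI impI)
  fix d f assume d: "d \<in> arcs D" "subseq [head D d, tail D d] (v @ [s])" and f: "f \<in> W x"
  note R = W_right_ideal[of x] and R' = W_right_ideal[of "x @ [i]"]
  have fA: "f \<in> carrier A" by (rule right_ideal_subset[OF R f])
  have layerD: "shift D d g \<in> vmul (W (x @ [i])) s"
    if "d \<in> arcs D" "subseq [head D d, tail D d] (s # v)" "g \<in> vmul (W x) s" for d g
    using layer that by (simp add: oriented_layer_def)
  have other: "g \<in> W (x @ [i])" if "g \<in> vmul (W (x @ [i])) s" for g
    using that vmul_subset[OF R'] by blast
  have headv: "head D d \<noteq> s"
  proof
    assume "head D d = s"
    with d(2) have "subseq [s, tail D d] (v @ [s])" by simp
    moreover have "tail D d \<noteq> s" using head_neq_tail[OF d(1)] \<open>head D d = s\<close> by simp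
    ultimately have "subseq [s, tail D d] v"
      by (auto elim!: subseq_appendE simp: subseq_Cons_right subseq_Nil_right Cons_eq_append_conv append_eq_Cons_conv)
    then show False using v subseq_set_subset by fastforce
  qed
  show "shift D d f \<in> W (x @ [i])"
  proof (cases "tail D d = s")
    case False
    then have "subseq [head D d, tail D d] v"
      using d(2) by (auto elim!: subseq_appendE simp: subseq_Cons_right subseq_Nil_right Cons_eq_append_conv append_eq_Cons_conv)
    moreover have "col (head D d) f \<in> vmul (W x) s"
      using col_vmul[OF R fA headv] right_ideal_col[OF R f] by simp
    ultimately have "shift D d (col (head D d) f) \<in> vmul (W (x @ [i])) s"
      using d(1) by (intro layerD) (simp_all add: subseq_Cons_right)
    then show ?thesis using other by (simp add: shift_col)
  next
    case True
    have q: "shift D d f \<in> vmul (W x) s" using f d(1) True by (rule vmul_shift[OF R])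
    have qA: "shift D d f \<in> carrier A" using d(1) fA by (rule D.shift_closed)
    have "shift D e (shift D d f) \<in> W (x @ [i])" if e: "e \<in> arcs D" "head D e = s" for e
    proof (cases "tail D e \<in> set v")
      case True
      then have "subseq [head D e, tail D e] (s # v)" using e by (simp add: subseq_singleton_left)
      then show ?thesis using layerD[OF e(1) _ q] other by blast
    next
      \<comment> \<open>Such an arrow starts outside the support of the word, where
        \<open>W (x @ [i])\<close> is no restriction.\<close>
      case False
      moreover have "tail D e \<noteq> s" using head_neq_tail[OF e(1)] e(2) by simp
      ultimately have e': "tail D e \<notin> set (x @ [i])" using set by auto
      have eA: "shift D e (shift D d f) \<in> carrier A" by (rule D.shift_closed[OF e(1) qA])
      have "col (tail D e) (shift D e (shift D d f)) = shift D e (shift D d f)" by (simp add: col_shift)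
      from word_mul_other[OF right_ideal_carrier eA this e'] show ?thesis using eA by blast
    qed
    then have "col s (shift D d f) \<in> W (x @ [i])" by (intro saturatedD[OF sat qA])
    then show ?thesis using True by (simp add: col_shift)
  qed
qed

lemma braid_equiv_commute_snoc:
  assumes "s \<in> verts Q" "\<And>r. r \<in> set x \<Longrightarrow> r \<in> verts Q \<and> num_arrows Q s r = 0"
  shows "braid_equiv Q (x @ [s]) (s # x)"
  using assms(2)
proof (induction x)
  case (Cons r x)
  have "braid_equiv Q (r # x @ [s]) (r # s # x)" using Cons by (intro braid_equiv_Cons) auto
  moreover have "braid_move Q (r # s # x) (s # r # x)"
    using braid_move.commute[of r Q s "[]" x] assms(1) Cons.prems[of r] by (simp add: num_arrows_commute)
  ultimately show ?case by simp
qed simp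

text \<open>As \<open>s\<close> does not occur in \<open>x\<close>, the trivial path at
  \<open>s\<close> lies in \<open>W x\<close>. An arrow \<open>d\<close> from \<open>r\<close> to
  \<open>s\<close> is reversed, so the layer condition would put \<open>d\<close> itself into
  \<open>W (x @ [s])\<close>; but there its coefficient vanishes because \<open>r\<close> precedes
  \<open>s\<close>.\<close>

lemma oriented_layer_first:
  assumes "s \<in> verts Q" "set v \<subseteq> verts Q" "s \<notin> set x" "set x \<subseteq> set v" "oriented_layer (s # v) x s" "r \<in> set x"
  shows "num_arrows Q s r = 0"
proof (rule ccontr)
  assume "num_arrows Q s r \<noteq> 0"
  moreover have "s \<noteq> r" using assms by blast
  ultimately have "{c \<in> arcs D. tail D c = r \<and> head D c = s} \<noteq> {}"
    using card_arrows[of s r] by (metis card.empty)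
  then obtain d where d: "d \<in> arcs D" "tail D d = r" "head D d = s" by blast
  have "subseq [head D d, tail D d] (s # v)" using d assms(4,6) by (auto simp: subseq_singleton_left)
  then have "shift D d (of_path (s, [])) \<in> W (x @ [s])"
    using assms(5) d(1) vertex_in_W[OF assms(1,3)] by (auto simp: oriented_layer_def)
  moreover obtain p q where "x = p @ r # q" using assms(6) by (meson split_list)
  ultimately have "shift D d (of_path (s, [])) \<in> W (p @ r # (q @ [s]))" by simp
  from W_arrow_coeff[OF this d(1,2)] d(3) have "shift D d (of_path (s, [])) (r, [d]) = (0 :: 'k)" by simp
  then show False using d by (simp add: shift_def of_path_def)
qed

text \<open>One step of the second implication. In a rotation, reducedness keeps \<open>s\<close>
  from coming to the front of \<open>x @ [i]\<close>, which is what saturation requires. If the new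
  letter is the skipped first letter itself, it commutes with \<open>x\<close> and can be moved to
  the front.\<close>

theorem sortable_word_extend:
  assumes "sortable_word v x" "distinct v" "set v \<subseteq> verts Q" "braid_reduced Q (x @ [i])" "i \<in> set v"
    "oriented_layer v x i"
  shows "\<exists>y. braid_equiv Q (x @ [i]) y \<and> sortable_word v y"
  using assms
proof (induction arbitrary: i rule: sortable_word.induct)
  case (Nil v)
  then show ?case using sortable_word_singleton[of i v] by auto
next
  case (rotate v s x)
  have set: "set x \<subseteq> insert s (set v)" using sortable_word_set[OF rotate.hyps] by auto
  have red: "braid_reduced Q (x @ [i])" using rotate.prems(3) braid_reduced_suffix[of Q "[s]"] by simp
  have "\<not> braid_equiv Q (x @ [i]) (s # y)" for y
  proof
    assume "braid_equiv Q (x @ [i]) (s # y)"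
    then have "braid_equiv Q ((s # x) @ [i]) ([] @ [s, s] @ y)" using braid_equiv_Cons by fastforce
    then show False using rotate.prems(3) unfolding braid_reduced_def by blast
  qed
  moreover have "set (x @ [i]) \<subseteq> verts Q" "s \<in> verts Q" using rotate.prems set by auto
  ultimately have "saturated s (W (x @ [i]))" using braid_reduced_saturated[OF red] by blast
  then have "oriented_layer (v @ [s]) x i"
    using rotate.prems set by (intro oriented_layer_rotate) auto
  then obtain y where "braid_equiv Q (x @ [i]) y" "sortable_word (v @ [s]) y"
    using rotate.IH[of i] rotate.prems red by auto
  then have "braid_equiv Q ((s # x) @ [i]) (s # y)" "sortable_word (s # v) (s # y)"
    using braid_equiv_Cons[of Q "x @ [i]" y s] by (auto intro: sortable_word.rotate)
  then show ?case by blast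
next
  case (skip s x v)
  have set: "set x \<subseteq> set v" using sortable_word_set[OF skip.hyps(2)] .
  show ?case
  proof (cases "i = s")
    case True
    have "num_arrows Q s r = 0" if "r \<in> set x" for r
      using skip.prems skip.hyps(1) set that True by (intro oriented_layer_first[of s v x r]) auto
    then have "braid_equiv Q (x @ [s]) (s # x)"
      using skip.prems set by (intro braid_equiv_commute_snoc) auto
    moreover have "sortable_word (v @ [s]) x"
      using sortable_word_insert[OF skip.hyps(2), of v "[]" s] skip.hyps(1) by simp
    then have "sortable_word (s # v) (s # x)" by (rule sortable_word.rotate)
    ultimately show ?thesis using True by blast
  next
    case False
    have "oriented_layer v x i"
      using skip.prems(5) by (auto simp: oriented_layer_def subseq_Cons_right)
    then obtain y where y: "braid_equiv Q (x @ [i]) y" "sortable_word v y"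
      using skip.IH[of i] skip.prems False by auto
    then have "s \<notin> set y" using braid_equiv_set[OF y(1)] skip.hyps(1) False by auto
    then have "sortable_word (s # v) y" using y(2) by (rule sortable_word.skip)
    then show ?thesis using y(1) by blast
  qed
qed

text \<open>The ideals depend only on words up to braid moves, so after each letter the prefix may
  be replaced by a sortable one without disturbing the condition on the next layer.\<close>

theorem oriented_layers_sortable:
  assumes v: "distinct v" "set v = verts Q" and u: "set u \<subseteq> verts Q" "braid_reduced Q u"
    and layers: "\<And>x i y. u = x @ i # y \<Longrightarrow> oriented_layer v x i"
  shows "\<exists>y. braid_equiv Q u y \<and> sortable_word v y"
  using u layers
proof (induction u rule: rev_induct)
  case Nil
  then show ?case by (auto intro: sortable_word.Nil)
next
  case (snoc i x)
  have "braid_reduced Q x" using snoc.prems(2) by (rule braid_reduced_prefix)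
  then obtain y where y: "braid_equiv Q x y" "sortable_word v y"
    using snoc.IH snoc.prems by (metis append_Cons append_assoc le_sup_iff set_append)
  have yi: "braid_equiv Q (x @ [i]) (y @ [i])" using y(1) by (rule braid_equiv_snoc)
  have "oriented_layer v x i" using snoc.prems(3)[of x i "[]"] by simp
  then have "oriented_layer v y i"
    using W_braid_equiv[OF y(1)] W_braid_equiv[OF yi] by (simp only: oriented_layer_def)
  then obtain y' where "braid_equiv Q (y @ [i]) y'" "sortable_word v y'"
    using sortable_word_extend[OF y(2) v(1) _ braid_reduced_equiv[OF snoc.prems(2) yi]] v(2) snoc.prems(1)
    by auto
  then show ?case using yi by (meson rtranclp_trans)
qed

end

section \<open>Adic completions\<close>

context ring begin

lemma ideal_prod_one_left:
  assumes "ideal I R"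
  shows "carrier R \<cdot> I = I"
proof
  show "carrier R \<cdot> I \<subseteq> I" using ideal_prod_inter[OF oneideal assms] by blast
  show "I \<subseteq> carrier R \<cdot> I"
  proof
    fix x assume x: "x \<in> I"
    then have "\<one> \<otimes> x \<in> carrier R \<cdot> I" by (intro ideal_prod.prod) auto
    then show "x \<in> carrier R \<cdot> I" using ideal.Icarr[OF assms x] by simp
  qed
qed

lemma ideal_power_0: "ideal_power R J 0 = carrier R"
  and ideal_power_Suc: "ideal_power R J (Suc m) = J \<cdot> ideal_power R J m"
  by (simp_all add: ideal_power_def)

lemma ideal_power_ideal: "ideal J R \<Longrightarrow> ideal (ideal_power R J m) R"
  by (induction m) (auto simp: ideal_power_0 ideal_power_Suc oneideal ideal_prod_is_ideal)

text \<open>Powers are built up from the left, whereas splitting off the first traversed arrow of a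
  path needs the extra factor on the right.\<close>

lemma ideal_power_Suc2:
  assumes "ideal J R"
  shows "ideal_power R J (Suc m) = ideal_power R J m \<cdot> J"
proof (induction m)
  case 0
  show ?case using assms by (simp add: ideal_power_0 ideal_power_Suc ideal_prod_one ideal_prod_one_left)
next
  case (Suc m)
  have "ideal_power R J (Suc (Suc m)) = J \<cdot> (ideal_power R J m \<cdot> J)"
    using Suc by (simp add: ideal_power_Suc)
  also have "\<dots> = (J \<cdot> ideal_power R J m) \<cdot> J"
    using assms ideal_power_ideal by (intro ideal_prod_assoc[symmetric])
  finally show ?case by (simp add: ideal_power_Suc)
qed

lemma ideal_power_mono: "ideal J R \<Longrightarrow> ideal_power R J (Suc m) \<subseteq> ideal_power R J m"
  using ideal_prod_inter[OF _ ideal_power_ideal] by (auto simp: ideal_power_Suc)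

lemma coset_eq_iff:
  assumes "ideal I R" "a \<in> carrier R" "b \<in> carrier R"
  shows "I +> a = I +> b \<longleftrightarrow> a \<ominus> b \<in> I"
proof -
  interpret I: ideal I R by fact
  have "a \<in> I +> b \<longleftrightarrow> a \<ominus> b \<in> I"
    using assms(2,3) by (intro I.a_rcos_module_minus ring_axioms)
  then show ?thesis
    using I.a_repr_independence'[of a b] I.a_rcos_self[OF assms(2)] assms(3) by auto
qed

lemma coset_subset_iff:
  assumes I: "ideal I R" and J: "ideal J R" "I \<subseteq> J" and ab: "a \<in> carrier R" "b \<in> carrier R"
  shows "I +> a \<subseteq> J +> b \<longleftrightarrow> J +> a = J +> b"
proof -
  interpret I: ideal I R by fact
  interpret J: ideal J R by fact
  have "I +> a \<subseteq> J +> a" using J(2) by (auto simp: a_r_coset_def r_coset_def)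
  moreover have "J +> a = J +> b" if "I +> a \<subseteq> J +> b"
    using that I.a_rcos_self[OF ab(1)] J.a_repr_independence'[of a b] ab by auto
  ultimately show ?thesis by blast
qed

lemma quotient_carrier: "carrier (R Quot I) = (\<lambda>a. I +> a) ` carrier R"
  by (auto simp: FactRing_simps)

lemma quotient_ops:
  assumes "ideal I R" "a \<in> carrier R" "b \<in> carrier R"
  shows "(I +> a) \<otimes>\<^bsub>R Quot I\<^esub> (I +> b) = I +> (a \<otimes> b)"
    and "(I +> a) \<oplus>\<^bsub>R Quot I\<^esub> (I +> b) = I +> (a \<oplus> b)"
    and "\<ominus>\<^bsub>R Quot I\<^esub> (I +> a) = I +> (\<ominus> a)"
proof -
  interpret I: ideal I R by fact
  interpret h: ring_hom_ring R "R Quot I" "(+>) I" by (rule I.rcos_ring_hom_ring)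
  show "(I +> a) \<otimes>\<^bsub>R Quot I\<^esub> (I +> b) = I +> (a \<otimes> b)"
    "(I +> a) \<oplus>\<^bsub>R Quot I\<^esub> (I +> b) = I +> (a \<oplus> b)"
    "\<ominus>\<^bsub>R Quot I\<^esub> (I +> a) = I +> (\<ominus> a)"
    using assms by simp_all
qed

end

locale adic_ring = ring R + J: ideal J R for R (structure) and J
begin

abbreviation power :: "nat \<Rightarrow> 'a set" where "power m \<equiv> ideal_power R J m"
abbreviation completion :: "(nat \<Rightarrow> 'a set) ring" where "completion \<equiv> adic_completion R J"

lemma power_ideal: "ideal (power m) R"
  by (rule ideal_power_ideal[OF J.ideal_axioms])

lemma quotient_ring: "ring (R Quot power m)"
  by (rule ideal.quotient_is_ring[OF power_ideal])

lemma completion_simps: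
  "\<one>\<^bsub>completion\<^esub> m = power m +> \<one>"
  "\<zero>\<^bsub>completion\<^esub> m = \<zero>\<^bsub>R Quot power m\<^esub>"
  "(x \<oplus>\<^bsub>completion\<^esub> y) m = x m \<oplus>\<^bsub>R Quot power m\<^esub> y m"
  "(x \<otimes>\<^bsub>completion\<^esub> y) m = x m \<otimes>\<^bsub>R Quot power m\<^esub> y m"
  by (simp_all add: adic_completion_def FactRing_def)

lemma zero_coset: "\<zero>\<^bsub>R Quot power m\<^esub> = power m +> \<zero>"
proof -
  interpret I: ideal "power m" R by (rule power_ideal)
  show ?thesis using I.a_rcos_const[of \<zero>] by (simp add: FactRing_def)
qed

text \<open>Cosets at consecutive levels are nested exactly when one element represents both.
  Closure under the operations becomes a computation with such common representatives.\<close>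

lemma completion_carrier_iff:
  "x \<in> carrier completion \<longleftrightarrow>
    (\<forall>m. \<exists>a\<in>carrier R. x m = power m +> a \<and> x (Suc m) = power (Suc m) +> a)"
proof
  assume x: "x \<in> carrier completion"
  show "\<forall>m. \<exists>a\<in>carrier R. x m = power m +> a \<and> x (Suc m) = power (Suc m) +> a"
  proof
    fix m
    obtain a b where ab: "a \<in> carrier R" "x (Suc m) = power (Suc m) +> a" "b \<in> carrier R" "x m = power m +> b"
      using x by (auto simp: adic_completion_def quotient_carrier) (metis imageE)
    moreover have "x (Suc m) \<subseteq> x m" using x by (simp add: adic_completion_def)
    ultimately have "power m +> a = power m +> b"
      using coset_subset_iff[OF power_ideal power_ideal ideal_power_mono[OF J.ideal_axioms]] by simp
    then show "\<exists>a\<in>carrier R. x m = power m +> a \<and> x (Suc m) = power (Suc m) +> a" using ab by auto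
  qed
next
  assume *: "\<forall>m. \<exists>a\<in>carrier R. x m = power m +> a \<and> x (Suc m) = power (Suc m) +> a"
  have "x m \<in> carrier (R Quot power m) \<and> x (Suc m) \<subseteq> x m" for m
  proof -
    obtain a where a: "a \<in> carrier R" "x m = power m +> a" "x (Suc m) = power (Suc m) +> a"
      using * by blast
    then show ?thesis
      using coset_subset_iff[OF power_ideal power_ideal ideal_power_mono[OF J.ideal_axioms] a(1) a(1)]
      by (auto simp: quotient_carrier)
  qed
  then show "x \<in> carrier completion" by (simp add: adic_completion_def)
qed

lemma completion_level: "x \<in> carrier completion \<Longrightarrow> x m \<in> carrier (R Quot power m)"
  by (simp add: adic_completion_def)

lemma completion_closed:
  assumes "x \<in> carrier completion" "y \<in> carrier completion"
  shows "x \<oplus>\<^bsub>completion\<^esub> y \<in> carrier completion" "x \<otimes>\<^bsub>completion\<^esub> y \<in> carrier completion"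
    "(\<lambda>m. \<ominus>\<^bsub>R Quot power m\<^esub> x m) \<in> carrier completion"
proof -
  have "\<exists>c\<in>carrier R. (x \<oplus>\<^bsub>completion\<^esub> y) m = power m +> c \<and> (x \<oplus>\<^bsub>completion\<^esub> y) (Suc m) = power (Suc m) +> c"
    "\<exists>c\<in>carrier R. (x \<otimes>\<^bsub>completion\<^esub> y) m = power m +> c \<and> (x \<otimes>\<^bsub>completion\<^esub> y) (Suc m) = power (Suc m) +> c"
    "\<exists>c\<in>carrier R. \<ominus>\<^bsub>R Quot power m\<^esub> x m = power m +> c \<and> \<ominus>\<^bsub>R Quot power (Suc m)\<^esub> x (Suc m) = power (Suc m) +> c" for m
  proof -
    obtain a b where "a \<in> carrier R" "x m = power m +> a" "x (Suc m) = power (Suc m) +> a"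
      "b \<in> carrier R" "y m = power m +> b" "y (Suc m) = power (Suc m) +> b"
      using assms by (meson completion_carrier_iff)
    then show
      "\<exists>c\<in>carrier R. (x \<oplus>\<^bsub>completion\<^esub> y) m = power m +> c \<and> (x \<oplus>\<^bsub>completion\<^esub> y) (Suc m) = power (Suc m) +> c"
      "\<exists>c\<in>carrier R. (x \<otimes>\<^bsub>completion\<^esub> y) m = power m +> c \<and> (x \<otimes>\<^bsub>completion\<^esub> y) (Suc m) = power (Suc m) +> c"
      "\<exists>c\<in>carrier R. \<ominus>\<^bsub>R Quot power m\<^esub> x m = power m +> c \<and> \<ominus>\<^bsub>R Quot power (Suc m)\<^esub> x (Suc m) = power (Suc m) +> c"
      using quotient_ops[OF power_ideal] by (auto simp: completion_simps)
  qed
  then show "x \<oplus>\<^bsub>completion\<^esub> y \<in> carrier completion" "x \<otimes>\<^bsub>completion\<^esub> y \<in> carrier completion"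
    "(\<lambda>m. \<ominus>\<^bsub>R Quot power m\<^esub> x m) \<in> carrier completion"
    by (simp_all add: completion_carrier_iff)
qed

lemma completion_ring: "ring completion"
proof -
  have one: "\<one>\<^bsub>completion\<^esub> \<in> carrier completion" and zero: "\<zero>\<^bsub>completion\<^esub> \<in> carrier completion"
    by (auto simp: completion_carrier_iff completion_simps zero_coset)
  have one_level: "\<one>\<^bsub>completion\<^esub> m = \<one>\<^bsub>R Quot power m\<^esub>" for m by (simp add: completion_simps FactRing_def)
  note simps = completion_simps(2-) one_level completion_level ring.ring_simprules[OF quotient_ring]
      monoid.r_one[OF ring.is_monoid[OF quotient_ring]]
  show ?thesis
  proof (rule ringI)
    show "abelian_group completion"
    proof (rule abelian_groupI)
      fix x assume x: "x \<in> carrier completion"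
      show "\<exists>y\<in>carrier completion. y \<oplus>\<^bsub>completion\<^esub> x = \<zero>\<^bsub>completion\<^esub>"
      proof (rule bexI)
        show "(\<lambda>m. \<ominus>\<^bsub>R Quot power m\<^esub> x m) \<oplus>\<^bsub>completion\<^esub> x = \<zero>\<^bsub>completion\<^esub>"
        using x by (intro ext) (simp add: simps)
      qed (rule completion_closed(3)[OF x x])
    next
      fix x y z assume xyz: "x \<in> carrier completion" "y \<in> carrier completion" "z \<in> carrier completion"
      show "x \<oplus>\<^bsub>completion\<^esub> y \<oplus>\<^bsub>completion\<^esub> z = x \<oplus>\<^bsub>completion\<^esub> (y \<oplus>\<^bsub>completion\<^esub> z)"
        using xyz by (intro ext) (simp add: simps)
    next
      fix x y assume xy: "x \<in> carrier completion" "y \<in> carrier completion"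
      show "x \<oplus>\<^bsub>completion\<^esub> y = y \<oplus>\<^bsub>completion\<^esub> x"
        using xy by (intro ext) (simp add: simps)
    next
      fix x assume x: "x \<in> carrier completion"
      show "\<zero>\<^bsub>completion\<^esub> \<oplus>\<^bsub>completion\<^esub> x = x"
        using x by (intro ext) (simp add: simps)
    qed (auto simp: completion_closed zero)
    show "Group.monoid completion"
    proof (rule monoidI)
      fix x y z assume xyz: "x \<in> carrier completion" "y \<in> carrier completion" "z \<in> carrier completion"
      show "x \<otimes>\<^bsub>completion\<^esub> y \<otimes>\<^bsub>completion\<^esub> z = x \<otimes>\<^bsub>completion\<^esub> (y \<otimes>\<^bsub>completion\<^esub> z)"
        using xyz by (intro ext) (simp add: simps)
    next
      fix x assume x: "x \<in> carrier completion"
      show "\<one>\<^bsub>completion\<^esub> \<otimes>\<^bsub>completion\<^esub> x = x"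
        using x by (intro ext) (simp add: simps)
    next
      fix x assume x: "x \<in> carrier completion"
      show "x \<otimes>\<^bsub>completion\<^esub> \<one>\<^bsub>completion\<^esub> = x"
        using x by (intro ext) (simp add: simps)
    qed (auto simp: completion_closed one)
  next
      fix x y z assume xyz: "x \<in> carrier completion" "y \<in> carrier completion" "z \<in> carrier completion"
      show "(x \<oplus>\<^bsub>completion\<^esub> y) \<otimes>\<^bsub>completion\<^esub> z = x \<otimes>\<^bsub>completion\<^esub> z \<oplus>\<^bsub>completion\<^esub> y \<otimes>\<^bsub>completion\<^esub> z"
        using xyz by (intro ext) (simp add: simps)
      show "z \<otimes>\<^bsub>completion\<^esub> (x \<oplus>\<^bsub>completion\<^esub> y) = z \<otimes>\<^bsub>completion\<^esub> x \<oplus>\<^bsub>completion\<^esub> z \<otimes>\<^bsub>completion\<^esub> y"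
        using xyz by (intro ext) (simp add: simps)
  qed
qed

end

section \<open>Ideals of the complete preprojective algebra\<close>

context preprojective_quiver begin

abbreviation PP where "PP \<equiv> preprojective k Q"
abbreviation J where "J \<equiv> arrow_ideal k Q"
abbreviation L where "L \<equiv> complete_preprojective k Q"
abbreviation to_Pi where "to_Pi \<equiv> to_preprojective k Q"
abbreviation to_L where "to_L \<equiv> to_complete_preprojective k Q"

lemma to_Pi_eq: "to_Pi = (+>\<^bsub>A\<^esub>) P"
  by (rule ext) (simp add: to_preprojective_def)

lemma to_Pi_hom: "ring_hom_ring A PP to_Pi"
  unfolding to_Pi_eq preprojective_def by (rule ideal.rcos_ring_hom_ring[OF ideal_P])

sublocale PP: ring PP
  using to_Pi_hom by (simp add: ring_hom_ring_def)

lemma to_Pi_closed: "f \<in> carrier A \<Longrightarrow> to_Pi f \<in> carrier PP"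
proof -
  interpret h: ring_hom_ring A PP to_Pi by (rule to_Pi_hom)
  show "f \<in> carrier A \<Longrightarrow> to_Pi f \<in> carrier PP" by (rule h.hom_closed)
qed

lemma arrow_ideal_gens: "(\<lambda>b. to_Pi (of_arrow D b)) ` arcs D \<subseteq> carrier PP"
  using to_Pi_closed D.of_arrow_closed by blast

sublocale PP: adic_ring PP J
  unfolding arrow_ideal_def
  by (intro adic_ring.intro PP.ring_axioms PP.genideal_ideal arrow_ideal_gens)

sublocale L: ring L
  unfolding complete_preprojective_def by (rule PP.completion_ring)

lemma to_Pi_simps:
  assumes "f \<in> carrier A" "g \<in> carrier A"
  shows "to_Pi (path_mult D f g) = to_Pi f \<otimes>\<^bsub>PP\<^esub> to_Pi g"
    "to_Pi (f + g) = to_Pi f \<oplus>\<^bsub>PP\<^esub> to_Pi g" "to_Pi (f - g) = to_Pi f \<ominus>\<^bsub>PP\<^esub> to_Pi g"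
proof -
  interpret h: ring_hom_ring A PP to_Pi by (rule to_Pi_hom)
  show "to_Pi (path_mult D f g) = to_Pi f \<otimes>\<^bsub>PP\<^esub> to_Pi g"
    "to_Pi (f + g) = to_Pi f \<oplus>\<^bsub>PP\<^esub> to_Pi g"
    using assms h.hom_mult[OF assms] h.hom_add[OF assms] by (simp_all add: path_algebra_simps(2,3))
  show "to_Pi (f - g) = to_Pi f \<ominus>\<^bsub>PP\<^esub> to_Pi g"
    using assms by (simp add: a_minus_def flip: D.path_algebra_minus)
qed

lemma to_Pi_surj: "x \<in> carrier PP \<longleftrightarrow> (\<exists>f\<in>carrier A. x = to_Pi f)"
  by (auto simp: preprojective_def A.quotient_carrier to_Pi_eq)

lemma to_Pi_eq_iff: "f \<in> carrier A \<Longrightarrow> g \<in> carrier A \<Longrightarrow> to_Pi f = to_Pi g \<longleftrightarrow> f - g \<in> P"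
  unfolding to_Pi_eq by (simp add: A.coset_eq_iff[OF ideal_P] D.path_algebra_minus)

lemma to_Pi_vimage:
  assumes I: "ideal I PP"
  shows "right_ideal {f \<in> carrier A. to_Pi f \<in> I}"
proof -
  interpret I: ideal I PP by (rule I)
  interpret h: ring_hom_ring A PP to_Pi by (rule to_Pi_hom)
  have "to_Pi p \<in> I" if "p \<in> P" for p
  proof -
    have "to_Pi p = to_Pi \<zero>\<^bsub>A\<^esub>"
      using that ideal.Icarr[OF ideal_P] by (subst to_Pi_eq_iff) (auto simp: path_algebra_simps(4) D.zero_closed)
    then show ?thesis by simp
  qed
  then show ?thesis
    using ideal.Icarr[OF ideal_P]
    by (auto simp: right_ideal_def to_Pi_simps D.path_algebra_add_closed D.path_mult_closed I.I_r_closed)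
qed

section \<open>The filtration by path length\<close>

definition long_paths :: "nat \<Rightarrow> (('v, 'a + 'a) path \<Rightarrow> 'k) set" where
  "long_paths m = {f \<in> carrier A. \<forall>i p. length p < m \<longrightarrow> f (i, p) = 0}"

text \<open>Long paths plus relations; by \<open>to_Pi_power_iff\<close> this is the preimage of a
  power of the arrow ideal.\<close>

definition filtration :: "nat \<Rightarrow> (('v, 'a + 'a) path \<Rightarrow> 'k) set" where
  "filtration m = {f \<in> carrier A. \<exists>g\<in>long_paths m. f - g \<in> P}"

lemma long_paths_carrier: "f \<in> long_paths m \<Longrightarrow> f \<in> carrier A"
  by (simp add: long_paths_def)

lemma long_paths_mult:
  assumes "f \<in> long_paths a" "g \<in> long_paths b"
  shows "path_mult D f g \<in> long_paths (a + b)"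
proof -
  have "(\<Sum>n\<le>length p. f (pre_digraph.awlast D i (take n p), drop n p) * g (i, take n p)) = 0"
    if "length p < a + b" for i p
  proof (rule sum.neutral, rule ballI)
    fix n assume "n \<in> {..length p}"
    then have "length (drop n p) < a \<or> length (take n p) < b" using that by auto
    then show "f (pre_digraph.awlast D i (take n p), drop n p) * g (i, take n p) = 0"
      using assms by (auto simp: long_paths_def)
  qed
  then show ?thesis using assms by (auto simp: long_paths_def path_mult_def[of D f g] D.path_mult_closed[unfolded path_mult_def])
qed

lemma long_paths_add: "f \<in> long_paths m \<Longrightarrow> g \<in> long_paths m \<Longrightarrow> f + g \<in> long_paths m"
  by (auto simp: long_paths_def D.path_algebra_add_closed)

lemma long_paths_0: "long_paths 0 = carrier A"
  by (auto simp: long_paths_def)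

lemma long_paths_mono: "m \<le> n \<Longrightarrow> long_paths n \<subseteq> long_paths m"
  by (auto simp: long_paths_def)

lemma long_paths_zero: "0 \<in> long_paths m"
  by (simp add: long_paths_def D.zero_closed)

lemma long_paths_unshift: "f \<in> long_paths (Suc m) \<Longrightarrow> unshift D c f \<in> long_paths m"
  by (auto simp: long_paths_def unshift_def[of D c f] D.unshift_closed[unfolded unshift_def])

lemma long_paths_filtration: "f \<in> long_paths m \<Longrightarrow> f \<in> filtration m"
  using right_ideal_zero[OF right_ideal_P] by (auto simp: filtration_def long_paths_carrier intro!: bexI[of _ f])

lemma P_filtration: "P \<subseteq> filtration m"
  using ideal.Icarr[OF ideal_P] long_paths_zero by (auto simp: filtration_def intro!: bexI[of _ 0])

lemma filtration_carrier: "f \<in> filtration m \<Longrightarrow> f \<in> carrier A"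
  by (simp add: filtration_def)

lemma filtration_add:
  assumes "f \<in> filtration m" "g \<in> filtration m"
  shows "f + g \<in> filtration m"
proof -
  obtain f' g' where *: "f' \<in> long_paths m" "f - f' \<in> P" "g' \<in> long_paths m" "g - g' \<in> P"
    using assms by (auto simp: filtration_def)
  have "(f + g) - (f' + g') = (f - f') + (g - g')" by simp
  then have "(f + g) - (f' + g') \<in> P" using * right_ideal_add[OF right_ideal_P] by metis
  then show ?thesis
    using assms * long_paths_add D.path_algebra_add_closed by (auto simp: filtration_def)
qed

lemma filtration_mult:
  assumes "f \<in> filtration a" "g \<in> filtration b"
  shows "path_mult D f g \<in> filtration (a + b)"
proof -
  interpret P: ideal P A by (rule ideal_P)
  obtain f' g' where *: "f' \<in> long_paths a" "f - f' \<in> P" "g' \<in> long_paths b" "g - g' \<in> P"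
    using assms by (auto simp: filtration_def)
  have "path_mult D f g - path_mult D f' g' = path_mult D (f - f') g + path_mult D f' (g - g')"
    using path_mult_add_left[of D "f - f'" f' g] path_mult_add_right[of D f' "g - g'" g'] by simp
  moreover have "path_mult D (f - f') g \<in> P"
    using P.I_r_closed[OF *(2)] assms by (simp add: path_algebra_simps(2) filtration_carrier)
  moreover have "path_mult D f' (g - g') \<in> P"
    using P.I_l_closed[OF *(4)] * by (simp add: path_algebra_simps(2) long_paths_carrier)
  ultimately have "path_mult D f g - path_mult D f' g' \<in> P"
    using right_ideal_add[OF right_ideal_P] by metis
  then show ?thesis
    using assms * long_paths_mult by (auto simp: filtration_def D.path_mult_closed)
qed

lemma filtration_0: "filtration 0 = carrier A"
  using long_paths_filtration by (auto simp: filtration_carrier long_paths_0)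

lemma filtration_ideal: "ideal (filtration m) A"
proof (rule A.idealI_closed)
  show "\<zero>\<^bsub>A\<^esub> \<in> filtration m"
    unfolding path_algebra_simps(4) by (rule long_paths_filtration[OF long_paths_zero])
  fix f g assume "f \<in> filtration m" "g \<in> carrier A"
  then show "g \<otimes>\<^bsub>A\<^esub> f \<in> filtration m" "f \<otimes>\<^bsub>A\<^esub> g \<in> filtration m"
    using filtration_mult[of g 0 f m] filtration_mult[of f m g 0] by (simp_all add: path_algebra_simps(2) filtration_0)
qed (auto simp: path_algebra_simps(3) filtration_add filtration_carrier)

text \<open>The filtration is multiplicative, and the arrow ideal lies in the image of its first
  step because the arrows do.\<close>

lemma to_Pi_power_filtration:
  assumes "x \<in> PP.power m"
  shows "\<exists>f\<in>filtration m. x = to_Pi f"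
proof -
  have ideal1: "ideal (to_Pi ` filtration 1) PP"
    unfolding to_Pi_eq preprojective_def
    by (rule A.ring_ideal_imp_quot_ideal[OF ideal_P filtration_ideal])
  have "of_arrow D c \<in> filtration 1" if "c \<in> arcs D" for c
    using that by (intro long_paths_filtration)
      (auto simp: long_paths_def D.of_arrow_closed, simp add: of_arrow_def of_path_def)
  then have J1: "J \<subseteq> to_Pi ` filtration 1"
    unfolding arrow_ideal_def by (intro PP.genideal_minimal[OF ideal1]) auto
  show ?thesis using assms
  proof (induction m arbitrary: x)
    case 0
    then show ?case by (simp add: PP.ideal_power_0 to_Pi_surj filtration_0)
  next
    case (Suc m)
    then have "x \<in> J \<cdot>\<^bsub>PP\<^esub> PP.power m" by (simp add: PP.ideal_power_Suc)
    then show ?case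
    proof (induction x rule: ideal_prod.induct)
      case (prod i j)
      obtain a b where "a \<in> filtration 1" "i = to_Pi a" "b \<in> filtration m" "j = to_Pi b"
        using prod J1 Suc.IH by blast
      then show ?case
        using filtration_mult[of a 1 b m] by (intro bexI[of _ "path_mult D a b"]) (auto simp: to_Pi_simps filtration_carrier)
    next
      case (sum s1 s2)
      then obtain f g where fg: "f \<in> filtration (Suc m)" "s1 = to_Pi f" "g \<in> filtration (Suc m)" "s2 = to_Pi g" by blast
      then have "s1 \<oplus>\<^bsub>PP\<^esub> s2 = to_Pi (f + g)" by (simp only: to_Pi_simps filtration_carrier)
      then show ?case using filtration_add[OF fg(1,3)] by blast
    qed
  qed
qed

text \<open>Removing the first arrow shortens every path by one, which leaves a power of the arrow
  ideal times an arrow on the right.\<close>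

lemma long_paths_to_Pi_power: "f \<in> long_paths m \<Longrightarrow> to_Pi f \<in> PP.power m"
proof (induction m arbitrary: f)
  case 0
  then show ?case by (simp add: PP.ideal_power_0 to_Pi_closed long_paths_carrier)
next
  case (Suc m)
  have I: "ideal (PP.power m \<cdot>\<^bsub>PP\<^esub> J) PP"
    by (rule PP.ideal_prod_is_ideal[OF PP.power_ideal PP.J.ideal_axioms])
  let ?X = "{f \<in> carrier A. to_Pi f \<in> PP.power m \<cdot>\<^bsub>PP\<^esub> J}"
  have fA: "f \<in> carrier A" using Suc.prems by (rule long_paths_carrier)
  have "shift D c (unshift D c f) \<in> ?X" if c: "c \<in> arcs D" for c
  proof -
    have u: "unshift D c f \<in> long_paths m" using Suc.prems by (rule long_paths_unshift)
    have "to_Pi (of_arrow D c) \<in> J"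
      unfolding arrow_ideal_def using PP.genideal_self[OF arrow_ideal_gens] c by blast
    then have "to_Pi (unshift D c f) \<otimes>\<^bsub>PP\<^esub> to_Pi (of_arrow D c) \<in> PP.power m \<cdot>\<^bsub>PP\<^esub> J"
      using Suc.IH[OF u] by (intro ideal_prod.prod)
    then have "to_Pi (path_mult D (unshift D c f) (of_arrow D c)) \<in> PP.power m \<cdot>\<^bsub>PP\<^esub> J"
      using u c by (simp add: to_Pi_simps(1) long_paths_carrier D.of_arrow_closed)
    then show ?thesis using u c by (simp add: mult_of_arrow D.shift_closed long_paths_carrier)
  qed
  then have "(\<Sum>c\<in>arcs D. shift D c (unshift D c f)) \<in> ?X" by (rule right_ideal_sum[OF to_Pi_vimage[OF I]])
  moreover have "f (r, []) = 0" for r using Suc.prems by (simp add: long_paths_def)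
  ultimately have "f \<in> ?X" using sum_shift_unshift[OF fA] by simp
  then show ?case using PP.ideal_power_Suc2[OF PP.J.ideal_axioms] by simp
qed

lemma to_Pi_power_iff:
  assumes "f \<in> carrier A"
  shows "to_Pi f \<in> PP.power m \<longleftrightarrow> f \<in> filtration m"
proof
  assume "to_Pi f \<in> PP.power m"
  then obtain g where g: "g \<in> filtration m" "to_Pi f = to_Pi g" using to_Pi_power_filtration by blast
  then have "f - g \<in> P" using assms to_Pi_eq_iff filtration_carrier by blast
  then have "(f - g) + g \<in> filtration m" using g P_filtration by (intro filtration_add) auto
  then show "f \<in> filtration m" by simp
next
  assume "f \<in> filtration m"
  then obtain g where "g \<in> long_paths m" "f - g \<in> P" by (auto simp: filtration_def)
  then show "to_Pi f \<in> PP.power m"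
    using long_paths_to_Pi_power[of g m] to_Pi_eq_iff[OF assms long_paths_carrier] by metis
qed

section \<open>Elements of the completion\<close>

lemma to_L_eq: "to_L f m = PP.power m +>\<^bsub>PP\<^esub> to_Pi f"
  by (simp add: to_complete_preprojective_def)

lemma to_L_eq_iff:
  "f \<in> carrier A \<Longrightarrow> g \<in> carrier A \<Longrightarrow> to_L f m = to_L g m \<longleftrightarrow> f - g \<in> filtration m"
  using right_ideal_minus[OF right_ideal_carrier, of f g]
  by (simp add: to_L_eq PP.coset_eq_iff[OF PP.power_ideal] to_Pi_closed to_Pi_power_iff flip: to_Pi_simps(3))

lemma L_carrier_iff:
  "x \<in> carrier L \<longleftrightarrow> (\<forall>m. \<exists>f\<in>carrier A. x m = to_L f m \<and> x (Suc m) = to_L f (Suc m))"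
  unfolding complete_preprojective_def PP.completion_carrier_iff to_L_eq
  by (metis to_Pi_surj)

lemma L_ops:
  assumes "f \<in> carrier A" "g \<in> carrier A" "x m = to_L f m" "y m = to_L g m"
  shows "(x \<oplus>\<^bsub>L\<^esub> y) m = to_L (f + g) m" "(x \<otimes>\<^bsub>L\<^esub> y) m = to_L (path_mult D f g) m"
  using assms
  by (simp_all add: complete_preprojective_def PP.completion_simps to_L_eq PP.quotient_ops[OF PP.power_ideal] to_Pi_simps to_Pi_closed)

lemma to_L_closed: "f \<in> carrier A \<Longrightarrow> to_L f \<in> carrier L"
  by (auto simp: L_carrier_iff)

lemma to_L_hom: "ring_hom_ring A L to_L"
proof (rule ring_hom_ringI2[OF A.ring_axioms L.ring_axioms], rule ring_hom_memI)
  interpret h: ring_hom_ring A PP to_Pi by (rule to_Pi_hom)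
  show "to_L \<one>\<^bsub>A\<^esub> = \<one>\<^bsub>L\<^esub>"
    by (rule ext) (simp add: complete_preprojective_def PP.completion_simps to_L_eq)
qed (auto simp: fun_eq_iff L_ops path_algebra_simps(2,3) to_L_closed)

end

section \<open>Word ideals of the completion compared with right ideals of the path algebra\<close>

context preprojective_quiver begin

abbreviation V :: "'v \<Rightarrow> ('k, 'v, 'a) cpp set" where "V i \<equiv> vertex_ideal k Q i"
abbreviation WI :: "'v list \<Rightarrow> ('k, 'v, 'a) cpp set" where "WI x \<equiv> word_ideal k Q x"

lemma one_coeff: "t \<in> verts Q \<Longrightarrow> \<one>\<^bsub>A\<^esub> (t, []) = 1"
  by (simp add: path_algebra_simps(5))

lemma trivial_path_closed: "t \<in> verts Q \<Longrightarrow> of_path (t, []) \<in> carrier A"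
  by (rule D.of_path_closed) (simp add: D.paths_Nil)

lemma vertex_ideal_eq:
  assumes "t \<in> verts Q"
  shows "V t = Idl\<^bsub>L\<^esub> {to_L (\<one>\<^bsub>A\<^esub> - of_path (t, []))}"
proof -
  interpret h: ring_hom_ring A L to_L by (rule to_L_hom)
  have "to_L (\<one>\<^bsub>A\<^esub> - of_path (t, [])) = \<one>\<^bsub>L\<^esub> \<ominus>\<^bsub>L\<^esub> idempotent k Q t"
    unfolding D.path_algebra_minus[OF D.one_closed trivial_path_closed[OF assms], symmetric]
    using trivial_path_closed[OF assms] by (simp add: a_minus_def idempotent_def)
  then show ?thesis by (simp add: vertex_ideal_def Let_def)
qed

lemma complement_closed: "t \<in> verts Q \<Longrightarrow> \<one>\<^bsub>A\<^esub> - of_path (t, []) \<in> carrier A"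
  using right_ideal_minus[OF right_ideal_carrier D.one_closed trivial_path_closed] .

lemma vertex_ideal_ideal:
  assumes "t \<in> verts Q"
  shows "ideal (V t) L"
  unfolding vertex_ideal_eq[OF assms]
  using to_L_closed[OF complement_closed[OF assms]] by (intro L.genideal_ideal) simp

lemma word_ideal_Nil: "WI [] = carrier L"
  and word_ideal_snoc: "WI (x @ [i]) = V i \<cdot>\<^bsub>L\<^esub> WI x"
  by (simp_all add: word_ideal_def Let_def)

lemma word_ideal_ideal: "set x \<subseteq> verts Q \<Longrightarrow> ideal (WI x) L"
proof (induction x rule: rev_induct)
  case Nil
  then show ?case by (simp add: word_ideal_Nil L.oneideal)
next
  case (snoc i x)
  then show ?case by (simp add: word_ideal_snoc L.ideal_prod_is_ideal vertex_ideal_ideal)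
qed

lemma word_ideal_Cons: "t \<in> verts Q \<Longrightarrow> set x \<subseteq> verts Q \<Longrightarrow> WI (t # x) = WI x \<cdot>\<^bsub>L\<^esub> V t"
proof (induction x rule: rev_induct)
  case Nil
  have "WI [t] = V t \<cdot>\<^bsub>L\<^esub> WI []" using word_ideal_snoc[of "[]" t] by simp
  then show ?case
    using Nil vertex_ideal_ideal by (simp add: word_ideal_Nil L.ideal_prod_one L.ideal_prod_one_left)
next
  case (snoc i x)
  have "WI (t # x @ [i]) = V i \<cdot>\<^bsub>L\<^esub> WI (t # x)" using word_ideal_snoc[of "t # x" i] by simp
  also have "\<dots> = V i \<cdot>\<^bsub>L\<^esub> (WI x \<cdot>\<^bsub>L\<^esub> V t)" using snoc by simp
  also have "\<dots> = (V i \<cdot>\<^bsub>L\<^esub> WI x) \<cdot>\<^bsub>L\<^esub> V t"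
    using snoc.prems by (intro L.ideal_prod_assoc[symmetric] vertex_ideal_ideal word_ideal_ideal) auto
  finally show ?case by (simp add: word_ideal_snoc)
qed

lemma to_L_mult: "f \<in> carrier A \<Longrightarrow> g \<in> carrier A \<Longrightarrow> to_L (path_mult D f g) = to_L f \<otimes>\<^bsub>L\<^esub> to_L g"
  and to_L_add: "f \<in> carrier A \<Longrightarrow> g \<in> carrier A \<Longrightarrow> to_L (f + g) = to_L f \<oplus>\<^bsub>L\<^esub> to_L g"
proof -
  interpret h: ring_hom_ring A L to_L by (rule to_L_hom)
  show "f \<in> carrier A \<Longrightarrow> g \<in> carrier A \<Longrightarrow> to_L (path_mult D f g) = to_L f \<otimes>\<^bsub>L\<^esub> to_L g"
    "f \<in> carrier A \<Longrightarrow> g \<in> carrier A \<Longrightarrow> to_L (f + g) = to_L f \<oplus>\<^bsub>L\<^esub> to_L g"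
    using h.hom_mult[of f g] h.hom_add[of f g] by (simp_all add: path_algebra_simps(2,3))
qed

lemma to_L_P: "p \<in> P \<Longrightarrow> to_L p = \<zero>\<^bsub>L\<^esub>"
proof -
  interpret h: ring_hom_ring A L to_L by (rule to_L_hom)
  assume p: "p \<in> P"
  have "to_L p m = to_L \<zero>\<^bsub>A\<^esub> m" for m
    using p P_filtration ideal.Icarr[OF ideal_P p]
    by (subst to_L_eq_iff) (auto simp: path_algebra_simps(4) D.zero_closed)
  then show "to_L p = \<zero>\<^bsub>L\<^esub>" using h.hom_zero by (auto simp: fun_eq_iff)
qed

lemma to_L_vimage:
  assumes I: "ideal I L"
  shows "right_ideal {f \<in> carrier A. to_L f \<in> I}"
proof -
  interpret I: ideal I L by (rule I)
  show ?thesis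
    using ideal.Icarr[OF ideal_P]
    by (auto simp: right_ideal_def to_L_P to_L_add to_L_mult D.path_algebra_add_closed D.path_mult_closed
        I.I_r_closed to_L_closed)
qed

lemma to_L_trivial_path:
  assumes "r \<in> verts Q" "t \<in> verts Q" "r \<noteq> t"
  shows "to_L (of_path (r, [])) \<in> V t"
proof -
  have "path_mult D (of_path (r, [])) (\<one>\<^bsub>A\<^esub> - of_path (t, [])) = (of_path (r, []) :: _ \<Rightarrow> 'k)"
  proof -
    have "path_mult D (of_path (r, [])) (\<one>\<^bsub>A\<^esub> - of_path (t, []))
        + path_mult D (of_path (r, [])) (of_path (t, [])) = (of_path (r, []) :: _ \<Rightarrow> 'k)"
      using assms(1) by (simp flip: path_mult_add_right add: D.path_mult_one trivial_path_closed)
    moreover have "path_mult D (of_path (r, [])) (of_path (t, [])) = (0 :: _ \<Rightarrow> 'k)"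
      unfolding mult_of_path_Nil using assms(3) by (auto simp: col_def of_path_def fun_eq_iff)
    ultimately show ?thesis by simp
  qed
  then have "to_L (of_path (r, [])) = to_L (of_path (r, [])) \<otimes>\<^bsub>L\<^esub> to_L (\<one>\<^bsub>A\<^esub> - of_path (t, []))"
    using assms by (simp add: trivial_path_closed complement_closed flip: to_L_mult)
  moreover have "to_L (\<one>\<^bsub>A\<^esub> - of_path (t, [])) \<in> V t"
    unfolding vertex_ideal_eq[OF assms(2)]
    by (rule L.genideal_self') (rule to_L_closed[OF complement_closed[OF assms(2)]])
  ultimately show ?thesis
    using ideal.I_l_closed[OF vertex_ideal_ideal[OF assms(2)]] to_L_closed[OF trivial_path_closed[OF assms(1)]]
    by metis
qed

text \<open>An arrow is no loop, so one of its ends differs from \<open>t\<close>, and the trivial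
  path at that end is a factor lying in \<open>V t\<close>.\<close>

lemma to_L_arrow:
  assumes c: "c \<in> arcs D" and t: "t \<in> verts Q"
  shows "to_L (of_arrow D c) \<in> V t"
proof (cases "tail D c = t")
  case True
  have "path_mult D (of_path (head D c, [])) (of_arrow D c) = (of_arrow D c :: _ \<Rightarrow> 'k)"
    unfolding mult_of_arrow by (auto simp: of_arrow_def of_path_def shift_def fun_eq_iff neq_Nil_conv)
  then have "to_L (of_arrow D c) = to_L (of_path (head D c, [])) \<otimes>\<^bsub>L\<^esub> to_L (of_arrow D c)"
    using c by (simp add: trivial_path_closed head_tail_in_verts D.of_arrow_closed flip: to_L_mult)
  moreover have "to_L (of_path (head D c, [])) \<in> V t"
    using True t head_tail_in_verts[OF c] head_neq_tail[OF c] by (intro to_L_trivial_path) auto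
  ultimately show ?thesis
    using ideal.I_r_closed[OF vertex_ideal_ideal[OF t]] to_L_closed[OF D.of_arrow_closed[OF c]] by metis
next
  case False
  have "path_mult D (of_arrow D c) (of_path (tail D c, [])) = (of_arrow D c :: _ \<Rightarrow> 'k)"
    unfolding mult_of_path_Nil of_arrow_def by (rule col_of_path)
  then have "to_L (of_arrow D c) = to_L (of_arrow D c) \<otimes>\<^bsub>L\<^esub> to_L (of_path (tail D c, []))"
    using c by (simp add: trivial_path_closed head_tail_in_verts D.of_arrow_closed flip: to_L_mult)
  moreover have "to_L (of_path (tail D c, [])) \<in> V t"
    using False t head_tail_in_verts[OF c] by (intro to_L_trivial_path) auto
  ultimately show ?thesis
    using ideal.I_l_closed[OF vertex_ideal_ideal[OF t]] to_L_closed[OF D.of_arrow_closed[OF c]] by metis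
qed

text \<open>A column other than \<open>t\<close> is a product with a trivial path in
  \<open>V t\<close>. The column at \<open>t\<close> is, up to relations, a sum of elements of
  \<open>W x\<close> times arrows, and all arrows lie in \<open>V t\<close>.\<close>

lemma to_L_word_ideal: "set x \<subseteq> verts Q \<Longrightarrow> f \<in> W x \<Longrightarrow> to_L f \<in> WI x"
proof (induction x arbitrary: f)
  case Nil
  then show ?case by (simp add: word_ideal_Nil to_L_closed)
next
  case (Cons t x)
  have t: "t \<in> verts Q" and x: "set x \<subseteq> verts Q" using Cons.prems by auto
  have eq: "WI (t # x) = WI x \<cdot>\<^bsub>L\<^esub> V t" by (rule word_ideal_Cons[OF t x])
  define X where "X = {f \<in> carrier A. to_L f \<in> WI (t # x)}"
  have X: "right_ideal X" unfolding X_def using Cons.prems by (intro to_L_vimage word_ideal_ideal)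
  have f: "f \<in> vmul (W x) t" using Cons.prems(2) by simp
  have fA: "f \<in> carrier A" using f by (simp add: vmul_def)
  have mult: "path_mult D g b \<in> X" if "g \<in> W x" "b \<in> carrier A" "to_L b \<in> V t" for g b
  proof -
    have "g \<in> carrier A" by (rule right_ideal_subset[OF W_right_ideal that(1)])
    moreover have "to_L g \<otimes>\<^bsub>L\<^esub> to_L b \<in> WI x \<cdot>\<^bsub>L\<^esub> V t"
      using Cons.IH[OF x that(1)] that(3) by (rule ideal_prod.prod)
    ultimately show ?thesis using that(2) by (simp add: X_def eq D.path_mult_closed to_L_mult)
  qed
  have "col r f \<in> X" if r: "r \<in> verts Q" for r
  proof (cases "r = t")
    case False
    then have "col r f \<in> W x" using f by (simp add: vmul_def)
    then have "path_mult D (col r f) (of_path (r, [])) \<in> X"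
      using r t False by (intro mult trivial_path_closed to_L_trivial_path) auto
    then show ?thesis by (simp add: mult_of_path_Nil col_col)
  next
    case True
    obtain h p where h: "h \<in> carrier A" "p \<in> P" "col t f = h + p" "\<And>r. h (r, []) = 0"
      "\<And>c. c \<in> arcs D \<Longrightarrow> unshift D c h \<in> W x"
      using vmul_decomp[OF W_right_ideal f] by blast
    have "shift D c (unshift D c h) \<in> X" if "c \<in> arcs D" for c
      using mult[OF h(5)[OF that] D.of_arrow_closed[OF that] to_L_arrow[OF that t]] by (simp add: mult_of_arrow)
    then have "(\<Sum>c\<in>arcs D. shift D c (unshift D c h)) \<in> X" by (rule right_ideal_sum[OF X])
    then have "h \<in> X" using sum_shift_unshift[OF h(1,4)] by simp
    then show ?thesis using h(2,3) True right_ideal_add[OF X] right_ideal_P_subset[OF X] by simp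
  qed
  then have "f \<in> X" by (rule right_ideal_colI[OF X fA])
  then show ?case by (simp add: X_def)
qed

lemma vmul_mult:
  assumes X: "right_ideal X" and f: "f \<in> X" and g: "g \<in> carrier A" "g (t, []) = 0"
  shows "path_mult D f g \<in> vmul X t"
proof -
  have fA: "f \<in> carrier A" by (rule right_ideal_subset[OF X f])
  have "unshift D c (path_mult D f g) \<in> X" if "tail D c = t" for c
    using that g right_ideal_mult[OF X f D.unshift_closed[OF g(1)], of c] by (simp add: unshift_mult)
  then have "vertex_part X t (path_mult D f g)"
    using g by (auto simp: vertex_part_def path_mult_Nil shift_linear D.zero_closed intro!: bexI[of _ 0])
  moreover have "col r (path_mult D f g) \<in> X" for r
    by (rule right_ideal_col[OF X right_ideal_mult[OF X f g(1)]])
  ultimately show ?thesis by (simp add: vmul_def D.path_mult_closed fA g(1))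
qed

text \<open>The constant term at \<open>t\<close> is multiplicative, so the elements with
  representatives free of it at every level form an ideal, and this ideal contains the generator of
  \<open>V t\<close>.\<close>

lemma vertex_ideal_level:
  assumes t: "t \<in> verts Q" and b: "b \<in> V t"
  shows "\<exists>g\<in>carrier A. g (t, []) = 0 \<and> b m = to_L g m"
proof -
  define S where "S = {b \<in> carrier L. \<forall>m. \<exists>g\<in>carrier A. g (t, []) = 0 \<and> b m = to_L g m}"
  have level: "\<exists>f\<in>carrier A. a m = to_L f m" if "a \<in> carrier L" for a m
    using that L_carrier_iff by blast
  have mult: "a \<otimes>\<^bsub>L\<^esub> b \<in> S \<and> b \<otimes>\<^bsub>L\<^esub> a \<in> S" if a: "a \<in> carrier L" and b: "b \<in> S" for a b
  proof -
    have "\<exists>g\<in>carrier A. g (t, []) = 0 \<and> (a \<otimes>\<^bsub>L\<^esub> b) m = to_L g m"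
      "\<exists>g\<in>carrier A. g (t, []) = 0 \<and> (b \<otimes>\<^bsub>L\<^esub> a) m = to_L g m" for m
    proof -
      have "\<exists>g\<in>carrier A. g (t, []) = 0 \<and> b m = to_L g m" using b by (simp add: S_def)
      then obtain f g where fg: "f \<in> carrier A" "a m = to_L f m" "g \<in> carrier A" "g (t, []) = 0" "b m = to_L g m"
        using level[OF a, of m] by blast
      show "\<exists>g\<in>carrier A. g (t, []) = 0 \<and> (a \<otimes>\<^bsub>L\<^esub> b) m = to_L g m"
        using fg by (intro bexI[of _ "path_mult D f g"]) (simp_all add: L_ops D.path_mult_closed path_mult_Nil)
      show "\<exists>g\<in>carrier A. g (t, []) = 0 \<and> (b \<otimes>\<^bsub>L\<^esub> a) m = to_L g m"
        using fg by (intro bexI[of _ "path_mult D g f"]) (simp_all add: L_ops D.path_mult_closed path_mult_Nil)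
    qed
    then show ?thesis using a b by (auto simp: S_def)
  qed
  interpret h: ring_hom_ring A L to_L by (rule to_L_hom)
  have "ideal S L"
  proof (rule L.idealI_closed)
    have "\<zero>\<^bsub>L\<^esub> = to_L 0" using h.hom_zero by (simp add: path_algebra_simps(4))
    then show "\<zero>\<^bsub>L\<^esub> \<in> S" by (auto simp: S_def to_L_closed D.zero_closed intro!: bexI[of _ 0])
  next
    fix a b assume a: "a \<in> S" and b: "b \<in> S"
    have "\<exists>g\<in>carrier A. g (t, []) = 0 \<and> (a \<oplus>\<^bsub>L\<^esub> b) m = to_L g m" for m
    proof -
      obtain f g where fg: "f \<in> carrier A" "f (t, []) = 0" "a m = to_L f m"
        "g \<in> carrier A" "g (t, []) = 0" "b m = to_L g m"
        using a b by (auto simp: S_def) metis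
      then show ?thesis by (intro bexI[of _ "f + g"]) (simp_all add: L_ops D.path_algebra_add_closed)
    qed
    then show "a \<oplus>\<^bsub>L\<^esub> b \<in> S" using a b by (auto simp: S_def)
  qed (use mult in \<open>auto simp: S_def\<close>)
  moreover have "to_L (\<one>\<^bsub>A\<^esub> - of_path (t, [])) \<in> S"
    using complement_closed[OF t] one_coeff[OF t]
    by (auto simp: S_def to_L_closed of_path_def intro!: bexI[of _ "\<one>\<^bsub>A\<^esub> - of_path (t, [])"])
  ultimately have "V t \<subseteq> S" unfolding vertex_ideal_eq[OF t] by (intro L.genideal_minimal) auto
  then show ?thesis using b by (auto simp: S_def)
qed

lemma word_ideal_level:
  "set x \<subseteq> verts Q \<Longrightarrow> a \<in> WI x \<Longrightarrow> \<exists>f\<in>W x. a m = to_L f m"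
proof (induction x arbitrary: a)
  case Nil
  then show ?case using L_carrier_iff by (simp add: word_ideal_Nil) blast
next
  case (Cons t x)
  have t: "t \<in> verts Q" and x: "set x \<subseteq> verts Q" using Cons.prems by auto
  have "a \<in> WI x \<cdot>\<^bsub>L\<^esub> V t" using Cons.prems(2) by (simp add: word_ideal_Cons[OF t x])
  then show ?case
  proof (induction a rule: ideal_prod.induct)
    case (prod i j)
    obtain f g where fg: "f \<in> W x" "i m = to_L f m" "g \<in> carrier A" "g (t, []) = 0" "j m = to_L g m"
      using Cons.IH[OF x prod(1)] vertex_ideal_level[OF t prod(2), of m] by blast
    have "path_mult D f g \<in> W (t # x)" using vmul_mult[OF W_right_ideal fg(1,3,4)] by simp
    then show ?case
      using fg right_ideal_subset[OF W_right_ideal fg(1)] by (intro bexI[of _ "path_mult D f g"]) (simp_all add: L_ops)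
  next
    case (sum s1 s2)
    then obtain f g where fg: "f \<in> W (t # x)" "s1 m = to_L f m" "g \<in> W (t # x)" "s2 m = to_L g m" by blast
    have "(s1 \<oplus>\<^bsub>L\<^esub> s2) m = to_L (f + g) m"
      using fg right_ideal_subset[OF W_right_ideal] by (intro L_ops) blast+
    then show ?case using right_ideal_add[OF W_right_ideal fg(1,3)] by blast
  qed
qed

text \<open>Each letter of the word costs at most one arrow, and witnesses 0 suffice.\<close>

lemma long_paths_W: "length x \<le> m \<Longrightarrow> long_paths m \<subseteq> W x"
proof (induction x arbitrary: m)
  case Nil
  then show ?case by (auto simp: long_paths_def)
next
  case (Cons t x)
  obtain n where m: "m = Suc n" using Cons.prems by (cases m) auto
  show ?case
  proof
    fix f assume f: "f \<in> long_paths m"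
    have "unshift D c f \<in> W x" for c
      using Cons.IH[of n] long_paths_unshift[of f n c] f m Cons.prems by auto
    then have "vertex_part (W x) t f"
      using f m by (auto simp: vertex_part_def long_paths_def shift_linear D.zero_closed intro!: bexI[of _ 0])
    moreover have "f \<in> W x" using Cons.IH[of m] Cons.prems f by auto
    then have "col r f \<in> W x" for r by (rule right_ideal_col[OF W_right_ideal])
    ultimately show "f \<in> W (t # x)" using f by (simp add: vmul_def long_paths_carrier)
  qed
qed

lemma filtration_W:
  assumes "length x \<le> m"
  shows "filtration m \<subseteq> W x"
proof
  fix f assume "f \<in> filtration m"
  then obtain g where "g \<in> long_paths m" "f - g \<in> P" by (auto simp: filtration_def)
  then have "(f - g) + g \<in> W x"
    using long_paths_W[OF assms] right_ideal_P_subset[OF W_right_ideal]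
    by (intro right_ideal_add[OF W_right_ideal]) auto
  then show "f \<in> W x" by simp
qed

text \<open>Agreement at level \<open>length x\<close> already decides membership in
  \<open>W x\<close>, so the passage to the completion loses nothing.\<close>

lemma to_L_word_ideal_iff:
  assumes "set x \<subseteq> verts Q" "f \<in> carrier A"
  shows "to_L f \<in> WI x \<longleftrightarrow> f \<in> W x"
proof
  assume "to_L f \<in> WI x"
  then obtain g where g: "g \<in> W x" "to_L f (length x) = to_L g (length x)"
    using word_ideal_level[OF assms(1), of "to_L f" "length x"] by blast
  then have "f - g \<in> filtration (length x)"
    using assms(2) to_L_eq_iff right_ideal_subset[OF W_right_ideal g(1)] by blast
  then have "f - g \<in> W x" using filtration_W[OF order_refl] by blast
  then show "f \<in> W x" using g(1) right_ideal_diff_iff[OF W_right_ideal] by blast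
qed (rule to_L_word_ideal[OF assms(1)])

end

section \<open>Word ideals are open in the completion\<close>

context preprojective_quiver begin

lemma filtration_mono: "m \<le> n \<Longrightarrow> filtration n \<subseteq> filtration m"
  using long_paths_mono by (fastforce simp: filtration_def)

lemma level_down:
  assumes a: "a \<in> carrier L" and f: "f \<in> carrier A"
  shows "a n = to_L f n \<Longrightarrow> m \<le> n \<Longrightarrow> a m = to_L f m"
proof (induction n)
  case (Suc n)
  show ?case
  proof (cases "m = Suc n")
    case False
    obtain g where g: "g \<in> carrier A" "a n = to_L g n" "a (Suc n) = to_L g (Suc n)"
      using a L_carrier_iff by blast
    then have "g - f \<in> filtration (Suc n)" using Suc.prems(1) g(3) to_L_eq_iff[OF g(1) f, of "Suc n"] by metis
    then have "g - f \<in> filtration n" using filtration_mono[of n "Suc n"] by auto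
    then have "a n = to_L f n" using g(2) to_L_eq_iff[OF g(1) f] by simp
    then show ?thesis using Suc.IH Suc.prems(2) False by simp
  qed (use Suc.prems in simp)
qed simp

lemma ideal_sum_level:
  assumes I: "ideal I L" and "finite C"
    and "\<And>c. c \<in> C \<Longrightarrow> y c \<in> I" and "\<And>c m. c \<in> C \<Longrightarrow> g c m \<in> carrier A \<and> y c m = to_L (g c m) m"
  shows "\<exists>s\<in>I. \<forall>m. s m = to_L (\<Sum>c\<in>C. g c m) m"
proof -
  interpret I: ideal I L by (rule I)
  interpret h: ring_hom_ring A L to_L by (rule to_L_hom)
  have "\<exists>s\<in>I. \<forall>m. (\<Sum>c\<in>C. g c m) \<in> carrier A \<and> s m = to_L (\<Sum>c\<in>C. g c m) m"
    using assms(2-)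
  proof (induction C rule: finite_induct)
    case empty
    have "to_L 0 = \<zero>\<^bsub>L\<^esub>" using h.hom_zero by (simp add: path_algebra_simps(4))
    then show ?case by (intro bexI[of _ "\<zero>\<^bsub>L\<^esub>"]) (simp_all only: sum.empty D.zero_closed I.zero_closed simp_thms)
  next
    case (insert c C)
    then obtain s where s: "s \<in> I" "\<And>m. (\<Sum>c\<in>C. g c m) \<in> carrier A" "\<And>m. s m = to_L (\<Sum>c\<in>C. g c m) m"
      by (metis insertCI)
    have c: "y c \<in> I" "\<And>m. g c m \<in> carrier A" "\<And>m. y c m = to_L (g c m) m"
      using insert.prems by blast+
    have sum: "(\<Sum>c\<in>insert c C. g c m) = g c m + (\<Sum>c\<in>C. g c m)" for m
      by (rule sum.insert[OF insert.hyps])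
    show ?case
    proof (intro bexI allI conjI)
      fix m
      show "(\<Sum>c\<in>insert c C. g c m) \<in> carrier A"
        unfolding sum by (rule D.path_algebra_add_closed[OF c(2) s(2)])
      show "(y c \<oplus>\<^bsub>L\<^esub> s) m = to_L (\<Sum>c\<in>insert c C. g c m) m"
        unfolding sum by (rule L_ops(1)[OF c(2) s(2) c(3) s(3)])
    qed (rule I.a_closed[OF c(1) s(1)])
  qed
  then show ?thesis by blast
qed

text \<open>
  An element that vanishes at level \<open>N + 1\<close> is a convergent sum of long paths, and splitting off
  the first arrow of every path writes it as \<open>\<Sum>\<^sub>c b\<^sub>c c\<close> where \<open>b\<^sub>c\<close> vanishes at level \<open>N\<close>.
\<close>

lemma kernel_word_ideal:
  assumes "set x \<subseteq> verts Q" "a \<in> carrier L" "a (length x) = to_L \<zero>\<^bsub>A\<^esub> (length x)"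
  shows "a \<in> WI x"
  using assms
proof (induction x arbitrary: a)
  case Nil
  then show ?case by (simp add: word_ideal_Nil)
next
  case (Cons t x)
  have t: "t \<in> verts Q" and x: "set x \<subseteq> verts Q" using Cons.prems by auto
  define N where "N = length x"
  have aL: "a \<in> carrier L" and a0: "a (Suc N) = to_L 0 (Suc N)" using Cons.prems by (simp_all add: N_def path_algebra_simps(4) zero_fun_def)
  have "\<forall>m. \<exists>f. f \<in> carrier A \<and> a m = to_L f m \<and> a (Suc m) = to_L f (Suc m)"
    using aL L_carrier_iff by blast
  then obtain F where F: "\<And>m. F m \<in> carrier A" "\<And>m. a m = to_L (F m) m" "\<And>m. a (Suc m) = to_L (F m) (Suc m)"
    by metis
  have "F (Suc m) - F m \<in> filtration (Suc m)" for m
    using F(2)[of "Suc m"] F(3)[of m] to_L_eq_iff[OF F(1)[of "Suc m"] F(1)[of m], of "Suc m"] by metis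
  then have "\<forall>m. \<exists>g. g \<in> long_paths (Suc m) \<and> F (Suc m) - F m - g \<in> P" by (auto simp: filtration_def)
  then obtain G where G: "\<And>m. G m \<in> long_paths (Suc m)" "\<And>m. F (Suc m) - F m - G m \<in> P" by metis
  have "F (Suc N) - 0 \<in> filtration (Suc N)"
    using a0 F(2)[of "Suc N"] to_L_eq_iff[OF F(1) D.zero_closed] by simp
  then obtain G0 where G0: "G0 \<in> long_paths (Suc N)" "F (Suc N) - G0 \<in> P"
    by (auto simp: filtration_def)
  \<comment> \<open>Removing first arrows does not respect the relations: it takes
    \<open>rho\<close> to a signed arrow. The representatives \<open>F\<close> are therefore
    replaced by partial sums of genuinely long paths, congruent to them modulo
    \<open>P\<close>.\<close>
  define H where "H j = G0 + (\<Sum>i<j. G (Suc N + i))" for j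
  have H_Suc: "H (Suc j) = H j + G (Suc N + j)" for j by (simp add: H_def)
  have H_long: "H j \<in> long_paths (Suc N)" for j
  proof (induction j)
    case 0
    then show ?case using G0 by (simp add: H_def)
  next
    case (Suc j)
    have "G (Suc N + j) \<in> long_paths (Suc N)" using G(1) long_paths_mono[of "Suc N" "Suc (Suc N + j)"] by auto
    then show ?case unfolding H_Suc using Suc by (intro long_paths_add)
  qed
  have HA: "H j \<in> carrier A" for j using H_long by (rule long_paths_carrier)
  define congP where "congP f g \<longleftrightarrow> f - g \<in> P" for f g
  have "congP (F (Suc N + j)) (H j)" for j
  proof (induction j)
    case 0
    have "H 0 = G0" by (simp add: H_def)
    then show ?case using G0 by (simp add: congP_def)
  next
    case (Suc j)
    have "F (Suc N + Suc j) - H (Suc j) = (F (Suc (Suc N + j)) - F (Suc N + j) - G (Suc N + j)) + (F (Suc N + j) - H j)"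
      by (simp add: H_Suc)
    then show ?case using right_ideal_add[OF right_ideal_P G(2)] Suc unfolding congP_def by metis
  qed
  then have HP: "F (Suc N + j) - H j \<in> P" for j by (simp add: congP_def)
  have aH: "a (Suc N + j) = to_L (H j) (Suc N + j)" for j
    using F(2)[of "Suc N + j"] to_L_eq_iff[OF F(1) HA] HP P_filtration by blast
  \<comment> \<open>The sum \<open>H j\<close> represents \<open>a\<close> at level
    \<open>Suc N + j\<close>, and removing one arrow lowers the level by one. For \<open>m\<close>
    below \<open>N\<close> the truncated difference selects \<open>H 0\<close>.\<close>
  define b where "b c m = to_L (unshift D c (H (m - N))) m" for c m
  have bL: "b c \<in> carrier L" for c
    unfolding L_carrier_iff
  proof
    fix m
    have "unshift D c (H (m - N)) - unshift D c (H (Suc m - N)) \<in> filtration m"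
    proof (cases "m < N")
      case True
      then show ?thesis using long_paths_filtration[OF long_paths_zero] by simp
    next
      case False
      then obtain j where m: "m = N + j" by (metis le_iff_add not_less)
      have "unshift D c (G (Suc N + j)) \<in> filtration (Suc N + j)"
        using long_paths_unshift[OF G(1)] by (rule long_paths_filtration)
      then have "unshift D c (G (Suc N + j)) \<in> filtration m" using filtration_mono[of m "Suc N + j"] m by auto
      then have "scale (- 1) (unshift D c (G (Suc N + j))) \<in> filtration m"
        using ideal.axioms(1)[OF filtration_ideal] filtration_mult[of "scale (-1) \<one>\<^bsub>A\<^esub>" 0 _ m]
        by (simp only: filtration_0 D.scale_closed D.one_closed path_mult_scale add_0 filtration_carrier D.path_mult_one)
      moreover have "unshift D c (H (m - N)) - unshift D c (H (Suc m - N)) = scale (- 1) (unshift D c (G (Suc N + j)))"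
        unfolding m by (simp add: Suc_diff_le H_Suc unshift_linear)
      ultimately show ?thesis by simp
    qed
    then have "to_L (unshift D c (H (m - N))) m = to_L (unshift D c (H (Suc m - N))) m"
      by (simp add: to_L_eq_iff D.unshift_closed HA)
    then show "\<exists>f\<in>carrier A. b c m = to_L f m \<and> b c (Suc m) = to_L f (Suc m)"
      by (intro bexI[of _ "unshift D c (H (Suc m - N))"]) (simp_all add: b_def D.unshift_closed HA)
  qed
  have "b c N = to_L 0 N" for c
    using long_paths_filtration[OF long_paths_unshift[OF H_long]] to_L_eq_iff[OF D.unshift_closed[OF HA] D.zero_closed]
    by (simp add: b_def)
  then have bW: "b c \<in> WI x" for c using Cons.IH[OF x bL] by (simp add: N_def path_algebra_simps(4) zero_fun_def)
  have I: "ideal (WI (t # x)) L" using Cons.prems by (intro word_ideal_ideal)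
  obtain s where s: "s \<in> WI (t # x)" "\<And>m. s m = to_L (\<Sum>c\<in>arcs D. shift D c (unshift D c (H (m - N)))) m"
  proof -
    have "b c \<otimes>\<^bsub>L\<^esub> to_L (of_arrow D c) \<in> WI (t # x)" if "c \<in> arcs D" for c
      unfolding word_ideal_Cons[OF t x] using bW to_L_arrow[OF that t] by (rule ideal_prod.prod)
    moreover have "shift D c (unshift D c (H (m - N))) \<in> carrier A \<and>
        (b c \<otimes>\<^bsub>L\<^esub> to_L (of_arrow D c)) m = to_L (shift D c (unshift D c (H (m - N)))) m"
      if "c \<in> arcs D" for c m
      using L_ops(2)[of "unshift D c (H (m - N))" "of_arrow D c" "b c" m "to_L (of_arrow D c)"] that
      by (simp add: b_def D.unshift_closed HA D.of_arrow_closed mult_of_arrow D.shift_closed)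
    ultimately show ?thesis
      using ideal_sum_level[OF I D.finite_arcs, of "\<lambda>c. b c \<otimes>\<^bsub>L\<^esub> to_L (of_arrow D c)"
          "\<lambda>c m. shift D c (unshift D c (H (m - N)))"] that by blast
  qed
  have sH: "s m = to_L (H (m - N)) m" for m
  proof -
    have "H j (r, []) = 0" for j r using H_long[of j] by (simp add: long_paths_def)
    then show ?thesis unfolding s(2) using sum_shift_unshift[OF HA] by simp
  qed
  have "a = s"
  proof
    fix m
    show "a m = s m"
    proof (cases "m \<le> N")
      case True
      then have "a m = to_L 0 m" using level_down[OF aL D.zero_closed a0, of m] by (simp add: zero_fun_def)
      moreover have "H 0 \<in> filtration m"
        using long_paths_filtration[OF H_long] filtration_mono[of m "Suc N"] True by auto
      then have "to_L (H 0) m = to_L 0 m" using to_L_eq_iff[OF HA D.zero_closed] by simp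
      ultimately show ?thesis using True by (simp add: sH)
    next
      case False
      \<comment> \<open>At this level \<open>s\<close> uses the partial sum with one more term than
        \<open>a\<close> does; that term only has paths longer than \<open>m\<close>.\<close>
      then obtain j where m: "m = Suc N + j" by (metis Suc_leI le_iff_add not_le)
      have "G (Suc N + j) \<in> filtration m"
        using long_paths_filtration[OF G(1)[of "Suc N + j"]] filtration_mono[of m "Suc (Suc N + j)"] m by auto
      then have "H (Suc j) - H j \<in> filtration m" by (simp add: H_Suc)
      then have "to_L (H (Suc j)) m = to_L (H j) m" using to_L_eq_iff[OF HA HA] by blast
      moreover have "m - N = Suc j" using m by simp
      ultimately show ?thesis using aH[of j] m by (simp add: sH)
    qed
  qed
  then show ?case using s(1) by simp
qed

end

section \<open>Layers\<close>

context ring begin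

context
  fixes I J assumes I: "ideal I R" and J: "ideal J R"
begin

abbreviation (input) quot where "quot \<equiv> quotient_right_module R I J"

lemma quotient_right_module_simps:
  "carrier quot = (\<lambda>x. J +> x) ` I" "\<zero>\<^bsub>quot\<^esub> = J"
  "X \<oplus>\<^bsub>quot\<^esub> Y = X <+> Y"
  by (simp_all add: quotient_right_module_def)

lemma quotient_right_module_add:
  "a \<in> I \<Longrightarrow> b \<in> I \<Longrightarrow> (J +> a) \<oplus>\<^bsub>quot\<^esub> (J +> b) = J +> (a \<oplus> b)"
  using quotient_ops(2)[OF J, of a b] ideal.Icarr[OF I]
  by (simp add: quotient_right_module_simps FactRing_def)

text \<open>All cosets in the defining union coincide, because \<open>J\<close> is closed under
  right multiplication.\<close>

lemma quotient_right_module_smult: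
  assumes a: "a \<in> carrier R" and r: "r \<in> carrier R"
  shows "r \<odot>\<^bsub>quot\<^esub> (J +> a) = J +> (a \<otimes> r)"
proof -
  interpret J: ideal J R by (rule J)
  have "J +> (x \<otimes> r) = J +> (a \<otimes> r)" if "x \<in> J +> a" for x
  proof -
    have x: "x \<in> carrier R" using J.a_elemrcos_carrier[OF a that] .
    have "x \<ominus> a \<in> J" using that J.a_rcos_module_minus[OF ring_axioms a x] by simp
    then have "(x \<ominus> a) \<otimes> r \<in> J" using r by (rule J.I_r_closed)
    then have "x \<otimes> r \<ominus> a \<otimes> r \<in> J"
      using a r x by (simp add: a_minus_def l_distr l_minus)
    then show ?thesis using coset_eq_iff[OF J] a r x by simp
  qed
  moreover have "a \<in> J +> a" using a by (rule J.a_rcos_self)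
  ultimately have "(\<Union>x\<in>J +> a. J +> (x \<otimes> r)) = J +> (a \<otimes> r)" by blast
  then show ?thesis by (simp add: quotient_right_module_def)
qed

lemma annihilated_by_quotient_iff:
  assumes K: "K \<subseteq> carrier R"
  shows "annihilated_by quot K \<longleftrightarrow> (\<forall>a\<in>I. \<forall>r\<in>K. a \<otimes> r \<in> J)"
proof -
  interpret J: ideal J R by (rule J)
  have zero: "J +> x = J \<longleftrightarrow> x \<in> J" if "x \<in> carrier R" for x
    using coset_eq_iff[OF J that zero_closed] J.a_rcos_const[OF J.zero_closed] that
    by (simp add: a_minus_def)
  have "r \<odot>\<^bsub>quot\<^esub> (J +> a) = J \<longleftrightarrow> a \<otimes> r \<in> J" if "a \<in> I" "r \<in> K" for a r
  proof -
    have "a \<in> carrier R" "r \<in> carrier R" using that K ideal.Icarr[OF I] by auto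
    then show ?thesis by (simp add: quotient_right_module_smult zero)
  qed
  then show ?thesis by (simp add: annihilated_by_def quotient_right_module_simps)
qed

lemma quotient_right_module_abelian_monoid: "abelian_monoid quot"
proof (rule abelian_monoidI)
  interpret J: ideal J R by (rule J)
  interpret I: ideal I R by (rule I)
  have zero: "\<zero>\<^bsub>quot\<^esub> = J +> \<zero>" using J.a_rcos_const[OF J.zero_closed] by (simp add: quotient_right_module_simps)
  show "\<zero>\<^bsub>quot\<^esub> \<in> carrier quot" unfolding zero by (simp add: quotient_right_module_simps)
  fix x y assume "x \<in> carrier quot" "y \<in> carrier quot"
  then obtain a b where ab: "a \<in> I" "x = J +> a" "b \<in> I" "y = J +> b"
    by (auto simp: quotient_right_module_simps)
  show "x \<oplus>\<^bsub>quot\<^esub> y \<in> carrier quot"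
    using ab by (simp add: quotient_right_module_add) (simp add: quotient_right_module_simps)
  show "x \<oplus>\<^bsub>quot\<^esub> y = y \<oplus>\<^bsub>quot\<^esub> x"
    using ab by (simp add: quotient_right_module_add a_comm)
  show "\<zero>\<^bsub>quot\<^esub> \<oplus>\<^bsub>quot\<^esub> x = x"
    unfolding zero using ab by (simp add: quotient_right_module_add)
  fix z assume "z \<in> carrier quot"
  then obtain c where "c \<in> I" "z = J +> c" by (auto simp: quotient_right_module_simps)
  then show "x \<oplus>\<^bsub>quot\<^esub> y \<oplus>\<^bsub>quot\<^esub> z = x \<oplus>\<^bsub>quot\<^esub> (y \<oplus>\<^bsub>quot\<^esub> z)"
    using ab by (simp add: quotient_right_module_add a_assoc)
qed

end

end

section \<open>Finite dimension of the layers\<close>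

context preprojective_quiver begin

lemma of_scalar_eq: "of_scalar D t = scale t \<one>\<^bsub>A\<^esub>"
  by (auto simp: of_scalar_def scale_def path_algebra_simps(5) fun_eq_iff)

lemma scalar_closed: "scalar k Q t \<in> carrier L"
  unfolding scalar_def of_scalar_eq by (intro to_L_closed D.scale_closed D.one_closed)

lemma scalar_add: "scalar k Q (s + t) = scalar k Q s \<oplus>\<^bsub>L\<^esub> scalar k Q t"
  unfolding scalar_def of_scalar_eq
  by (simp add: fun_space.scale_left_distrib to_L_add D.scale_closed D.one_closed)

lemma scalar_zero: "scalar k Q 0 = \<zero>\<^bsub>L\<^esub>"
proof -
  interpret h: ring_hom_ring A L to_L by (rule to_L_hom)
  show ?thesis using h.hom_zero by (simp add: scalar_def of_scalar_eq path_algebra_simps(4))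
qed

lemma to_L_scale: "f \<in> carrier A \<Longrightarrow> to_L (scale t f) = to_L f \<otimes>\<^bsub>L\<^esub> scalar k Q t"
  unfolding scalar_def of_scalar_eq
  by (simp add: D.scale_closed D.one_closed path_mult_scale D.path_mult_one flip: to_L_mult)

text \<open>Reduces spanning by cosets with scalars from the completion to linear spans of functions
  over the field, where the library of vector spaces applies.\<close>

lemma finite_dimensionalI:
  assumes I: "ideal I L" and N: "ideal N L"
    and B: "finite B" "B \<subseteq> carrier A" "\<And>b. b \<in> B \<Longrightarrow> to_L b \<in> I"
    and span: "\<And>a. a \<in> I \<Longrightarrow> \<exists>f\<in>fun_space.span B. f \<in> carrier A \<and> a \<ominus>\<^bsub>L\<^esub> to_L f \<in> N"
  shows "finite_dimensional k Q (quotient_right_module L I N)"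
proof -
  let ?M = "quotient_right_module L I N"
  interpret I: ideal I L by (rule I)
  interpret N: ideal N L by (rule N)
  interpret M: abelian_monoid ?M by (rule L.quotient_right_module_abelian_monoid[OF I N])
  interpret h: ring_hom_ring A L to_L by (rule to_L_hom)
  note add = L.quotient_right_module_add[OF I N] and simps = L.quotient_right_module_simps[OF I N]
    and smult = L.quotient_right_module_smult[OF I N]
  let ?c = "\<lambda>a. N +>\<^bsub>L\<^esub> a"
  define C where "C = (\<lambda>b. ?c (to_L b)) ` B"
  have C: "finite C" "C \<subseteq> carrier ?M" using B by (auto simp: C_def simps)
  define comb where "comb t = (\<Oplus>\<^bsub>?M\<^esub>b\<in>C. scalar k Q (t b) \<odot>\<^bsub>?M\<^esub> b)" for t
  have smult_closed: "scalar k Q t \<odot>\<^bsub>?M\<^esub> b \<in> carrier ?M" if "b \<in> carrier ?M" for b t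
    using that scalar_closed I.Icarr I.I_r_closed by (auto simp: simps smult)
  have smult_add: "scalar k Q (s + t) \<odot>\<^bsub>?M\<^esub> b = (scalar k Q s \<odot>\<^bsub>?M\<^esub> b) \<oplus>\<^bsub>?M\<^esub> (scalar k Q t \<odot>\<^bsub>?M\<^esub> b)"
    if b: "b \<in> carrier ?M" for b s t
  proof -
    obtain a where a: "a \<in> I" "b = ?c a" using b by (auto simp: simps)
    then show ?thesis using scalar_closed I.Icarr[OF a(1)] I.I_r_closed[OF a(1)]
      by (simp add: smult scalar_add add L.r_distr)
  qed
  have zero_coset: "?c \<zero>\<^bsub>L\<^esub> = \<zero>\<^bsub>?M\<^esub>" using N.a_rcos_const[OF N.zero_closed] by (simp add: simps)
  have smult_zero: "scalar k Q 0 \<odot>\<^bsub>?M\<^esub> b = \<zero>\<^bsub>?M\<^esub>" if b: "b \<in> carrier ?M" for b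
  proof -
    obtain a where "a \<in> I" "b = ?c a" using b by (auto simp: simps)
    then show ?thesis using I.Icarr by (simp add: smult scalar_zero zero_coset)
  qed
  have comb_add: "comb s \<oplus>\<^bsub>?M\<^esub> comb t = comb (\<lambda>b. s b + t b)" for s t
  proof -
    have "comb (\<lambda>b. s b + t b) = (\<Oplus>\<^bsub>?M\<^esub>b\<in>C. (scalar k Q (s b) \<odot>\<^bsub>?M\<^esub> b) \<oplus>\<^bsub>?M\<^esub> (scalar k Q (t b) \<odot>\<^bsub>?M\<^esub> b))"
      unfolding comb_def using C smult_add by (intro M.finsum_cong') (auto intro!: smult_closed)
    then show ?thesis unfolding comb_def using C by (subst M.finsum_addf[symmetric]) (auto intro!: smult_closed)
  qed
  have comb_single: "comb (\<lambda>b. if b = b0 then t else 0) = scalar k Q t \<odot>\<^bsub>?M\<^esub> b0" if b0: "b0 \<in> C" for b0 t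
  proof -
    have "comb (\<lambda>b. if b = b0 then t else 0)
        = (\<Oplus>\<^bsub>?M\<^esub>b\<in>C. if b0 = b then scalar k Q t \<odot>\<^bsub>?M\<^esub> b else \<zero>\<^bsub>?M\<^esub>)"
      unfolding comb_def using C smult_zero by (intro M.finsum_cong') (auto intro!: smult_closed)
    also have "\<dots> = scalar k Q t \<odot>\<^bsub>?M\<^esub> b0"
      using b0 C by (intro M.add.finprod_singleton) (auto intro!: smult_closed)
    finally show ?thesis .
  qed
  have "\<exists>t. ?c (to_L f) = comb t" if f: "f \<in> fun_space.span B" for f
  proof -
    obtain r where r: "f = (\<Sum>b\<in>B. scale (r b) b)"
      using f fun_space.span_finite[OF B(1)] by auto
    have "\<exists>t. (\<Sum>b\<in>S. scale (r b) b) \<in> carrier A \<and> to_L (\<Sum>b\<in>S. scale (r b) b) \<in> I \<and>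
        ?c (to_L (\<Sum>b\<in>S. scale (r b) b)) = comb t" if "S \<subseteq> B" for S
      using finite_subset[OF that B(1)] that
    proof (induction S rule: finite_induct)
      case empty
      have "comb (\<lambda>_. 0) = (\<Oplus>\<^bsub>?M\<^esub>b\<in>C. \<zero>\<^bsub>?M\<^esub>)"
        unfolding comb_def using C smult_zero by (intro M.finsum_cong') auto
      then have "comb (\<lambda>_. 0) = \<zero>\<^bsub>?M\<^esub>" by simp
      moreover have "to_L 0 = \<zero>\<^bsub>L\<^esub>" using h.hom_zero by (simp add: path_algebra_simps(4))
      ultimately show ?case
        using zero_coset by (intro exI[of _ "\<lambda>_. 0"]) (simp only: sum.empty D.zero_closed I.zero_closed)
    next
      case (insert b S)
      then obtain t where t: "(\<Sum>b\<in>S. scale (r b) b) \<in> carrier A" "to_L (\<Sum>b\<in>S. scale (r b) b) \<in> I"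
        "?c (to_L (\<Sum>b\<in>S. scale (r b) b)) = comb t" by auto
      have b: "b \<in> carrier A" "to_L b \<in> I" "?c (to_L b) \<in> C" using insert.prems B by (auto simp: C_def)
      have rb: "to_L (scale (r b) b) = to_L b \<otimes>\<^bsub>L\<^esub> scalar k Q (r b)" by (rule to_L_scale[OF b(1)])
      have rbI: "to_L (scale (r b) b) \<in> I" unfolding rb using b(2) scalar_closed by (rule I.I_r_closed)
      have eq: "to_L (scale (r b) b + (\<Sum>b\<in>S. scale (r b) b)) = to_L (scale (r b) b) \<oplus>\<^bsub>L\<^esub> to_L (\<Sum>b\<in>S. scale (r b) b)"
        using b t by (simp add: to_L_add D.scale_closed)
      \<comment> \<open>Different elements of \<open>B\<close> may have the same coset, so
        \<open>r b\<close> is added to the coefficient of that coset.\<close>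
      have 1: "?c (to_L (scale (r b) b + (\<Sum>b\<in>S. scale (r b) b)))
          = comb (\<lambda>x. (if x = ?c (to_L b) then r b else 0) + t x)"
        unfolding eq add[OF rbI t(2), symmetric] comb_add[symmetric] comb_single[OF b(3)] t(3)
        using b scalar_closed I.Icarr by (simp add: rb smult)
      have 2: "to_L (scale (r b) b + (\<Sum>b\<in>S. scale (r b) b)) \<in> I"
        unfolding eq by (rule I.a_closed[OF rbI t(2)])
      have 3: "scale (r b) b + (\<Sum>b\<in>S. scale (r b) b) \<in> carrier A"
        by (rule D.path_algebra_add_closed[OF D.scale_closed[OF b(1)] t(1)])
      have sum: "(\<Sum>b\<in>insert b S. scale (r b) b) = scale (r b) b + (\<Sum>b\<in>S. scale (r b) b)"
        by (rule sum.insert[OF insert.hyps])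
      show ?case unfolding sum using 1 2 3 by blast
    qed
    from this[OF order_refl] show ?thesis using r by blast
  qed
  note comb_span = this
  have "\<exists>t. x = comb t" if x: "x \<in> carrier ?M" for x
  proof -
    obtain a where a: "a \<in> I" "x = ?c a" using x by (auto simp: simps)
    obtain f where "f \<in> fun_space.span B" "f \<in> carrier A" "a \<ominus>\<^bsub>L\<^esub> to_L f \<in> N" using span[OF a(1)] by blast
    then show ?thesis
      using comb_span a L.coset_eq_iff[OF N I.Icarr[OF a(1)] to_L_closed] by metis
  qed
  then show ?thesis unfolding finite_dimensional_def using C unfolding comb_def by blast
qed

lemma finite_short_paths: "finite {x \<in> paths D. length (snd x) < m}"
proof -
  have "{x \<in> paths D. length (snd x) < m} \<subseteq> verts D \<times> {p. set p \<subseteq> arcs D \<and> length p \<le> m}"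
    by (auto simp: paths_def pre_digraph.awalk_def)
  moreover have "finite (verts D \<times> {p. set p \<subseteq> arcs D \<and> length p \<le> m})"
    using D.finite_verts D.finite_arcs finite_lists_length_le by blast
  ultimately show ?thesis by (rule finite_subset)
qed

text \<open>Modulo \<open>WI y\<close> only the finitely many paths shorter than
  \<open>length y\<close> matter. Truncation keeps elements inside \<open>W x\<close> because
  \<open>x\<close> is not longer than \<open>y\<close>, and the error vanishes at level
  \<open>length y\<close>, hence lies in \<open>WI y\<close> by
  \<open>kernel_word_ideal\<close>.\<close>

lemma word_ideal_quotient_finite_dimensional:
  assumes x: "set x \<subseteq> verts Q" and y: "set y \<subseteq> verts Q" and xy: "length x \<le> length y"
  shows "finite_dimensional k Q (quotient_right_module L (WI x) (WI y))"
proof -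
  define m where "m = length y"
  define S where "S = {x \<in> paths D. length (snd x) < m}"
  define T where "T = W x \<inter> {f. \<forall>i p. m \<le> length p \<longrightarrow> f (i, p) = 0}"
  have T: "T \<subseteq> fun_space.span (of_path ` S)"
  proof
    fix f assume f: "f \<in> T"
    then have fA: "f \<in> carrier A" using right_ideal_subset[OF W_right_ideal] by (auto simp: T_def)
    have S: "finite S" unfolding S_def by (rule finite_short_paths)
    have fz: "f z = (\<Sum>x\<in>S. scale (f x) (of_path x)) z" for z
    proof -
      have "(\<Sum>x\<in>S. scale (f x) (of_path x)) z = (\<Sum>x\<in>S. if x = z then f z else 0)"
        unfolding sum_fun_apply by (intro sum.cong) (auto simp: scale_def of_path_def)
      also have "\<dots> = (if z \<in> S then f z else 0)" using S by simp
      also have "\<dots> = f z"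
        using f fA by (cases z) (auto simp: S_def T_def path_algebra_simps(1) not_less)
      finally show ?thesis by simp
    qed
    have eq: "f = (\<Sum>x\<in>S. scale (f x) (of_path x))" by (rule ext) (rule fz)
    show "f \<in> fun_space.span (of_path ` S)"
      by (subst eq, intro fun_space.span_sum fun_space.span_scale fun_space.span_base) auto
  qed
  obtain B where B: "B \<subseteq> T" "fun_space.independent B" "T \<subseteq> fun_space.span B"
    using fun_space.maximal_independent_subset[of T] by blast
  have "finite B"
    using fun_space.independent_span_bound[of "of_path ` S" B] B(1,2) T finite_short_paths by (auto simp: S_def)
  have BW: "b \<in> W x" if "b \<in> B" for b using that B(1) by (auto simp: T_def)
  show ?thesis
  proof (rule finite_dimensionalI[OF word_ideal_ideal[OF x] word_ideal_ideal[OF y] \<open>finite B\<close>])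
    show "B \<subseteq> carrier A" using BW right_ideal_subset[OF W_right_ideal] by blast
    show "to_L b \<in> WI x" if "b \<in> B" for b using to_L_word_ideal[OF x BW[OF that]] .
    fix a assume a: "a \<in> WI x"
    then have aL: "a \<in> carrier L" by (rule ideal.Icarr[OF word_ideal_ideal[OF x]])
    obtain f where f: "f \<in> W x" "a m = to_L f m" using word_ideal_level[OF x a] by blast
    have fA: "f \<in> carrier A" by (rule right_ideal_subset[OF W_right_ideal f(1)])
    define g where "g = (\<lambda>(i, p). if length p < m then f (i, p) else 0)"
    have gA: "g \<in> carrier A" by (rule carrier_eqI[OF fA]) (auto simp: g_def split: if_splits)
    have fg: "f - g \<in> long_paths m"
      using right_ideal_minus[OF right_ideal_carrier fA gA] by (auto simp: long_paths_def g_def)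
    then have "f - g \<in> W x" using long_paths_W[of x m] xy by (auto simp: m_def)
    then have "g \<in> W x" using f(1) right_ideal_diff_iff[OF W_right_ideal] by blast
    then have "g \<in> T" by (auto simp: T_def g_def)
    then have "g \<in> fun_space.span B" using B(3) by blast
    moreover have "a \<ominus>\<^bsub>L\<^esub> to_L g \<in> WI y"
    proof (rule kernel_word_ideal[OF y])
      show "a \<ominus>\<^bsub>L\<^esub> to_L g \<in> carrier L" using aL to_L_closed[OF gA] by simp
      interpret h: ring_hom_ring A L to_L by (rule to_L_hom)
      have "a m = to_L g m" using f(2) to_L_eq_iff[OF fA gA] long_paths_filtration[OF fg] by simp
      moreover have "\<ominus>\<^bsub>L\<^esub> to_L g = to_L (\<ominus>\<^bsub>A\<^esub> g)" using gA by simp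
      ultimately have "(a \<oplus>\<^bsub>L\<^esub> (\<ominus>\<^bsub>L\<^esub> to_L g)) m = to_L (g + \<ominus>\<^bsub>A\<^esub> g) m"
        using gA by (intro L_ops(1)) auto
      also have "g + \<ominus>\<^bsub>A\<^esub> g = \<zero>\<^bsub>A\<^esub>" using A.r_neg[OF gA] by (simp add: path_algebra_simps(3))
      finally show "(a \<ominus>\<^bsub>L\<^esub> to_L g) (length y) = to_L \<zero>\<^bsub>A\<^esub> (length y)"
        by (simp add: a_minus_def m_def)
    qed
    ultimately show "\<exists>f\<in>fun_space.span B. f \<in> carrier A \<and> a \<ominus>\<^bsub>L\<^esub> to_L f \<in> WI y" using gA by blast
  qed
qed

end

section \<open>The two implications for layers\<close>

context preprojective_quiver begin

text \<open>Finite dimension is automatic here, so only the annihilation remains, as an inclusion of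
  a product of ideals. Layers are counted from 1, whence \<open>Suc (length x)\<close>.\<close>

lemma layer_in_mod_iff:
  assumes u: "set u \<subseteq> verts Q" "u = x @ i # y" and Q': "verts Q' = verts Q"
  shows "in_mod_path_algebra k Q Q' (layer k Q u (Suc (length x))) \<longleftrightarrow>
    (\<exists>v. admissible_word Q' v \<and> (\<forall>a\<in>WI x. \<forall>r\<in>WI v. a \<otimes>\<^bsub>L\<^esub> r \<in> WI (x @ [i])))"
proof -
  have xi: "set (x @ [i]) \<subseteq> verts Q" "set x \<subseteq> verts Q" using u by auto
  have layer: "layer k Q u (Suc (length x)) = quotient_right_module L (WI x) (WI (x @ [i]))"
    using u(2) by (simp add: layer_def take_Cons')
  have "finite_dimensional k Q (quotient_right_module L (WI x) (WI (x @ [i])))"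
    by (intro word_ideal_quotient_finite_dimensional xi) auto
  moreover have "annihilated_by (quotient_right_module L (WI x) (WI (x @ [i]))) (WI v) \<longleftrightarrow>
      (\<forall>a\<in>WI x. \<forall>r\<in>WI v. a \<otimes>\<^bsub>L\<^esub> r \<in> WI (x @ [i]))" if "admissible_word Q' v" for v
  proof (rule L.annihilated_by_quotient_iff)
    have "set v \<subseteq> verts Q" using that Q' by (simp add: admissible_word_def coxeter_word_def)
    then show "WI v \<subseteq> carrier L" using ideal.Icarr[OF word_ideal_ideal] by blast
  qed (rule word_ideal_ideal[OF xi(2)], rule word_ideal_ideal[OF xi(1)])
  ultimately show ?thesis unfolding in_mod_path_algebra_def layer by blast
qed

lemma ideal_prod_mono: "I \<subseteq> I' \<Longrightarrow> K \<subseteq> K' \<Longrightarrow> I \<cdot>\<^bsub>L\<^esub> K \<subseteq> I' \<cdot>\<^bsub>L\<^esub> K'"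
proof
  fix a assume "I \<subseteq> I'" "K \<subseteq> K'" "a \<in> I \<cdot>\<^bsub>L\<^esub> K"
  from this(3,1,2) show "a \<in> I' \<cdot>\<^bsub>L\<^esub> K'"
    by (induction a rule: ideal_prod.induct) (auto intro: ideal_prod.intros)
qed

text \<open>
  Rotating the Coxeter word is conjugation by \<open>I\<^sub>s\<close>: one has \<open>I\<^sub>s I\<^sub>s\<^sub>v = I\<^sub>v\<^sub>s I\<^sub>s\<close>.
\<close>

lemma sortable_word_layer:
  assumes "sortable_word v u" "set v \<subseteq> verts Q" "u = x @ i # y"
  shows "WI x \<cdot>\<^bsub>L\<^esub> WI v \<subseteq> WI (x @ [i])"
  using assms
proof (induction arbitrary: x rule: sortable_word.induct)
  case (Nil v)
  then show ?case by simp
next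
  case (rotate v s u)
  have s: "s \<in> verts Q" and v: "set v \<subseteq> verts Q" using rotate.prems by auto
  note V = vertex_ideal_ideal[OF s] and Wv = word_ideal_ideal[OF v]
  have "set u \<subseteq> set (v @ [s])" by (rule sortable_word_set[OF rotate.hyps])
  then have u: "set u \<subseteq> verts Q" using s v by auto
  have Ws: "WI (s # v) = WI v \<cdot>\<^bsub>L\<^esub> V s" by (rule word_ideal_Cons[OF s v])
  show ?case
  proof (cases x)
    case Nil
    then have "i = s" using rotate.prems(2) by simp
    have "WI [] \<cdot>\<^bsub>L\<^esub> WI (s # v) = WI (s # v)"
      using word_ideal_ideal[of "s # v"] rotate.prems(1) by (simp add: word_ideal_Nil L.ideal_prod_one_left)
    moreover have "WI (s # v) \<subseteq> V s" unfolding Ws using L.ideal_prod_inter[OF Wv V] by blast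
    moreover have "WI [s] = V s"
      using word_ideal_Cons[OF s, of "[]"] V by (simp add: word_ideal_Nil L.ideal_prod_one_left)
    ultimately show ?thesis using Nil \<open>i = s\<close> by simp
  next
    case (Cons s' x')
    then have ux: "u = x' @ i # y" and x: "x = s # x'" using rotate.prems(2) by auto
    have x': "set x' \<subseteq> verts Q" "set (x' @ [i]) \<subseteq> verts Q" using u ux by auto
    note Wx = word_ideal_ideal[OF x'(1)]
    have "WI x \<cdot>\<^bsub>L\<^esub> WI (s # v) = (WI x' \<cdot>\<^bsub>L\<^esub> V s) \<cdot>\<^bsub>L\<^esub> (WI v \<cdot>\<^bsub>L\<^esub> V s)"
      unfolding x Ws word_ideal_Cons[OF s x'(1)] ..
    also have "\<dots> = (WI x' \<cdot>\<^bsub>L\<^esub> (V s \<cdot>\<^bsub>L\<^esub> WI v)) \<cdot>\<^bsub>L\<^esub> V s"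
      using V Wv Wx by (simp add: L.ideal_prod_assoc L.ideal_prod_is_ideal)
    \<comment> \<open>The regrouped middle factor is the ideal of the rotated Coxeter word; the
      induction hypothesis applies to it, and the outer \<open>V s\<close> is carried along.\<close>
    also have "V s \<cdot>\<^bsub>L\<^esub> WI v = WI (v @ [s])" by (rule word_ideal_snoc[symmetric])
    also have "(WI x' \<cdot>\<^bsub>L\<^esub> WI (v @ [s])) \<cdot>\<^bsub>L\<^esub> V s \<subseteq> WI (x' @ [i]) \<cdot>\<^bsub>L\<^esub> V s"
      using rotate.IH[of x'] ux rotate.prems(1) by (intro ideal_prod_mono) auto
    also have "\<dots> = WI (x @ [i])" using word_ideal_Cons[OF s x'(2)] x by simp
    finally show ?thesis .
  qed
next
  case (skip s u v)
  have s: "s \<in> verts Q" and v: "set v \<subseteq> verts Q" using skip.prems by auto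
  have "WI (s # v) \<subseteq> WI v"
    unfolding word_ideal_Cons[OF s v]
    using L.ideal_prod_inter[OF word_ideal_ideal[OF v] vertex_ideal_ideal[OF s]] by blast
  then have "WI x \<cdot>\<^bsub>L\<^esub> WI (s # v) \<subseteq> WI x \<cdot>\<^bsub>L\<^esub> WI v" by (intro ideal_prod_mono) auto
  then show ?case using skip.IH[OF v skip.prems(2)] by blast
qed

lemma sortable_layers_in_mod:
  assumes Q': "is_orientation Q Q'" and v: "admissible_word Q' v" and u: "sortable_word v u"
    and j: "j \<in> {1..length u}"
  shows "in_mod_path_algebra k Q Q' (layer k Q u j)"
proof -
  have verts: "verts Q' = verts Q" using Q' by (simp add: is_orientation_def)
  have sv: "set v \<subseteq> verts Q" using v verts by (simp add: admissible_word_def coxeter_word_def)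
  have su: "set u \<subseteq> verts Q" using sortable_word_set[OF u] sv by blast
  obtain n where n: "j = Suc n" "n < length u" using j by (cases j) auto
  have ux: "u = take n u @ u ! n # drop (Suc n) u" using n(2) by (rule id_take_nth_drop)
  have len: "length (take n u) = n" using n(2) by simp
  have "\<forall>a\<in>WI (take n u). \<forall>r\<in>WI v. a \<otimes>\<^bsub>L\<^esub> r \<in> WI (take n u @ [u ! n])"
    using sortable_word_layer[OF u sv ux] by (blast intro: ideal_prod.prod)
  then show ?thesis using layer_in_mod_iff[OF su ux verts] v n(1) len by metis
qed

lemma layers_in_mod_sortable:
  assumes Q': "is_orientation Q Q'" and v: "admissible_word Q' v"
    and u: "set u \<subseteq> verts Q" "braid_reduced Q u"
    and layers: "\<And>j. j \<in> {1..length u} \<Longrightarrow> in_mod_path_algebra k Q Q' (layer k Q u j)"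
  shows "\<exists>y. braid_equiv Q u y \<and> sortable_word v y"
proof (rule oriented_layers_sortable)
  have verts: "verts Q' = verts Q" using Q' by (simp add: is_orientation_def)
  show dv: "distinct v" "set v = verts Q"
    using v verts by (simp_all add: admissible_word_def coxeter_word_def)
  fix x i y assume ux: "u = x @ i # y"
  have xi: "set x \<subseteq> verts Q" "set (x @ [i]) \<subseteq> verts Q" using u(1) ux by auto
  have "in_mod_path_algebra k Q Q' (layer k Q u (Suc (length x)))" using ux by (intro layers) auto
  then obtain v' where v': "admissible_word Q' v'"
    "\<And>a r. a \<in> WI x \<Longrightarrow> r \<in> WI v' \<Longrightarrow> a \<otimes>\<^bsub>L\<^esub> r \<in> WI (x @ [i])"
    using layer_in_mod_iff[OF u(1) ux verts] by blast
  have dv': "distinct v'" "set v' = verts Q"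
    using v'(1) verts by (simp_all add: admissible_word_def coxeter_word_def)
  show "oriented_layer v x i"
    unfolding oriented_layer_def
  proof (intro ballI impI)
    fix d f assume d: "d \<in> arcs D" "subseq [head D d, tail D d] v" and f: "f \<in> W x"
    \<comment> \<open>The word \<open>v'\<close> comes from this layer and may differ from
      \<open>v\<close>. But an arrow running against \<open>v\<close> runs against
      \<open>Q'\<close>, and hence against every admissible word.\<close>
    have "(head D d, tail D d) \<in> arcs_ends Q' \<or> (tail D d, head D d) \<in> arcs_ends Q'"
    proof -
      obtain b where b: "b \<in> arcs Q" "d = Inl b \<or> d = Inr b" using d(1) by (auto simp: double_quiver_def)
      then have "b \<in> arcs Q'" "tail Q' b = tail Q b \<and> head Q' b = head Q b \<or> tail Q' b = head Q b \<and> head Q' b = tail Q b"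
        using Q' by (auto simp: is_orientation_def)
      then show ?thesis
        using b(2) by (auto simp: arcs_ends_def arc_to_ends_def double_quiver_def image_iff) metis+
    qed
    moreover have in_v: "tail D d \<in> set v" "head D d \<in> set v"
      using head_tail_in_verts[OF d(1)] dv(2) by auto
    moreover have "\<not> subseq [tail D d, head D d] v" using subseq_pair_asym[OF dv(1) d(2)] .
    ultimately have "(head D d, tail D d) \<in> arcs_ends Q'" using v by (auto simp: admissible_word_iff)
    then have "subseq [head D d, tail D d] v'"
      using v'(1) in_v dv(2) dv'(2) by (auto simp: admissible_word_iff)
    then have "of_arrow D d \<in> W v'" using d(1) dv' by (intro arrow_in_W)
    then have "to_L (of_arrow D d) \<in> WI v'" using dv'(2) by (intro to_L_word_ideal) auto
    then have "to_L f \<otimes>\<^bsub>L\<^esub> to_L (of_arrow D d) \<in> WI (x @ [i])"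
      using to_L_word_ideal[OF xi(1) f] by (intro v'(2))
    moreover have fA: "f \<in> carrier A" by (rule right_ideal_subset[OF W_right_ideal f])
    ultimately have "to_L (shift D d f) \<in> WI (x @ [i])"
      using to_L_mult[OF fA D.of_arrow_closed[OF d(1)]] by (simp add: mult_of_arrow)
    then show "shift D d f \<in> W (x @ [i])"
      using to_L_word_ideal_iff[OF xi(2) D.shift_closed[OF d(1) fA]] by blast
  qed
qed (use u in auto)

end

theorem theorem3p3:
  fixes k :: "'k::alg_closed_field itself"
    and Q :: "('v, 'a) pre_digraph"
    and w :: "'v list set"
    and u :: "'v list"
  assumes "fin_digraph Q"
    and "Digraph_Component.connected Q"
    and "acyclic (arcs_ends Q)"
    and "w \<in> carrier (coxeter_group Q)"
    and "reduced_expression Q w u"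
  shows
    "(\<forall>c v Q'. coxeter_element Q c \<and> reduced_expression Q c v \<and> sortable_expression Q v w u \<and>
        is_orientation Q Q' \<and> acyclic (arcs_ends Q') \<and> admissible Q' c \<longrightarrow>
        (\<forall>j\<in>{1..length u}. in_mod_path_algebra k Q Q' (layer k Q u j)))
     \<and>
     (\<forall>Q'. is_orientation Q Q' \<and> acyclic (arcs_ends Q') \<and>
        (\<forall>j\<in>{1..length u}. in_mod_path_algebra k Q Q' (layer k Q u j)) \<longrightarrow>
        (\<forall>c v. coxeter_element Q c \<and> admissible Q' c \<and> reduced_expression Q c v \<longrightarrow>
           sortable Q v w))"
proof -
  interpret fin_digraph Q by fact
  have "tail Q a \<noteq> head Q a" if a: "a \<in> arcs Q" for a
  proof
    assume "tail Q a = head Q a"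
    then have "(tail Q a, tail Q a) \<in> arcs_ends Q" using in_arcs_imp_in_arcs_ends[OF a] by simp
    then show False using assms(3) by (auto simp: acyclic_def)
  qed
  then interpret preprojective_quiver Q k by unfold_locales
  have admissible_v: "admissible_word Q' v"
    if "is_orientation Q Q'" "admissible Q' c" "reduced_expression Q c v" for Q' c v
    using that by (rule admissible_reduced_expression)
  show ?thesis
  proof (intro conjI allI impI ballI)
    fix c v Q' j
    assume *: "coxeter_element Q c \<and> reduced_expression Q c v \<and> sortable_expression Q v w u \<and>
        is_orientation Q Q' \<and> acyclic (arcs_ends Q') \<and> admissible Q' c" and j: "j \<in> {1..length u}"
    then have v: "admissible_word Q' v" using admissible_v by blast
    then have "distinct v" by (simp add: admissible_word_def coxeter_word_def)
    then have "sortable_word v u" using * sortable_expression_iff by blast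
    then show "in_mod_path_algebra k Q Q' (layer k Q u j)"
      using * v j by (intro sortable_layers_in_mod) auto
  next
    fix Q' c v
    assume Q': "is_orientation Q Q' \<and> acyclic (arcs_ends Q') \<and>
        (\<forall>j\<in>{1..length u}. in_mod_path_algebra k Q Q' (layer k Q u j))"
      and c: "coxeter_element Q c \<and> admissible Q' c \<and> reduced_expression Q c v"
    have v: "admissible_word Q' v" using Q' c admissible_v by blast
    have u: "set u \<subseteq> verts Q" using assms(5) by (auto simp: reduced_expression_def is_expression_iff)
    obtain y where y: "braid_equiv Q u y" "sortable_word v y"
      using layers_in_mod_sortable[OF _ v u reduced_expression_braid_reduced[OF assms(5)]] Q' by blast
    have "reduced_expression Q w y" using assms(5) y(1) by (rule reduced_expression_braid_equiv)
    moreover have "distinct v" using v by (simp add: admissible_word_def coxeter_word_def)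
    ultimately show "sortable Q v w" using y(2) unfolding sortable_def by (auto simp: sortable_expression_iff)
  qed
qed

end
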